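(* Fix a multiparameter basis $\mathcal R^\alpha$, $\alpha=(a_1,\dots,a_j)$. Fix $p\in(1,\infty]$. Then for every matrix weight $W\in\mathcal A_{p,\mathcal R^\alpha}$ and every $f\in L^p(\mathbb R^n;\mathbb R^d)$, $$\|M_{W,\mathcal R^\alpha}f\|_{L^p(\mathbb R^n)}\le C(n,d,p)\,[W]_{\mathcal A_{p,\mathcal R^\alpha}}^{jp'}\,\|f\|_{L^p(\mathbb R^n;\mathbb R^d)}.$$ Moreover, when $p=\infty$, this inequality holds with $[W]_{\mathcal A_{\infty,\mathcal R^\alpha}}$ instead of $[W]_{\mathcal A_{\infty,\mathcal R^\alpha}}^{j}$.
   Context: $\alpha=(a_1,\dots,a_j)$ is a tuple of positive integers with $a_1+\cdots+a_j=n$, and $\mathbb R^n=\mathbb R^{a_1}\times\cdots\times\mathbb R^{a_j}$. The multiparameter basis $\mathcal R^\alpha$ is the collection of all sets $R=Q_1\times\cdots\times Q_j$, where each $Q_i$ is an open cube in $\mathbb R^{a_i}$ with sides parallel to the coordinate axes. Matrix weight: a measurable function $W$ on $\mathbb R^n$ with values in the $d\times d$ real symmetric positive semidefinite matrices, with entries finite a.e. and $W(x)$ invertible for a.e. $x$. $|A|_{\mathrm{op}}=\sup_{|v|=1}|Av|$; $\frac1p+\frac1{p'}=1$ ($p'=1$ if $p=\infty$). For $1<p<\infty$, $W\in\mathcal A_{p,\mathcal R^\alpha}$ means $$[W]_{\mathcal A_{p,\mathcal R^\alpha}}=\sup_{R\in\mathcal R^\alpha}\left(\frac1{|R|}\int_R\left(\frac1{|R|}\int_R|W(x)W^{-1}(y)|_{\mathrm{op}}^{p'}\,dy\right)^{\frac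 p{p'}}dx\right)^{\frac1p}<\infty,$$ and $W\in\mathcal A_{\infty,\mathcal R^\alpha}$ means $[W]_{\mathcal A_{\infty,\mathcal R^\alpha}}=\sup_{R\in\mathcal R^\alpha}\operatorname{ess\,sup}_{x\in R}\frac1{|R|}\int_R|W(x)W^{-1}(y)|_{\mathrm{op}}\,dy<\infty$. The Christ–Goldberg maximal operator is $$M_{W,\mathcal R^\alpha}f(x)=\sup_{R\in\mathcal R^\alpha}\frac1{|R|}\int_R|W(x)W^{-1}(y)f(y)|\,dy\cdot\chi_R(x).$$ *)

theory Defs
  imports "HOL-Analysis.Analysis" "HOL-Probability.Essential_Supremum"
begin

text \<open>
  \<open>\<real>\<^sup>n\<close> is \<^typ>\<open>real ^ 'n\<close> with \<open>n = CARD('n)\<close>, with Lebesgue measure \<^const>\<open>lebesgue\<close>. All integrals and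
  norms are taken in \<^typ>\<open>ennreal\<close>, so that suprema and averages which may be infinite need no side
  condition.
\<close>

text \<open>Real powers of extended nonnegative numbers. Only exponents \<open>r > 0\<close> are used, for which
  \<open>\<infinity> powr r = \<infinity>\<close>.\<close>

definition ennpowr :: "ennreal \<Rightarrow> real \<Rightarrow> ennreal" where
  "ennpowr x r = (if x = \<infinity> then \<infinity> else ennreal (enn2real x powr r))"

definition average :: "(real ^ 'n) set \<Rightarrow> (real ^ 'n \<Rightarrow> ennreal) \<Rightarrow> ennreal" where
  "average R g = (\<integral>\<^sup>+y\<in>R. g y \<partial>lebesgue) / emeasure lebesgue R"

text \<open>The conjugate exponent \<open>p'\<close> of \<open>p \<in> (1, \<infinity>]\<close>, solved from \<open>1 / p + 1 / p' = 1\<close>.\<close>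

definition conj_exp :: "ennreal \<Rightarrow> real" where
  "conj_exp p = (if p = \<infinity> then 1 else enn2real p / (enn2real p - 1))"

text \<open>As for \<^const>\<open>esssup\<close>, the norm of a function that is not measurable is \<open>\<infinity>\<close>.\<close>

definition Lp_norm :: "ennreal \<Rightarrow> (real ^ 'n \<Rightarrow> ennreal) \<Rightarrow> ennreal" where
  "Lp_norm p g =
     (if p = \<infinity> then esssup lebesgue g
      else if g \<in> borel_measurable lebesgue
        then ennpowr (\<integral>\<^sup>+x. ennpowr (g x) (enn2real p) \<partial>lebesgue) (1 / enn2real p)
      else \<infinity>)"

definition Lp_space :: "ennreal \<Rightarrow> (real ^ 'n \<Rightarrow> real ^ 'd) set" where
  "Lp_space p = {f. f \<in> borel_measurable lebesgue \<and> Lp_norm p (\<lambda>x. ennreal (norm (f x))) < \<infinity>}"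

text \<open>
  The splitting \<open>\<real>\<^sup>n = \<real>\<^bsup>a\<^sub>1\<^esup> \<times> \<dots> \<times> \<real>\<^bsup>a\<^sub>j\<^esup>\<close> for \<open>\<alpha> = [a\<^sub>1, \<dots>, a\<^sub>j]\<close> is encoded by a map \<open>blk\<close> that
  sends each of the \<open>n\<close> coordinates to the index, counted from 0, of the factor it belongs to. The
  index type \<open>'n\<close> carries no order, so every assignment with the right block sizes is admitted, not
  only consecutive blocks; this amounts to a permutation of the coordinates.
\<close>

definition factor_blocks :: "nat list \<Rightarrow> ('n::finite \<Rightarrow> nat) \<Rightarrow> bool" where
  "factor_blocks \<alpha> blk \<longleftrightarrow>
     (\<forall>a\<in>set \<alpha>. 0 < a) \<and> sum_list \<alpha> = CARD('n) \<and>
     (\<forall>k. blk k < length \<alpha>) \<and> (\<forall>i<length \<alpha>. card {k. blk k = i} = \<alpha> ! i)"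

text \<open>
  The multiparameter basis: \<open>box c (c + \<dots>)\<close> is the product of the open intervals
  \<open>(c\<^sub>k, c\<^sub>k + s (blk k))\<close>. The side length depends only on the factor, so the coordinates of one factor
  span an open cube.
\<close>

definition multi_basis :: "('n::finite \<Rightarrow> nat) \<Rightarrow> (real ^ 'n) set set" where
  "multi_basis blk = {box c (c + (\<chi> k. s (blk k))) | c s. \<forall>i. 0 < s i}"

definition pos_semidefinite :: "real ^ 'd ^ 'd \<Rightarrow> bool" where
  "pos_semidefinite A \<longleftrightarrow> transpose A = A \<and> (\<forall>v. 0 \<le> v \<bullet> (A *v v))"

definition matrix_weight :: "(real ^ 'n \<Rightarrow> real ^ 'd ^ 'd) \<Rightarrow> bool" where
  "matrix_weight W \<longleftrightarrow>
     W \<in> borel_measurable lebesgue \<and> (\<forall>x. pos_semidefinite (W x)) \<and>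
     (AE x in lebesgue. invertible (W x))"

text \<open>\<open>|W(x) W\<^sup>-\<^sup>1(y)|\<close> in operator norm. The value of \<^const>\<open>matrix_inv\<close> at a singular matrix is
  unspecified, which for a matrix weight concerns only a null set of \<open>y\<close>.\<close>

definition transfer_norm :: "(real ^ 'n \<Rightarrow> real ^ 'd ^ 'd) \<Rightarrow> real ^ 'n \<Rightarrow> real ^ 'n \<Rightarrow> real" where
  "transfer_norm W x y = onorm ((*v) (W x ** matrix_inv (W y)))"

definition Ap_const ::
  "ennreal \<Rightarrow> ('n::finite \<Rightarrow> nat) \<Rightarrow> (real ^ 'n \<Rightarrow> real ^ 'd ^ 'd) \<Rightarrow> ennreal" where
  "Ap_const p blk W =
     (if p = \<infinity> then
        (SUP R\<in>multi_basis blk.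
           esssup (restrict_space lebesgue R)
             (\<lambda>x. average R (\<lambda>y. ennreal (transfer_norm W x y))))
      else
        (SUP R\<in>multi_basis blk.
           ennpowr
             (average R (\<lambda>x.
                ennpowr (average R (\<lambda>y. ennpowr (ennreal (transfer_norm W x y)) (conj_exp p)))
                  (enn2real p / conj_exp p)))
             (1 / enn2real p)))"

definition Ap_weights ::
  "ennreal \<Rightarrow> ('n::finite \<Rightarrow> nat) \<Rightarrow> (real ^ 'n \<Rightarrow> real ^ 'd ^ 'd) set" where
  "Ap_weights p blk = {W. matrix_weight W \<and> Ap_const p blk W < \<infinity>}"

definition christ_goldberg ::
  "('n::finite \<Rightarrow> nat) \<Rightarrow> (real ^ 'n \<Rightarrow> real ^ 'd ^ 'd) \<Rightarrow> (real ^ 'n \<Rightarrow> real ^ 'd) \<Rightarrow> real ^ 'n \<Rightarrow> ennreal"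
  where
  "christ_goldberg blk W f x =
     (SUP R\<in>multi_basis blk.
        average R (\<lambda>y. ennreal (norm ((W x ** matrix_inv (W y)) *v f y))) * indicator R x)"

end

theory Submission
  imports Defs
begin

text \<open>
  The proof replaces the matrices by the scalar kernel \<open>t x y = |W(x) W\<^sup>-\<^sup>1(y)|\<close> in operator norm.
  The only algebra that survives is \<open>t x z \<le> t x y * t y z\<close>. The maximal function of \<open>f\<close> is at most
  the supremum over \<open>R\<close> of the averages of \<open>|f(y)| t x y\<close>.

  Fix a dyadic grid with finitely many scales. For the factor \<open>i\<close> of \<open>\<real>\<^sup>n\<close> let \<open>T i\<close> be the maximal
  operator with kernel \<open>t\<close> over the dyadic boxes that have an arbitrary scale in the coordinates of
  factor \<open>i\<close> and the finest scale in all others. Because \<open>t\<close> is submultiplicative, an average over a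
  dyadic box of arbitrary shape is at most \<open>T 0 (T 1 (\<dots> (T (j - 1) |f|)))\<close> (\<open>iterated_dominates\<close>).
  The boxes used by \<open>T i\<close> belong to the multiparameter basis, so \<open>W\<close> satisfies the \<open>A\<^sub>p\<close> condition
  on them with its own constant \<open>A\<close>.

  Each \<open>T i\<close> satisfies \<open>\<integral> (T i \<phi>)\<^sup>p \<le> C A\<^bsup>p + p'\<^esup> \<integral> \<phi>\<^sup>p\<close>, which is the factor \<open>A\<^bsup>p'\<^esup>\<close> in norm
  (\<open>T_bound\<close>). On every cell \<open>S\<close> the kernel almost factorizes as \<open>t x y \<le> 2 \<tau> S x * \<sigma>(y)\<^bsup>1/p'\<^esup>\<close>,
  where \<open>\<tau> S\<close> has \<open>p\<close>-th power average at most \<open>A\<^sup>p\<close> and \<open>\<sigma>\<close> is a scalar weight that is adapted to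
  \<open>S\<close>. This comes from a basis of \<open>\<real>\<^sup>d\<close> of nearly maximal determinant in the unit ball of
  \<open>u \<mapsto> (average over S of |W\<^sup>-\<^sup>1(y) u|\<^bsup>p'\<^esup>)\<^bsup>1/p'\<^esup>\<close> (\<open>reducing_vectors\<close>). A stopping time then
  selects a sparse family of cells, on which \<open>\<tau> S\<close> contributes \<open>A\<^sup>p\<close> and it remains to sum
  \<open>|S| (mean of \<phi> \<sigma>\<^bsup>1/p'\<^esup>)\<^sup>p\<close>. Every \<open>\<sigma>\<close> obeys an \<open>A\<^sub>\<infinity>\<close> condition with constant \<open>L\<close> comparable to
  \<open>A\<^bsup>p'\<^esup>\<close>, hence a reverse Hoelder inequality with a gain of order \<open>1/L\<close> in the exponent. The sum is
  therefore controlled by a maximal function of \<open>\<phi>\<^sup>r\<close> with \<open>p/r - 1\<close> of order \<open>1/L\<close>, and Doob's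
  inequality costs a factor \<open>L\<close>. The fine cubes are the atoms of the argument: one first averages
  \<open>\<phi>\<^sup>p\<close> and \<open>\<sigma>\<close> over them, so this part consists of finite sums.

  An arbitrary box lies in a dyadic box of comparable size if each coordinate of the grid is either
  left in place or shifted by a third of the largest scale. With Fatou's lemma the range of scales
  is exhausted (\<open>strong_bound\<close>). For \<open>p = \<infinity>\<close> the estimate is immediate, apart from \<open>1 \<le> A\<close> and from
  the measurability of a supremum over uncountably many boxes.
\<close>

section \<open>Nested cells and sparse families\<close>

definition mean :: "'x set \<Rightarrow> ('x \<Rightarrow> real) \<Rightarrow> real" where
  "mean Q g = (\<Sum>y\<in>Q. g y) / card Q"

lemma mean_nonneg: "(\<And>y. y \<in> Q \<Longrightarrow> 0 \<le> g y) \<Longrightarrow> 0 \<le> mean Q g"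
  by (simp add: mean_def sum_nonneg)

lemma mean_singleton [simp]: "mean {x} g = g x"
  by (simp add: mean_def)

lemma mean_add: "mean Q (\<lambda>y. f y + g y) = mean Q f + mean Q g"
  by (simp add: mean_def sum.distrib add_divide_distrib)

lemma mean_divide: "mean Q (\<lambda>y. f y / c) = mean Q f / c"
  by (simp add: mean_def flip: sum_divide_distrib)

lemma mean_mono: "(\<And>y. y \<in> Q \<Longrightarrow> f y \<le> g y) \<Longrightarrow> mean Q f \<le> mean Q g"
  by (simp add: mean_def divide_right_mono sum_mono)

lemma card_times_mean: "finite Q \<Longrightarrow> card Q * mean Q g = (\<Sum>y\<in>Q. g y)"
  by (cases "Q = {}") (auto simp: mean_def)

lemma sum_UN_le:
  fixes f :: "'b \<Rightarrow> real"
  assumes "finite F" "\<And>C. C \<in> F \<Longrightarrow> finite (S C)" "\<And>s. 0 \<le> f s"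
  shows "(\<Sum>s\<in>(\<Union>C\<in>F. S C). f s) \<le> (\<Sum>C\<in>F. \<Sum>s\<in>S C. f s)"
  using assms(1,2)
proof (induction F rule: finite_induct)
  case (insert C F)
  have "(\<Sum>s\<in>S C \<union> (\<Union>C\<in>F. S C). f s) \<le> (\<Sum>s\<in>S C. f s) + (\<Sum>s\<in>(\<Union>C\<in>F. S C). f s)"
    using insert assms(3)
      sum.union_inter[of "S C" "\<Union>C\<in>F. S C" f] sum_nonneg[of "S C \<inter> (\<Union>C\<in>F. S C)" f]
    by auto
  also have "\<dots> \<le> (\<Sum>s\<in>S C. f s) + (\<Sum>C\<in>F. \<Sum>s\<in>S C. f s)" using insert by simp
  finally show ?case using insert by simp
qed simp

text \<open>
  An element of \<open>'x\<close> stands for a cube of the finest scale, and \<open>cell k x\<close> is the set of the finest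
  cubes that share their ancestor of level \<open>k\<close> with \<open>x\<close>. All finest cubes have the same volume, so
  averages over regions turn into counting averages.
\<close>

locale nested_cells =
  fixes cell :: "nat \<Rightarrow> 'x \<Rightarrow> 'x set" and D :: real
  assumes cell_0 [simp]: "cell 0 x = {x}"
    and cell_self [simp]: "x \<in> cell k x"
    and cell_eq: "y \<in> cell k x \<Longrightarrow> cell k y = cell k x"
    and cell_Suc: "cell k x \<subseteq> cell (Suc k) x"
    and finite_cell [simp]: "finite (cell k x)"
    and card_cell_Suc: "card (cell (Suc k) x) \<le> D * card (cell k x)"
    and D_ge: "1 \<le> D"
begin

lemma cell_mono: "i \<le> k \<Longrightarrow> cell i x \<subseteq> cell k x"
  by (rule lift_Suc_mono_le[of "\<lambda>k. cell k x"]) (simp_all add: cell_Suc)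

lemma cell_subset: "y \<in> cell k x \<Longrightarrow> i \<le> k \<Longrightarrow> cell i y \<subseteq> cell k x"
  using cell_mono cell_eq by blast

lemma card_cell_pos [simp]: "0 < card (cell k x)"
  by (metis card_gt_0_iff cell_self empty_iff finite_cell)

lemma cell_nonempty [simp]: "cell k x \<noteq> {}"
  using cell_self by blast

lemma mem_cell_sym: "y \<in> cell k x \<longleftrightarrow> x \<in> cell k y"
  using cell_eq cell_self by metis

text \<open>
  The cells of level below \<open>k\<close> with property \<open>P\<close> that are maximal. Each comes with the level \<open>l\<close> at
  which it is found, since cells of different levels may coincide as sets.
\<close>

lemma stopping_cells:
  fixes P :: "'x set \<Rightarrow> bool"
  obtains F where "finite F" "disjoint F" "\<Union>F \<subseteq> cell k x"
    "\<And>C. C \<in> F \<Longrightarrow> \<exists>l y. l < k \<and> y \<in> cell k x \<and> C = cell l y \<and> P C \<and>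
        (\<forall>i. l < i \<and> i < k \<longrightarrow> \<not> P (cell i y))"
    "\<And>y. y \<in> cell k x \<Longrightarrow> y \<notin> \<Union>F \<Longrightarrow> \<forall>i<k. \<not> P (cell i y)"
proof -
  define G where "G y = {i. i < k \<and> P (cell i y)}" for y
  define F where "F = (\<lambda>y. cell (Max (G y)) y) ` {y \<in> cell k x. G y \<noteq> {}}"
  have fin: "finite (G y)" for y by (simp add: G_def)
  have mx: "Max (G y) < k" "P (cell (Max (G y)) y)" if "G y \<noteq> {}" for y
    using Max_in[OF fin that] by (auto simp: G_def)
  have top: "\<not> P (cell i y)" if "Max (G y) < i" "i < k" for i y
    using that Max_ge[OF fin, of i y] unfolding G_def
    by (metis (mono_tags, lifting) linorder_not_le mem_Collect_eq)
  have le: "Max (G y') \<le> Max (G y)"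
    if "G y \<noteq> {}" "G y' \<noteq> {}" "z \<in> cell (Max (G y)) y" "z \<in> cell (Max (G y')) y'" for y y' z
  proof (rule ccontr)
    assume lt: "\<not> Max (G y') \<le> Max (G y)"
    then have "cell (Max (G y')) y = cell (Max (G y')) y'"
      using that cell_eq cell_mono by (metis linear subsetD)
    then show False using top[of y "Max (G y')"] mx[OF that(2)] lt by auto
  qed
  show ?thesis
  proof (rule that[of F])
    show "finite F" by (simp add: F_def)
    show "disjoint F"
    proof (rule disjointI)
      fix a b assume "a \<in> F" "b \<in> F" "a \<noteq> b"
      then obtain y y' where *: "a = cell (Max (G y)) y" "b = cell (Max (G y')) y'"
        "G y \<noteq> {}" "G y' \<noteq> {}" by (auto simp: F_def)
      show "a \<inter> b = {}"
      proof (rule ccontr)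
        assume "a \<inter> b \<noteq> {}"
        then obtain z where z: "z \<in> a" "z \<in> b" by auto
        then have "Max (G y) = Max (G y')" using le[of y y' z] le[of y' y z] * by auto
        with z * have "a = b" using cell_eq by metis
        with \<open>a \<noteq> b\<close> show False by simp
      qed
    qed
    show "\<Union>F \<subseteq> cell k x"
      unfolding F_def using cell_subset mx(1) by (fastforce dest: less_imp_le)
    show "\<exists>l y. l < k \<and> y \<in> cell k x \<and> C = cell l y \<and> P C \<and>
        (\<forall>i. l < i \<and> i < k \<longrightarrow> \<not> P (cell i y))" if "C \<in> F" for C
      using that mx top unfolding F_def by blast
    show "\<forall>i<k. \<not> P (cell i y)" if "y \<in> cell k x" "y \<notin> \<Union>F" for y
    proof -
      have "G y = {}" using that cell_self unfolding F_def by blast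
      then show ?thesis by (auto simp: G_def)
    qed
  qed
qed

text \<open>
  Chebyshev's inequality.
\<close>

lemma card_Union_large_mean:
  assumes F: "finite F" "disjoint F" "\<Union>F \<subseteq> Q" and Q: "finite Q"
    and g: "\<And>y. y \<in> Q \<Longrightarrow> 0 \<le> g y"
    and big: "\<And>C. C \<in> F \<Longrightarrow> 2 * mean Q g < mean C g"
  shows "card Q \<le> 2 * card (Q - \<Union>F)"
proof -
  have finC: "finite C" if "C \<in> F" for C using that F(3) Q by (meson Union_upper finite_subset order_trans)
  have sumF: "(\<Sum>y\<in>\<Union>F. g y) = (\<Sum>C\<in>F. card C * mean C g)"
    using finC F by (subst sum.Union_disjoint) (auto simp: card_times_mean disjoint_def intro!: sum.cong)
  have cardF: "card (\<Union>F) = (\<Sum>C\<in>F. card C)"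
    using finC F by (intro card_Union_disjoint) (auto simp: disjoint_def pairwise_def disjnt_def)
  have m0: "0 \<le> mean Q g" using g by (rule mean_nonneg)
  have ne: "0 < card C" if "C \<in> F" for C
    using big[OF that] m0 finC[OF that] by (auto simp: mean_def card_gt_0_iff)
  have "2 * card (\<Union>F) \<le> card Q"
  proof (cases "mean Q g = 0")
    case True
    have "F = {}"
    proof (rule ccontr)
      assume "F \<noteq> {}"
      then obtain C where C: "C \<in> F" by auto
      have "(\<Sum>y\<in>Q. g y) = 0" using True card_times_mean[OF Q, of g] by simp
      then have "\<forall>y\<in>Q. g y = 0" using sum_nonneg_eq_0_iff[OF Q, of g] g by auto
      then have "(\<Sum>y\<in>C. g y) = 0" using C F(3) by (intro sum.neutral) auto
      moreover have "0 < mean C g" using big[OF C] True by simp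
      ultimately show False by (simp add: mean_def)
    qed
    then show ?thesis by simp
  next
    case False
    then have pos: "0 < mean Q g" using m0 by simp
    have "2 * card (\<Union>F) * mean Q g = (\<Sum>C\<in>F. card C * (2 * mean Q g))"
      by (simp add: cardF sum_distrib_left sum_distrib_right mult_ac)
    also have "\<dots> \<le> (\<Sum>C\<in>F. card C * mean C g)"
      using big by (intro sum_mono mult_left_mono) (auto intro: less_imp_le)
    also have "\<dots> = (\<Sum>y\<in>\<Union>F. g y)" using sumF by simp
    also have "\<dots> \<le> (\<Sum>y\<in>Q. g y)" using F Q g by (intro sum_mono2) auto
    also have "\<dots> = card Q * mean Q g" using Q by (simp add: card_times_mean)
    finally have "real (2 * card (\<Union>F)) \<le> real (card Q)" using pos by simp
    then show ?thesis by linarith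
  qed
  moreover have "card (Q - \<Union>F) = card Q - card (\<Union>F)"
    using F Q by (intro card_Diff_subset) (auto intro: finite_subset)
  ultimately show ?thesis by simp
qed

text \<open>
  Stop at the maximal cells where the mean of \<open>a Q\<close> exceeds twice its mean over \<open>Q\<close>, and repeat
  below each of them with its own function \<open>a C\<close>. The function may change at every stopping cell
  because the next generation only looks at the cell where it starts. Half of each cell \<open>S\<close> is free
  of further stopping cells, and on this half every \<open>\<Gamma> S\<close> is below the maximum of \<open>\<Gamma>\<close> over the cells
  through the point; this is how sparseness is expressed in the last clause.
\<close>

lemma sparse_domination:
  fixes a :: "'x set \<Rightarrow> 'x \<Rightarrow> real"
  assumes a: "\<And>S y. 0 \<le> a S y"
  shows "\<exists>\<S>. finite \<S> \<and> (\<forall>S\<in>\<S>. \<exists>i\<le>k. \<exists>y\<in>cell k x. S = cell i y) \<and>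
    (\<forall>y\<in>cell k x. \<forall>i\<le>k. \<exists>S\<in>\<S>. cell i y \<subseteq> S \<and> mean (cell i y) (a S) \<le> 2 * mean S (a S)) \<and>
    (\<forall>\<Gamma>::'x set \<Rightarrow> real. (\<forall>Q. 0 \<le> \<Gamma> Q) \<longrightarrow>
       (\<Sum>S\<in>\<S>. card S * \<Gamma> S) \<le> 2 * (\<Sum>y\<in>cell k x. Max ((\<lambda>i. \<Gamma> (cell i y)) ` {..k})))"
proof (induction k arbitrary: x rule: less_induct)
  case (less k x)
  let ?Q = "cell k x"
  let ?M = "\<lambda>\<Gamma>::'x set \<Rightarrow> real. \<lambda>l y. Max ((\<lambda>i. \<Gamma> (cell i y)) ` {..l})"
  obtain F where F: "finite F" "disjoint F" "\<Union>F \<subseteq> ?Q"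
    and stop: "\<And>C. C \<in> F \<Longrightarrow> \<exists>l y. l < k \<and> y \<in> ?Q \<and> C = cell l y \<and> 2 * mean ?Q (a ?Q) < mean C (a ?Q) \<and>
        (\<forall>i. l < i \<and> i < k \<longrightarrow> \<not> 2 * mean ?Q (a ?Q) < mean (cell i y) (a ?Q))"
    and go: "\<And>y. y \<in> ?Q \<Longrightarrow> y \<notin> \<Union>F \<Longrightarrow> \<forall>i<k. \<not> 2 * mean ?Q (a ?Q) < mean (cell i y) (a ?Q)"
    using stopping_cells[of k x "\<lambda>C. 2 * mean ?Q (a ?Q) < mean C (a ?Q)"] by metis
  obtain l r where lr: "\<And>C. C \<in> F \<Longrightarrow> l C < k \<and> r C \<in> ?Q \<and> C = cell (l C) (r C) \<and>
      (\<forall>i. l C < i \<and> i < k \<longrightarrow> \<not> 2 * mean ?Q (a ?Q) < mean (cell i (r C)) (a ?Q))"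
    using stop by metis
  have lC: "l C < k" if "C \<in> F" for C using lr[OF that] by blast
  have C_eq: "cell (l C) (r C) = C" if "C \<in> F" for C using lr[OF that] by metis
  have CQ: "C \<subseteq> ?Q" if "C \<in> F" for C using F that by blast
  have up: "\<not> 2 * mean ?Q (a ?Q) < mean (cell i (r C)) (a ?Q)" if "C \<in> F" "l C < i" "i < k" for C i
    using lr[OF that(1)] that(2,3) by blast
  have stop_mean: "2 * mean ?Q (a ?Q) < mean C (a ?Q)" if "C \<in> F" for C
    using stop[OF that] by blast
  define good where "good C \<S> \<longleftrightarrow> finite \<S> \<and> (\<forall>S\<in>\<S>. \<exists>i\<le>l C. \<exists>y\<in>C. S = cell i y) \<and>
      (\<forall>y\<in>C. \<forall>i\<le>l C. \<exists>S\<in>\<S>. cell i y \<subseteq> S \<and> mean (cell i y) (a S) \<le> 2 * mean S (a S)) \<and>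
      (\<forall>\<Gamma>::'x set \<Rightarrow> real. (\<forall>Q. 0 \<le> \<Gamma> Q) \<longrightarrow>
         (\<Sum>S\<in>\<S>. card S * \<Gamma> S) \<le> 2 * (\<Sum>y\<in>C. ?M \<Gamma> (l C) y))" for C \<S>
  have "\<exists>\<S>. good C \<S>" if "C \<in> F" for C
    using less[of "l C" "r C", unfolded C_eq[OF that], OF lC[OF that]] unfolding good_def .
  then obtain S' where good: "\<And>C. C \<in> F \<Longrightarrow> good C (S' C)" by metis
  have S'1: "finite (S' C)" if "C \<in> F" for C
    using good[OF that] by (simp add: good_def)
  have S'2: "\<exists>i\<le>l C. \<exists>y\<in>C. S = cell i y" if "C \<in> F" "S \<in> S' C" for C S
    using good[OF that(1)] that(2) by (simp add: good_def)
  have S'3: "\<exists>S\<in>S' C. cell i y \<subseteq> S \<and> mean (cell i y) (a S) \<le> 2 * mean S (a S)"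
    if "C \<in> F" "y \<in> C" "i \<le> l C" for C y i
    using good[OF that(1)] that(2,3) by (simp add: good_def)
  have S'4: "(\<Sum>S\<in>S' C. card S * \<Gamma> S) \<le> 2 * (\<Sum>y\<in>C. ?M \<Gamma> (l C) y)"
    if "C \<in> F" "\<forall>Q. 0 \<le> \<Gamma> Q" for C and \<Gamma> :: "'x set \<Rightarrow> real"
    using good[OF that(1)] that(2) by (simp add: good_def)
  define \<S> where "\<S> = insert ?Q (\<Union>C\<in>F. S' C)"
  show ?case
  proof (intro exI[of _ \<S>] conjI ballI allI impI)
    show "finite \<S>" using F S'1 by (simp add: \<S>_def)
  next
    fix S assume "S \<in> \<S>"
    then consider "S = ?Q" | C where "C \<in> F" "S \<in> S' C" by (auto simp: \<S>_def)
    then show "\<exists>i\<le>k. \<exists>y\<in>cell k x. S = cell i y"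
    proof cases
      case 1 then show ?thesis using cell_self by blast
    next
      case 2
      then obtain i y where "i \<le> l C" "y \<in> C" "S = cell i y" using S'2[OF 2] by blast
      moreover have "l C < k" "C \<subseteq> ?Q" using lC CQ 2(1) by auto
      ultimately have "i \<le> k" "y \<in> ?Q" by auto
      with \<open>S = cell i y\<close> show ?thesis by blast
    qed
  next
    fix y i assume y: "y \<in> cell k x" and i: "i \<le> k"
    show "\<exists>S\<in>\<S>. cell i y \<subseteq> S \<and> mean (cell i y) (a S) \<le> 2 * mean S (a S)"
    proof (cases "\<exists>C\<in>F. y \<in> C \<and> i \<le> l C")
      case True
      then obtain C where C: "C \<in> F" "y \<in> C" "i \<le> l C" by auto
      then show ?thesis using S'3[OF C] unfolding \<S>_def by blast
    next
      case False
      have "mean (cell i y) (a ?Q) \<le> 2 * mean ?Q (a ?Q)"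
      proof (cases "i = k")
        case True
        then have "cell i y = ?Q" using cell_eq y by simp
        then show ?thesis using mean_nonneg[of ?Q "a ?Q"] a by simp
      next
        case ik: False
        show ?thesis
        proof (cases "y \<in> \<Union>F")
          case True
          then obtain C where C: "C \<in> F" "y \<in> C" by auto
          have li: "l C < i" using C False by (meson not_le)
          have "y \<in> cell i (r C)"
            using cell_mono[of "l C" i "r C"] C(2) li unfolding C_eq[OF C(1)] by auto
          then have "cell i y = cell i (r C)" by (rule cell_eq)
          moreover have "i < k" using ik i by simp
          ultimately show ?thesis using up[OF C(1) li] by simp
        next
          case False
          have "i < k" using ik i by simp
          then show ?thesis using go[OF y False] by (simp add: not_less)
        qed
      qed
      moreover have "cell i y \<subseteq> ?Q" using cell_subset y i by blast
      ultimately show ?thesis by (auto simp: \<S>_def)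
    qed
  next
    fix \<Gamma> :: "'x set \<Rightarrow> real" assume \<Gamma>: "\<forall>Q. 0 \<le> \<Gamma> Q"
    have M: "\<Gamma> (cell i y) \<le> ?M \<Gamma> k y" if "i \<le> k" for i y
      using that by (intro Max_ge) auto
    have MQ: "\<Gamma> ?Q \<le> ?M \<Gamma> k y" if "y \<in> ?Q" for y
      using M[of k y] unfolding cell_eq[OF that] by simp
    have half: "card ?Q \<le> 2 * card (?Q - \<Union>F)"
      using F stop_mean a by (intro card_Union_large_mean[of F ?Q "a ?Q"]) auto
    have "card ?Q * \<Gamma> ?Q \<le> 2 * card (?Q - \<Union>F) * \<Gamma> ?Q"
      using half \<Gamma> by (intro mult_right_mono) (auto simp flip: of_nat_mult)
    also have "\<dots> = 2 * (\<Sum>y\<in>?Q - \<Union>F. \<Gamma> ?Q)" by simp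
    also have "\<dots> \<le> 2 * (\<Sum>y\<in>?Q - \<Union>F. ?M \<Gamma> k y)"
      using MQ by (intro mult_left_mono sum_mono) auto
    finally have 1: "card ?Q * \<Gamma> ?Q \<le> 2 * (\<Sum>y\<in>?Q - \<Union>F. ?M \<Gamma> k y)" .
    have "(\<Sum>S\<in>(\<Union>C\<in>F. S' C). card S * \<Gamma> S) \<le> (\<Sum>C\<in>F. \<Sum>S\<in>S' C. card S * \<Gamma> S)"
      using F S'1 \<Gamma> by (intro sum_UN_le) auto
    also have "\<dots> \<le> (\<Sum>C\<in>F. 2 * (\<Sum>y\<in>C. ?M \<Gamma> k y))"
    proof (rule sum_mono)
      fix C assume C: "C \<in> F"
      have "(\<Sum>y\<in>C. ?M \<Gamma> (l C) y) \<le> (\<Sum>y\<in>C. ?M \<Gamma> k y)"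
        using lC[OF C] by (intro sum_mono Max_mono) auto
      then show "(\<Sum>S\<in>S' C. card S * \<Gamma> S) \<le> 2 * (\<Sum>y\<in>C. ?M \<Gamma> k y)"
        using S'4[OF C \<Gamma>] by linarith
    qed
    also have "\<dots> = 2 * (\<Sum>y\<in>\<Union>F. ?M \<Gamma> k y)"
      using F CQ finite_subset[of _ ?Q]
      by (subst sum.Union_disjoint) (auto simp: sum_distrib_left disjoint_def)
    finally have 2: "(\<Sum>S\<in>(\<Union>C\<in>F. S' C). card S * \<Gamma> S) \<le> 2 * (\<Sum>y\<in>\<Union>F. ?M \<Gamma> k y)" .
    have "(\<Sum>S\<in>\<S>. card S * \<Gamma> S) \<le> card ?Q * \<Gamma> ?Q + (\<Sum>S\<in>(\<Union>C\<in>F. S' C). card S * \<Gamma> S)"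
      unfolding \<S>_def using F(1) S'1 \<Gamma> by (subst sum.insert_if) auto
    also have "\<dots> \<le> 2 * ((\<Sum>y\<in>?Q - \<Union>F. ?M \<Gamma> k y) + (\<Sum>y\<in>\<Union>F. ?M \<Gamma> k y))"
      using 1 2 by simp
    also have "(\<Sum>y\<in>?Q - \<Union>F. ?M \<Gamma> k y) + (\<Sum>y\<in>\<Union>F. ?M \<Gamma> k y) = (\<Sum>y\<in>?Q. ?M \<Gamma> k y)"
      using F by (intro sum.subset_diff[symmetric]) auto
    finally show "(\<Sum>S\<in>\<S>. card S * \<Gamma> S) \<le> 2 * (\<Sum>y\<in>?Q. ?M \<Gamma> k y)" .
  qed
qed

end

section \<open>Doob's inequality and the reverse Hoelder inequality for cells\<close>

lemma mean_Holder:
  fixes f g :: "'x \<Rightarrow> real"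
  assumes rs: "1 < r" "1 < s" "1 / r + 1 / s = 1" and S: "finite S"
    and f: "\<And>y. y \<in> S \<Longrightarrow> 0 \<le> f y" and g: "\<And>y. y \<in> S \<Longrightarrow> 0 \<le> g y"
  shows "mean S (\<lambda>y. f y * g y) \<le>
    mean S (\<lambda>y. f y powr r) powr (1 / r) * mean S (\<lambda>y. g y powr s) powr (1 / s)"
proof -
  define A where "A = mean S (\<lambda>y. f y powr r)"
  define B where "B = mean S (\<lambda>y. g y powr s)"
  have A0: "0 \<le> A" and B0: "0 \<le> B" by (auto simp: A_def B_def intro: mean_nonneg)
  have zero: "mean S (\<lambda>y. f y * g y) = 0" if "S = {} \<or> A = 0 \<or> B = 0"
  proof -
    have "\<forall>y\<in>S. f y * g y = 0"
      using that S unfolding A_def B_def mean_def by (auto simp: sum_nonneg_eq_0_iff)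
    then show ?thesis by (simp add: mean_def sum.neutral)
  qed
  show ?thesis
  proof (cases "S = {} \<or> A = 0 \<or> B = 0")
    case True
    then show ?thesis using zero by simp
  next
    case False
    then have pos: "0 < A" "0 < B" "S \<noteq> {}" using A0 B0 by auto
    define a where "a = A powr (1 / r)"
    define b where "b = B powr (1 / s)"
    have ab: "0 < a" "0 < b" "a powr r = A" "b powr s = B"
      using pos rs by (auto simp: a_def b_def powr_powr)
    have "f y / a * (g y / b) \<le> f y powr r / A / r + g y powr s / B / s" if "y \<in> S" for y
      using Youngs_inequality[OF rs, of "f y / a" "g y / b"] f[OF that] g[OF that] ab
      by (simp add: powr_divide)
    then have "mean S (\<lambda>y. f y / a * (g y / b)) \<le> mean S (\<lambda>y. f y powr r / A / r + g y powr s / B / s)"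
      by (rule mean_mono)
    also have "\<dots> = A / A / r + B / B / s"
      by (simp add: mean_add mean_divide A_def B_def)
    also have "\<dots> = 1" using pos rs by simp
    finally have "mean S (\<lambda>y. f y / a * (g y / b)) \<le> 1" .
    moreover have "mean S (\<lambda>y. f y / a * (g y / b)) = mean S (\<lambda>y. f y * g y) / (a * b)"
      unfolding mean_def by (simp add: mult_ac flip: sum_divide_distrib)
    ultimately show ?thesis
      using ab by (simp add: a_def b_def A_def B_def divide_le_eq)
  qed
qed

text \<open>
  Burkholder's function \<open>U(a, M) = M\<^bsup>q - 1\<^esup> (M - q' a)\<close> does not increase when the running maximum
  \<open>M\<close> is updated by the new value \<open>a\<close>; this is Young's inequality.
\<close>

lemma Burkholder_majorant:
  fixes a M q :: real
  assumes "1 < q" "0 \<le> a" "0 \<le> M"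
  defines "q' \<equiv> q / (q - 1)"
  shows "max a M powr (q - 1) * (max a M - q' * a) \<le> M powr (q - 1) * (M - q' * a)"
proof (cases "a \<le> M")
  case True then show ?thesis by (simp add: max_def)
next
  case False
  have q': "1 < q'" "1 / q + 1 / q' = 1" "(q - 1) * q' = q" "q' / q = q' - 1"
    using assms(1) unfolding q'_def by (auto simp: field_simps)
  have "a * M powr (q - 1) \<le> a powr q / q + (M powr (q - 1)) powr q' / q'"
    using assms q' by (intro Youngs_inequality) auto
  then have "q' * (a * M powr (q - 1)) \<le> q' * (a powr q / q + M powr q / q')"
    using q' by (intro mult_left_mono) (auto simp: powr_powr)
  also have "\<dots> = (q' - 1) * a powr q + M powr q"
    using q' by (simp add: distrib_left flip: q'(4))
  finally have "a powr q * (1 - q') \<le> M powr q - q' * (a * M powr (q - 1))"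
    by (simp add: algebra_simps)
  moreover have "a powr q = a powr (q - 1) * a" "M powr q = M powr (q - 1) * M"
    using powr_mult_base[of a "q - 1"] powr_mult_base[of M "q - 1"] assms by (auto simp: mult.commute)
  ultimately show ?thesis using False by (simp add: max_def algebra_simps)
qed

context nested_cells
begin

text \<open>
  Averaging over cells of one level is a self-adjoint projection.
\<close>

lemma sum_mean_cells:
  assumes "i \<le> k" and h: "\<And>y z. z \<in> cell i y \<Longrightarrow> h z = h y"
  shows "(\<Sum>y\<in>cell k x. h y * mean (cell i y) g) = (\<Sum>y\<in>cell k x. h y * g y)"
proof -
  let ?Q = "cell k x"
  have "(\<Sum>y\<in>?Q. h y * mean (cell i y) g) =
    (\<Sum>y\<in>?Q. \<Sum>z\<in>?Q. if z \<in> cell i y then h y * g z / card (cell i y) else 0)"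
  proof (rule sum.cong[OF refl])
    fix y assume "y \<in> ?Q"
    then have "?Q \<inter> cell i y = cell i y" using cell_subset assms(1) by blast
    then have "(\<Sum>z\<in>?Q. if z \<in> cell i y then h y * g z / card (cell i y) else 0) =
        (\<Sum>z\<in>cell i y. h y * g z / card (cell i y))"
      by (simp flip: sum.inter_restrict)
    then show "h y * mean (cell i y) g =
        (\<Sum>z\<in>?Q. if z \<in> cell i y then h y * g z / card (cell i y) else 0)"
      by (simp add: mean_def sum_distrib_left sum_divide_distrib)
  qed
  also have "\<dots> = (\<Sum>z\<in>?Q. \<Sum>y\<in>?Q. if y \<in> cell i z then h z * g z / card (cell i z) else 0)"
    using h cell_eq mem_cell_sym
    by (subst sum.swap, intro sum.cong refl) (smt (verit, best))
  also have "\<dots> = (\<Sum>z\<in>?Q. h z * g z)"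
  proof (rule sum.cong[OF refl])
    fix z assume "z \<in> ?Q"
    then have "?Q \<inter> cell i z = cell i z" using cell_subset assms(1) by blast
    then have "(\<Sum>y\<in>?Q. if y \<in> cell i z then h z * g z / card (cell i z) else 0) =
        (\<Sum>y\<in>cell i z. h z * g z / card (cell i z))"
      by (simp flip: sum.inter_restrict)
    then show "(\<Sum>y\<in>?Q. if y \<in> cell i z then h z * g z / card (cell i z) else 0) = h z * g z"
      by (simp add: card_gt_0_iff)
  qed
  finally show ?thesis .
qed

text \<open>
  Run from the coarsest level \<open>k\<close> down to level \<open>0\<close> and let \<open>V i\<close> be the maximum of the means met so
  far. The sum of Burkholder's function of the current mean and \<open>V i\<close> can only decrease on the way,
  and it starts out nonpositive. At level \<open>0\<close> this gives \<open>\<Sum> V\<^sup>q \<le> q' \<Sum> V\<^bsup>q - 1\<^esup> \<psi>\<close>, and Young's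
  inequality absorbs \<open>V\<close>.
\<close>

lemma Doob_maximal:
  assumes q: "1 < q" and \<psi>: "\<And>y. 0 \<le> \<psi> y"
  shows "(\<Sum>y\<in>cell k x. (Max ((\<lambda>i. mean (cell i y) \<psi>) ` {..k})) powr q)
     \<le> (q / (q - 1)) powr q * (\<Sum>y\<in>cell k x. \<psi> y powr q)"
proof -
  define q' where "q' = q / (q - 1)"
  have q': "1 < q'" "1 / q + 1 / q' = 1" "(q - 1) * q' = q"
    using q unfolding q'_def by (auto simp: field_simps)
  let ?Q = "cell k x"
  define V where "V i y = Max ((\<lambda>l. mean (cell l y) \<psi>) ` {i..k})" for i y
  define S where "S i = (\<Sum>y\<in>?Q. V i y powr (q - 1) * (V i y - q' * mean (cell i y) \<psi>))" for i
  have m0: "0 \<le> mean C \<psi>" for C using \<psi> by (intro mean_nonneg)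
  have V0: "0 \<le> V i y" if "i \<le> k" for i y
    unfolding V_def using that m0 by (subst Max_ge_iff) auto
  have V_cell: "V i z = V i y" if "z \<in> cell i y" for i y z
  proof -
    have "cell l z = cell l y" if "i \<le> l" for l
      using cell_eq cell_mono[OF that] \<open>z \<in> cell i y\<close> by blast
    then show ?thesis unfolding V_def by (intro arg_cong[where f = Max] image_cong) auto
  qed
  have V_Suc: "V i y = max (mean (cell i y) \<psi>) (V (Suc i) y)" if "i < k" for i y
  proof -
    have "{i..k} = insert i {Suc i..k}" using that by auto
    then show ?thesis unfolding V_def using that by (simp add: Max_insert)
  qed
  have S_mono: "S i \<le> S (Suc i)" if "i < k" for i
  proof -
    have "S i \<le> (\<Sum>y\<in>?Q. V (Suc i) y powr (q - 1) * (V (Suc i) y - q' * mean (cell i y) \<psi>))"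
      unfolding S_def V_Suc[OF that] q'_def using that V0[of "Suc i"] m0 q
      by (intro sum_mono Burkholder_majorant) auto
    also have "\<dots> = (\<Sum>y\<in>?Q. V (Suc i) y powr (q - 1) * V (Suc i) y)
        - q' * (\<Sum>y\<in>?Q. V (Suc i) y powr (q - 1) * mean (cell i y) \<psi>)"
      by (simp add: right_diff_distrib sum_subtractf sum_distrib_left mult_ac)
    also have "(\<Sum>y\<in>?Q. V (Suc i) y powr (q - 1) * mean (cell i y) \<psi>)
        = (\<Sum>y\<in>?Q. V (Suc i) y powr (q - 1) * \<psi> y)"
      using that V_cell cell_Suc by (intro sum_mean_cells) (auto, metis subsetD)
    also have "\<dots> = (\<Sum>y\<in>?Q. V (Suc i) y powr (q - 1) * mean (cell (Suc i) y) \<psi>)"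
      using that V_cell[of _ "Suc i"] by (intro sum_mean_cells[symmetric]) auto
    finally show ?thesis
      by (simp add: S_def right_diff_distrib sum_subtractf sum_distrib_left mult_ac)
  qed
  have "S 0 \<le> S k"
    by (rule inc_induct[of 0 k "\<lambda>i. S i \<le> S k"]) (auto intro: order_trans[OF S_mono])
  also have "S k \<le> 0"
    unfolding S_def V_def using m0 q' mult_right_mono[of 1 q' "mean _ \<psi>"]
    by (intro sum_nonpos mult_nonneg_nonpos) auto
  finally have "S 0 \<le> 0" .
  then have 1: "(\<Sum>y\<in>?Q. V 0 y powr q) \<le> (\<Sum>y\<in>?Q. (q' * \<psi> y) * V 0 y powr (q - 1))"
    using powr_mult_base[OF V0, of 0 _ "q - 1"]
    by (simp add: S_def right_diff_distrib sum_subtractf mult_ac)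
  have "(q' * \<psi> y) * V 0 y powr (q - 1) \<le> q' powr q * \<psi> y powr q / q + V 0 y powr q / q'" for y
    using Youngs_inequality[OF q q'(1,2), of "q' * \<psi> y" "V 0 y powr (q - 1)"] \<psi>[of y] q'
    by (simp add: powr_powr powr_mult)
  then have "(\<Sum>y\<in>?Q. (q' * \<psi> y) * V 0 y powr (q - 1)) \<le>
     (\<Sum>y\<in>?Q. q' powr q * \<psi> y powr q / q + V 0 y powr q / q')"
    by (intro sum_mono) auto
  also have "\<dots> = q' powr q / q * (\<Sum>y\<in>?Q. \<psi> y powr q) + (\<Sum>y\<in>?Q. V 0 y powr q) / q'"
    by (simp add: sum.distrib sum_distrib_left sum_divide_distrib)
  finally have "(\<Sum>y\<in>?Q. V 0 y powr q) * (1 - 1 / q') \<le> q' powr q / q * (\<Sum>y\<in>?Q. \<psi> y powr q)"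
    using 1 by (simp add: algebra_simps)
  moreover have "1 - 1 / q' = 1 / q" using q' by linarith
  ultimately show ?thesis
    using q by (simp add: V_def q'_def atLeast0AtMost field_simps)
qed

text \<open>
  Outside the cells on which the mean doubles, \<open>\<sigma>\<close> is at most twice its mean. Those cells carry at
  most the fraction \<open>1 - 1/L\<close> of the sum by the \<open>A\<^sub>\<infinity>\<close> condition, and by maximality their means are
  at most \<open>2 D\<close> times the mean over the whole cell. With \<open>(2 D)\<^sup>e \<le> 1 + 1/(2 L)\<close> the induction
  closes with the constant \<open>4\<close>, which must not depend on \<open>L\<close>: all dependence on \<open>L\<close> has to go into
  the exponent.
\<close>

lemma reverse_Holder:
  assumes \<sigma>: "\<And>y. 0 \<le> \<sigma> y"
    and A_inf: "\<And>k x E. E \<subseteq> cell k x \<Longrightarrow> card (cell k x) \<le> 2 * card E \<Longrightarrow>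
        (\<Sum>y\<in>cell k x. \<sigma> y) \<le> L * (\<Sum>y\<in>E. \<sigma> y)"
    and L: "1 \<le> L" and e: "0 < e" "2 powr e \<le> 2" "(2 * D) powr e \<le> 1 + 1 / (2 * L)"
  shows "(\<Sum>y\<in>cell k x. \<sigma> y powr (1 + e)) \<le>
    4 * mean (cell k x) \<sigma> powr e * (\<Sum>y\<in>cell k x. \<sigma> y)"
proof (induction k arbitrary: x rule: less_induct)
  case (less k x)
  have split: "\<sigma> y powr (1 + e) = \<sigma> y * \<sigma> y powr e" for y
    using powr_mult_base[OF \<sigma>, of y e] by simp
  show ?case
  proof (cases "k = 0")
    case True
    then show ?thesis using \<sigma>[of x] by (simp add: split mult_ac mult_nonneg_nonneg)
  next
    case k: False
    let ?Q = "cell k x"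
    let ?m = "mean ?Q \<sigma>"
    obtain F where F: "finite F" "disjoint F" "\<Union>F \<subseteq> ?Q"
      and stop: "\<And>C. C \<in> F \<Longrightarrow> \<exists>l y. l < k \<and> y \<in> ?Q \<and> C = cell l y \<and> 2 * ?m < mean C \<sigma> \<and>
          (\<forall>i. l < i \<and> i < k \<longrightarrow> \<not> 2 * ?m < mean (cell i y) \<sigma>)"
      and go: "\<And>y. y \<in> ?Q \<Longrightarrow> y \<notin> \<Union>F \<Longrightarrow> \<forall>i<k. \<not> 2 * ?m < mean (cell i y) \<sigma>"
      using stopping_cells[of k x "\<lambda>C. 2 * ?m < mean C \<sigma>"] by metis
    have m0: "0 \<le> ?m" using \<sigma> by (rule mean_nonneg)
    define E where "E = ?Q - \<Union>F"
    have half: "card ?Q \<le> 2 * card E"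
      unfolding E_def using F \<sigma> stop by (intro card_Union_large_mean[of F ?Q \<sigma>]) auto
    have sE: "(\<Sum>y\<in>E. \<sigma> y powr (1 + e)) \<le> 2 * ?m powr e * (\<Sum>y\<in>E. \<sigma> y)"
    proof -
      have "\<sigma> y powr (1 + e) \<le> 2 * ?m powr e * \<sigma> y" if "y \<in> E" for y
      proof -
        have "\<sigma> y \<le> 2 * ?m" using go[of y] that k unfolding E_def by force
        then have "\<sigma> y powr e \<le> (2 * ?m) powr e" using \<sigma> e by (intro powr_mono2) auto
        also have "\<dots> \<le> 2 * ?m powr e"
          using m0 e by (simp add: powr_mult mult_right_mono)
        finally show ?thesis unfolding split using \<sigma>[of y] by (simp add: mult.commute mult_left_mono)
      qed
      then show ?thesis by (simp add: sum_distrib_left sum_mono)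
    qed
    have sC: "(\<Sum>y\<in>C. \<sigma> y powr (1 + e)) \<le> 4 * (1 + 1 / (2 * L)) * ?m powr e * (\<Sum>y\<in>C. \<sigma> y)"
      if C: "C \<in> F" for C
    proof -
      obtain l y where ly: "l < k" "y \<in> ?Q" "C = cell l y"
        and up: "\<And>i. l < i \<Longrightarrow> i < k \<Longrightarrow> \<not> 2 * ?m < mean (cell i y) \<sigma>"
        using stop[OF C] by blast
      let ?P = "cell (Suc l) y"
      have P: "mean ?P \<sigma> \<le> 2 * ?m"
      proof (cases "Suc l = k")
        case True
        then have "?P = ?Q" using cell_eq ly by simp
        then show ?thesis using m0 by simp
      qed (use up[of "Suc l"] ly in auto)
      have "mean C \<sigma> \<le> (\<Sum>z\<in>?P. \<sigma> z) / card C"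
        unfolding mean_def ly(3) using \<sigma> cell_Suc by (intro divide_right_mono sum_mono2) auto
      also have "\<dots> = card ?P * mean ?P \<sigma> / card C" by (simp add: card_times_mean)
      also have "\<dots> \<le> D * card C * mean ?P \<sigma> / card C"
        using card_cell_Suc[of l y] \<sigma> unfolding ly(3)
        by (intro divide_right_mono mult_right_mono mean_nonneg) auto
      also have "\<dots> = D * mean ?P \<sigma>" by (simp add: ly(3) card_gt_0_iff)
      also have "\<dots> \<le> D * (2 * ?m)" using P D_ge by (intro mult_left_mono) auto
      finally have "mean C \<sigma> powr e \<le> (2 * D * ?m) powr e"
        using \<sigma> e by (intro powr_mono2) (auto intro: mean_nonneg simp: mult_ac)
      also have "\<dots> \<le> (1 + 1 / (2 * L)) * ?m powr e"
        using m0 D_ge e by (simp add: powr_mult[of "2 * D"] mult_right_mono)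
      finally have "4 * mean C \<sigma> powr e * (\<Sum>y\<in>C. \<sigma> y) \<le>
          4 * ((1 + 1 / (2 * L)) * ?m powr e) * (\<Sum>y\<in>C. \<sigma> y)"
        using \<sigma> by (intro mult_right_mono mult_left_mono sum_nonneg) auto
      with less[OF ly(1), of y] show ?thesis unfolding ly(3) by (simp only: mult.assoc)
    qed
    have finC: "finite C" if "C \<in> F" for C
      using that F(3) by (meson Union_upper finite_subset finite_cell order_trans)
    have UF: "(\<Sum>y\<in>\<Union>F. g y) = (\<Sum>C\<in>F. \<Sum>y\<in>C. g y)" for g :: "'x \<Rightarrow> real"
      using F finC by (subst sum.Union_disjoint) (auto simp: disjoint_def)
    have sF: "(\<Sum>y\<in>\<Union>F. \<sigma> y powr (1 + e)) \<le> 4 * (1 + 1 / (2 * L)) * ?m powr e * (\<Sum>y\<in>\<Union>F. \<sigma> y)"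
      unfolding UF sum_distrib_left[of _ _ F] using sC by (intro sum_mono)
    have Q: "(\<Sum>y\<in>?Q. g y) = (\<Sum>y\<in>E. g y) + (\<Sum>y\<in>\<Union>F. g y)" for g :: "'x \<Rightarrow> real"
      unfolding E_def using F by (intro sum.subset_diff) auto
    define s t where "s = (\<Sum>y\<in>E. \<sigma> y)" and "t = (\<Sum>y\<in>\<Union>F. \<sigma> y)"
    have st: "0 \<le> s" "0 \<le> t" using \<sigma> by (auto simp: s_def t_def intro: sum_nonneg)
    have "s + t \<le> L * s"
      using A_inf[OF _ half] Q[of \<sigma>] unfolding s_def t_def E_def by auto
    then have "t / L \<le> s"
      using L st by (simp add: field_simps)
    have eq: "2 * s + 4 * (1 + 1 / (2 * L)) * t = 2 * s + 4 * t + 2 * (t / L)"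
      using L by (simp add: field_simps)
    have "2 * s + 4 * (1 + 1 / (2 * L)) * t \<le> 4 * (s + t)"
      unfolding eq using \<open>t / L \<le> s\<close> by simp
    then have "(2 * s + 4 * (1 + 1 / (2 * L)) * t) * ?m powr e \<le> 4 * (s + t) * ?m powr e"
      by (intro mult_right_mono) auto
    then show ?thesis
      using sE sF unfolding Q by (simp add: s_def t_def algebra_simps)
  qed
qed

end

section \<open>Weighted means over a sparse family\<close>

text \<open>
  For \<open>q\<close> close to 1 the left-hand side is of the size of the conjugate exponent itself, which will
  be of order \<open>L\<close>, and not of a higher power of it.
\<close>

lemma powr_conj_le:
  fixes q :: real
  assumes "1 < q"
  shows "(q / (q - 1)) powr q \<le> q / (q - 1) * exp q"
proof -
  define q' where "q' = q / (q - 1)"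
  have q': "1 < q'" "q = 1 + q / q'" using assms unfolding q'_def by (auto simp: field_simps)
  have "q' powr q = q' * q' powr (q / q')"
    using q' by (subst q'(2), subst powr_add) auto
  moreover have "q' powr (q / q') \<le> exp q"
  proof -
    have "ln q' \<le> q'" using q' ln_less_self[of q'] by linarith
    then have "ln q' / q' \<le> 1" using q' by simp
    then have "q * (ln q' / q') \<le> q" using assms mult_left_mono[of "ln q' / q'" 1 q] by simp
    then show ?thesis using q' by (simp add: powr_def)
  qed
  ultimately show ?thesis using q' by (simp add: mult_left_mono flip: q'_def)
qed

context nested_cells
begin

text \<open>
  Hoelder's inequality with the exponents \<open>r\<close> and \<open>s = p' (1 + e)\<close> and the reverse Hoelder
  inequality for \<open>\<sigma> S\<close> bound the mean of \<open>\<phi> (\<sigma> S)\<^bsup>1/p'\<^esup>\<close> by a constant times \<open>(mean of \<phi>\<^sup>r)\<^bsup>1/r\<^esup>\<close>.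
  Sparseness replaces the sum over cells by the maximal function of \<open>\<phi>\<^sup>r\<close> in \<open>\<ell>\<^bsup>q\<^esup>\<close> with \<open>q = p/r\<close>.
  As \<open>q - 1\<close> is of order \<open>e\<close>, hence of order \<open>1/L\<close>, Doob's inequality contributes a factor of order
  \<open>L\<close>.
\<close>

lemma sparse_weighted_means:
  fixes p :: real and \<sigma> :: "'x set \<Rightarrow> 'x \<Rightarrow> real"
  defines "p' \<equiv> p / (p - 1)"
  assumes p: "1 < p" and L: "1 \<le> L" and H: "1 \<le> H"
    and \<phi>: "\<And>y. 0 \<le> \<phi> y" and \<sigma>: "\<And>S y. 0 \<le> \<sigma> S y"
    and \<sigma>_mean: "\<And>i x. mean (cell i x) (\<sigma> (cell i x)) \<le> H"
    and A_inf: "\<And>S i x E. E \<subseteq> cell i x \<Longrightarrow> card (cell i x) \<le> 2 * card E \<Longrightarrow>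
        (\<Sum>y\<in>cell i x. \<sigma> S y) \<le> L * (\<Sum>y\<in>E. \<sigma> S y)"
  defines "a \<equiv> (\<lambda>S y. \<phi> y * \<sigma> S y powr (1 / p'))"
  shows "\<exists>\<S>. finite \<S> \<and> (\<forall>S\<in>\<S>. \<exists>i\<le>k. \<exists>y\<in>cell k x. S = cell i y) \<and>
    (\<forall>y\<in>cell k x. \<forall>i\<le>k. \<exists>S\<in>\<S>. cell i y \<subseteq> S \<and> mean (cell i y) (a S) \<le> 2 * mean S (a S)) \<and>
    (\<Sum>S\<in>\<S>. card S * mean S (a S) powr p) \<le>
      (4 * H) powr p * exp p * (16 * D * (1 + p) / (p - 1)) * L * (\<Sum>y\<in>cell k x. \<phi> y powr p)"
proof -
  have a0: "0 \<le> a S y" for S y using \<phi> \<sigma> by (simp add: a_def)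
  obtain \<S> where \<S>: "finite \<S> \<and> (\<forall>S\<in>\<S>. \<exists>i\<le>k. \<exists>y\<in>cell k x. S = cell i y) \<and>
    (\<forall>y\<in>cell k x. \<forall>i\<le>k. \<exists>S\<in>\<S>. cell i y \<subseteq> S \<and> mean (cell i y) (a S) \<le> 2 * mean S (a S)) \<and>
    (\<forall>\<Gamma>::'x set \<Rightarrow> real. (\<forall>Q. 0 \<le> \<Gamma> Q) \<longrightarrow>
       (\<Sum>S\<in>\<S>. card S * \<Gamma> S) \<le> 2 * (\<Sum>y\<in>cell k x. Max ((\<lambda>i. \<Gamma> (cell i y)) ` {..k})))"
    using sparse_domination[of a k x, OF a0] ..
  note S = \<S>[THEN conjunct1] \<S>[THEN conjunct2, THEN conjunct1]
    \<S>[THEN conjunct2, THEN conjunct2, THEN conjunct1]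
  note sparse = \<S>[THEN conjunct2, THEN conjunct2, THEN conjunct2, rule_format]
  \<comment> \<open>The gain in the exponent: small enough for \<open>(2 D)\<^sup>e \<le> 1 + 1 / (2 L)\<close>, as \<open>ln (2 D) \<le> 2 D\<close>.\<close>
  define e where "e = 1 / (8 * D * L)"
  have DL: "1 \<le> D * L" using mult_mono[of 1 D 1 L] D_ge L by simp
  have e: "0 < e" "e \<le> 1 / 8" using DL by (auto simp: e_def field_simps)
  have "ln (2 * D) \<le> 2 * D" using D_ge by (intro less_imp_le ln_less_self) simp
  then have eD: "e * ln (2 * D) \<le> 1 / (4 * L)"
    using D_ge L mult_left_mono[of "ln (2 * D)" "2 * D" e] e
    by (simp add: e_def field_simps)
  have "(2 * D) powr e = exp (e * ln (2 * D))" using D_ge by (simp add: powr_def)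
  also have "\<dots> \<le> exp (1 / (4 * L))" using eD by simp
  also have "\<dots> \<le> 1 + 1 / (4 * L) + (1 / (4 * L))\<^sup>2"
    using L by (intro exp_bound) (auto simp: field_simps)
  also have "\<dots> \<le> 1 + 1 / (4 * L) + 1 / (4 * L)"
    using L by (auto simp: power2_eq_square field_simps)
  finally have e2: "(2 * D) powr e \<le> 1 + 1 / (2 * L)" by simp
  have "2 powr e \<le> 2 powr 1" using e by (intro powr_mono) auto
  then have e3: "2 powr e \<le> 2" by simp
  define s where "s = p' * (1 + e)"
  define r where "r = s / (s - 1)"
  \<comment> \<open>This is \<open>p / r\<close>.\<close>
  define q where "q = (1 + p * e) / (1 + e)"
  have p': "1 < p'" "1 / p + 1 / p' = 1" using p unfolding p'_def by (auto simp: field_simps)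
  have s: "1 < s" "p' \<le> s"
  proof -
    have "p' * 1 \<le> s" unfolding s_def using p' e by (intro mult_left_mono) auto
    then show "1 < s" "p' \<le> s" using p' by auto
  qed
  have r: "1 < r" "1 / r + 1 / s = 1" using s unfolding r_def by (auto simp: field_simps)
  have pe: "0 < 1 + p * e" using p e by (simp add: add_pos_pos)
  have "s = p * (1 + e) / (p - 1)" "s - 1 = (1 + p * e) / (p - 1)"
    using p unfolding s_def p'_def by (auto simp: field_simps)
  then have r_eq: "r = p * (1 + e) / (1 + p * e)" using p unfolding r_def by simp
  have rq: "r * q = p" "p * (1 / r) = q"
    using p e pe unfolding r_eq q_def by auto
  have q1: "q - 1 = (p - 1) * e / (1 + e)"
    using p e unfolding q_def by (simp add: field_simps)
  have q2: "q / (q - 1) = (1 + p * e) / ((p - 1) * e)"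
    unfolding q1 using p e by (simp add: q_def)
  have "0 < (p - 1) * e / (1 + e)" using p e by simp
  then have "1 < q" using q1 by linarith
  moreover have "q \<le> p" using p e unfolding q_def by (auto simp: field_simps)
  ultimately have q: "1 < q" "q \<le> p" by auto
  define \<Gamma> where "\<Gamma> S = mean S (\<lambda>y. \<phi> y powr r) powr q" for S
  have mean_a: "mean S (a S) powr p \<le> (4 * H) powr p * \<Gamma> S" if SS: "S \<in> \<S>" for S
  proof -
    obtain i y where S_eq: "S = cell i y" using S(2) SS by blast
    let ?m = "mean S (\<sigma> S)"
    have m: "0 \<le> ?m" "?m \<le> H" using \<sigma> \<sigma>_mean unfolding S_eq by (auto intro: mean_nonneg)
    let ?Y = "mean S (\<lambda>y. \<sigma> S y powr (1 + e))"
    have "(\<Sum>y\<in>S. \<sigma> S y powr (1 + e)) \<le> 4 * ?m powr e * (\<Sum>y\<in>S. \<sigma> S y)"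
      unfolding S_eq using \<sigma> A_inf L e e2 e3 by (intro reverse_Holder) auto
    then have "?Y \<le> 4 * ?m powr e * ?m"
      unfolding mean_def[of S "\<lambda>y. \<sigma> S y powr (1 + e)"] mean_def[of S "\<sigma> S"]
      by (metis divide_right_mono of_nat_0_le_iff times_divide_eq_right)
    also have "\<dots> = 4 * ?m powr (1 + e)" using powr_mult_base[OF m(1), of e] by (simp add: mult_ac)
    also have "\<dots> \<le> 4 * H powr (1 + e)"
      using m e by (intro mult_left_mono powr_mono2) auto
    finally have "?Y powr (1 / s) \<le> (4 * H powr (1 + e)) powr (1 / s)"
      using s by (intro powr_mono2 mean_nonneg) auto
    also have "\<dots> = 4 powr (1 / s) * H powr (1 / p')"
      using p' e by (simp add: powr_mult powr_powr s_def)
    also have "\<dots> \<le> 4 powr 1 * H powr 1"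
      using H s p' by (intro mult_mono powr_mono) auto
    finally have Y: "?Y powr (1 / s) \<le> 4 * H" using H by simp
    have "mean S (a S) \<le> mean S (\<lambda>y. \<phi> y powr r) powr (1 / r) *
        mean S (\<lambda>y. (\<sigma> S y powr (1 / p')) powr s) powr (1 / s)"
      unfolding a_def using r s \<phi> \<sigma> by (intro mean_Holder) (auto simp: S_eq)
    also have "mean S (\<lambda>y. (\<sigma> S y powr (1 / p')) powr s) = ?Y"
      using p' by (simp add: powr_powr s_def)
    also have "mean S (\<lambda>y. \<phi> y powr r) powr (1 / r) * ?Y powr (1 / s)
        \<le> mean S (\<lambda>y. \<phi> y powr r) powr (1 / r) * (4 * H)"
      using Y by (intro mult_left_mono) auto
    finally have "mean S (a S) \<le> 4 * H * mean S (\<lambda>y. \<phi> y powr r) powr (1 / r)"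
      by (simp add: mult_ac)
    then have "mean S (a S) powr p \<le> (4 * H * mean S (\<lambda>y. \<phi> y powr r) powr (1 / r)) powr p"
      using a0 p by (intro powr_mono2 mean_nonneg) auto
    also have "\<dots> = (4 * H) powr p * \<Gamma> S"
      using H rq by (simp add: powr_mult powr_powr \<Gamma>_def mult.commute)
    finally show ?thesis .
  qed
  define X where "X = (\<Sum>y\<in>cell k x. \<phi> y powr p)"
  define B where "B = 8 * D * (1 + p) / (p - 1) * L * exp p"
  let ?max = "\<lambda>y. Max ((\<lambda>i. mean (cell i y) (\<lambda>y. \<phi> y powr r)) ` {..k})"
  have X0: "0 \<le> X" unfolding X_def by (intro sum_nonneg) auto
  have B: "(q / (q - 1)) powr q \<le> B"
  proof -
    have "(q / (q - 1)) powr q \<le> q / (q - 1) * exp q" using q by (intro powr_conj_le)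
    also have "\<dots> \<le> (1 + p * e) / ((p - 1) * e) * exp p"
      unfolding q2 using q p e by (intro mult_left_mono) auto
    also have "\<dots> \<le> (1 + p) / ((p - 1) * e) * exp p"
      using q p e by (intro mult_right_mono divide_right_mono) (auto simp: mult_left_le)
    also have "\<dots> = B" by (simp add: B_def e_def)
    finally show ?thesis .
  qed
  have "(\<Sum>S\<in>\<S>. card S * \<Gamma> S) \<le> 2 * (\<Sum>y\<in>cell k x. Max ((\<lambda>i. \<Gamma> (cell i y)) ` {..k}))"
    by (intro sparse[of \<Gamma>]) (auto simp: \<Gamma>_def)
  also have "\<dots> \<le> 2 * (\<Sum>y\<in>cell k x. ?max y powr q)"
  proof (intro mult_left_mono sum_mono Max.boundedI)
    fix y v assume "v \<in> (\<lambda>i. \<Gamma> (cell i y)) ` {..k}"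
    then obtain i where i: "i \<le> k" "v = \<Gamma> (cell i y)" by auto
    have "mean (cell i y) (\<lambda>y. \<phi> y powr r) \<le> ?max y" using i by (intro Max_ge) auto
    then show "v \<le> ?max y powr q"
      unfolding i \<Gamma>_def using q by (intro powr_mono2 mean_nonneg) auto
  qed auto
  also have "\<dots> \<le> 2 * ((q / (q - 1)) powr q * (\<Sum>y\<in>cell k x. (\<phi> y powr r) powr q))"
    using q by (intro mult_left_mono Doob_maximal) auto
  also have "(\<Sum>y\<in>cell k x. (\<phi> y powr r) powr q) = X"
    by (simp add: powr_powr rq X_def)
  also have "2 * ((q / (q - 1)) powr q * X) \<le> 2 * (B * X)"
    using B X0 by (intro mult_left_mono mult_right_mono) auto
  finally have \<Gamma>: "(\<Sum>S\<in>\<S>. card S * \<Gamma> S) \<le> 2 * (B * X)" .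
  have "(\<Sum>S\<in>\<S>. card S * mean S (a S) powr p) \<le> (\<Sum>S\<in>\<S>. card S * ((4 * H) powr p * \<Gamma> S))"
    using mean_a by (intro sum_mono mult_left_mono) auto
  also have "\<dots> = (4 * H) powr p * (\<Sum>S\<in>\<S>. card S * \<Gamma> S)"
    by (simp add: sum_distrib_left mult_ac)
  also have "\<dots> \<le> (4 * H) powr p * (2 * (B * X))"
    using \<Gamma> by (intro mult_left_mono) auto
  also have "\<dots> = (4 * H) powr p * exp p * (16 * D * (1 + p) / (p - 1)) * L * (\<Sum>y\<in>cell k x. \<phi> y powr p)"
    by (simp add: B_def X_def)
  finally show ?thesis using S by (intro exI[of _ \<S>] conjI)
qed

end

section \<open>Powers and Hoelder's inequality for extended reals\<close>

lemma ennpowr_ennreal [simp]: "0 \<le> x \<Longrightarrow> ennpowr (ennreal x) r = ennreal (x powr r)"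
  by (simp add: ennpowr_def)

lemma ennpowr_top [simp]: "ennpowr top r = top"
  by (simp add: ennpowr_def)

lemma ennpowr_0 [simp]: "ennpowr 0 r = 0"
  by (simp add: ennpowr_def)

lemma ennpowr_one [simp]: "ennpowr x 1 = x"
  by (cases x) auto

lemma ennpowr_mono:
  assumes "x \<le> y" "0 \<le> r"
  shows "ennpowr x r \<le> ennpowr y r"
proof (cases y)
  case (real b)
  then have "x < top" using assms(1) by (simp add: le_less_trans)
  then obtain a where "0 \<le> a" "x = ennreal a" by (cases x) auto
  then show ?thesis using assms real by (auto intro: ennreal_leI powr_mono2)
qed auto

lemma ennpowr_ennpowr: "ennpowr (ennpowr x r) s = ennpowr x (r * s)"
  by (cases x) (auto simp: powr_powr)

lemma ennpowr_eq_0_iff [simp]: "ennpowr x r = 0 \<longleftrightarrow> x = 0"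
  by (cases x) auto

lemma ennpowr_eq_top_iff [simp]: "ennpowr x r = top \<longleftrightarrow> x = top"
  by (cases x) auto

lemma ennpowr_less_top_iff [simp]: "ennpowr x r < top \<longleftrightarrow> x < top"
  by (simp flip: less_top)

lemma ennpowr_mult: "ennpowr (x * y) r = ennpowr x r * ennpowr y r"
proof (cases x)
  case (real a)
  show ?thesis
  proof (cases y)
    case (real b)
    then show ?thesis using \<open>x = ennreal a\<close> \<open>0 \<le> a\<close>
      by (simp add: powr_mult flip: ennreal_mult)
  next
    case top
    then show ?thesis using real by (cases "a = 0") (auto simp: ennreal_mult_top)
  qed
next
  case top
  then show ?thesis by (cases "y = 0") (auto simp: ennreal_top_mult)
qed

lemma le_ennpowr_iff:
  assumes "0 < r"
  shows "x \<le> ennpowr z (1 / r) \<longleftrightarrow> ennpowr x r \<le> z"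
  using ennpowr_mono[of x "ennpowr z (1 / r)" r] ennpowr_mono[of "ennpowr x r" z "1 / r"] assms
  by (auto simp: ennpowr_ennpowr)

text \<open>
  For positive \<open>r\<close> the map \<open>x \<mapsto> x\<^sup>r\<close> is an order isomorphism with inverse \<open>x \<mapsto> x\<^bsup>1/r\<^esup>\<close>, so it
  commutes with suprema and infima.
\<close>

lemma ennpowr_SUP_le:
  assumes "0 < r"
  shows "ennpowr (SUP i\<in>I. a i) r \<le> (SUP i\<in>I. ennpowr (a i) r)"
  unfolding le_ennpowr_iff[OF assms, symmetric]
  by (rule SUP_least) (auto simp: le_ennpowr_iff[OF assms] intro: SUP_upper)

lemma ennpowr_liminf_le:
  fixes a :: "nat \<Rightarrow> ennreal"
  assumes "0 < r"
  shows "ennpowr (liminf a) r \<le> liminf (\<lambda>n. ennpowr (a n) r)"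
  unfolding liminf_SUP_INF
proof (rule order_trans[OF ennpowr_SUP_le[OF assms]], rule SUP_mono)
  fix n
  have "ennpowr (INF m\<in>{n..}. a m) r \<le> (INF m\<in>{n..}. ennpowr (a m) r)"
    using assms by (intro INF_greatest ennpowr_mono INF_lower) auto
  then show "\<exists>m\<in>UNIV. ennpowr (INF m\<in>{n..}. a m) r \<le> (INF i\<in>{m..}. ennpowr (a i) r)" by blast
qed

lemma measurable_ennpowr [measurable (raw)]:
  assumes [measurable]: "f \<in> borel_measurable M"
  shows "(\<lambda>x. ennpowr (f x) r) \<in> borel_measurable M"
  unfolding ennpowr_def by measurable

text \<open>
  The parameters \<open>a\<close> and \<open>b\<close> stand for the integrals of \<open>x\<^sup>p\<close> and \<open>y\<^sup>q\<close>: integrated, the bracket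
  becomes \<open>1/p + 1/q = 1\<close> and the prefactor is the right-hand side of Hoelder's inequality.
\<close>

lemma ennreal_Young_scaled:
  fixes p q a b :: real and x y :: ennreal
  assumes pq: "1 < p" "1 < q" "1 / p + 1 / q = 1" and ab: "0 < a" "0 < b"
  shows "x * y \<le> ennreal (a powr (1 / p) * b powr (1 / q)) *
    (ennpowr x p * ennreal (1 / (p * a)) + ennpowr y q * ennreal (1 / (q * b)))"
proof (cases "x = top \<or> y = top")
  case True
  show ?thesis
  proof (cases "x = 0 \<or> y = 0")
    case False
    then have "ennpowr x p * ennreal (1 / (p * a)) + ennpowr y q * ennreal (1 / (q * b)) = top"
      using True pq ab by (auto simp: ennreal_top_mult)
    then show ?thesis using pq ab by (auto simp: ennreal_mult_top)
  qed auto
next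
  case False
  then obtain u v where uv: "x = ennreal u" "0 \<le> u" "y = ennreal v" "0 \<le> v"
    by (cases x; cases y) auto
  define c d where "c = a powr (1 / p)" and "d = b powr (1 / q)"
  have cd: "0 < c" "0 < d" "c powr p = a" "d powr q = b"
    using pq ab by (auto simp: c_def d_def powr_powr)
  have "u / c * (v / d) \<le> (u / c) powr p / p + (v / d) powr q / q"
    using uv cd by (intro Youngs_inequality[OF pq]) auto
  then have "u * v \<le> c * d * (u powr p * (1 / (p * a)) + v powr q * (1 / (q * b)))"
    using uv cd by (simp add: powr_divide divide_le_eq mult_ac)
  then have "ennreal (u * v) \<le> ennreal (c * d * (u powr p * (1 / (p * a)) + v powr q * (1 / (q * b))))"
    by (rule ennreal_leI)
  then show ?thesis
    using uv pq ab unfolding uv c_def d_def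
    by (simp flip: ennreal_mult ennreal_plus)
qed

lemma nn_integral_Holder:
  assumes pq: "1 < p" "1 < q" "1 / p + 1 / q = 1"
    and [measurable]: "f \<in> borel_measurable M" "g \<in> borel_measurable M"
  shows "(\<integral>\<^sup>+x. f x * g x \<partial>M) \<le>
    ennpowr (\<integral>\<^sup>+x. ennpowr (f x) p \<partial>M) (1 / p) * ennpowr (\<integral>\<^sup>+x. ennpowr (g x) q \<partial>M) (1 / q)"
proof -
  define a b where "a = (\<integral>\<^sup>+x. ennpowr (f x) p \<partial>M)" and "b = (\<integral>\<^sup>+x. ennpowr (g x) q \<partial>M)"
  consider "a = 0 \<or> b = 0" | "a \<noteq> 0" "b \<noteq> 0" "a = top \<or> b = top" | "a \<noteq> 0" "b \<noteq> 0" "a \<noteq> top" "b \<noteq> top"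
    by blast
  then show ?thesis
  proof cases
    case 1
    then have "AE x in M. f x * g x = 0"
      unfolding a_def b_def by (auto simp: nn_integral_0_iff_AE)
    then have "(\<integral>\<^sup>+x. f x * g x \<partial>M) = 0" by (simp add: nn_integral_0_iff_AE)
    then show ?thesis by simp
  next
    case 2
    then have "ennpowr a (1 / p) * ennpowr b (1 / q) = top"
      by (auto simp: ennreal_top_mult ennreal_mult_top)
    then show ?thesis unfolding a_def b_def by simp
  next
    case 3
    then obtain \<alpha> \<beta> where ab: "a = ennreal \<alpha>" "0 < \<alpha>" "b = ennreal \<beta>" "0 < \<beta>"
      by (cases a; cases b) (auto simp: less_le)
    let ?c = "ennreal (\<alpha> powr (1 / p) * \<beta> powr (1 / q))"
    have "(\<integral>\<^sup>+x. f x * g x \<partial>M) \<le> (\<integral>\<^sup>+x. ?c *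
        (ennpowr (f x) p * ennreal (1 / (p * \<alpha>)) + ennpowr (g x) q * ennreal (1 / (q * \<beta>))) \<partial>M)"
      using pq ab by (intro nn_integral_mono ennreal_Young_scaled) auto
    also have "\<dots> = ?c * (a * ennreal (1 / (p * \<alpha>)) + b * ennreal (1 / (q * \<beta>)))"
      by (simp add: nn_integral_cmult nn_integral_add nn_integral_multc a_def b_def)
    also have "a * ennreal (1 / (p * \<alpha>)) + b * ennreal (1 / (q * \<beta>)) = ennreal (1 / p) + ennreal (1 / q)"
    proof -
      have "a * ennreal (1 / (p * \<alpha>)) = ennreal (1 / p)" "b * ennreal (1 / (q * \<beta>)) = ennreal (1 / q)"
        using ab pq by (simp_all flip: ennreal_mult)
      then show ?thesis by simp
    qed
    also have "\<dots> = ennreal (1 / p + 1 / q)"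
      using pq by (intro ennreal_plus[symmetric]) auto
    also have "?c * \<dots> = ennpowr a (1 / p) * ennpowr b (1 / q)"
      unfolding pq(3) using ab by (simp add: ennreal_mult)
    finally show ?thesis unfolding a_def b_def .
  qed
qed

lemma sigma_finite_lebesgue: "sigma_finite_measure (lebesgue :: 'a::euclidean_space measure)"
proof
  obtain A :: "'a set set" where A: "countable A" "A \<subseteq> sets lborel" "\<Union>A = space lborel"
      "\<forall>a\<in>A. emeasure lborel a \<noteq> \<infinity>"
    using lborel.sigma_finite_countable by auto
  then show "\<exists>A::'a set set. countable A \<and> A \<subseteq> sets lebesgue \<and> \<Union>A = space lebesgue \<and>
      (\<forall>a\<in>A. emeasure lebesgue a \<noteq> \<infinity>)"
    by (intro exI[of _ A]) auto
qed

lemma measurable_lebesgue_AE: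
  fixes f g :: "'a::euclidean_space \<Rightarrow> 'b::topological_space"
  assumes f: "f \<in> borel_measurable lebesgue" and eq: "AE x in lebesgue. f x = g x"
  shows "g \<in> borel_measurable lebesgue"
proof (rule borel_measurableI)
  fix S :: "'b set" assume "open S"
  then have "{x\<in>space lebesgue. f x \<in> S} \<in> sets lebesgue"
    using measurable_sets[OF f, of S] by (simp add: vimage_def Int_def conj_commute)
  moreover have "AE x in lebesgue. x \<in> {x\<in>space lebesgue. f x \<in> S} \<longleftrightarrow> x \<in> {x\<in>space lebesgue. g x \<in> S}"
    using eq by eventually_elim simp
  ultimately have "{x\<in>space lebesgue. g x \<in> S} \<in> sets lebesgue"
    by (intro completion.in_sets_AE[of "{x\<in>space lebesgue. f x \<in> S}" "{x\<in>space lebesgue. g x \<in> S}"]) auto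
  then show "g -` S \<inter> space lebesgue \<in> sets lebesgue" by (simp add: vimage_def Int_def conj_commute)
qed

section \<open>Bases of nearly maximal determinant and matrix norms\<close>

lemma abs_det_le:
  fixes A :: "real ^ 'd::finite ^ 'd"
  assumes "\<And>i j. \<bar>A $ i $ j\<bar> \<le> B"
  shows "\<bar>det A\<bar> \<le> fact CARD('d) * B ^ CARD('d)"
proof -
  have "\<bar>det A\<bar> \<le> (\<Sum>\<pi> | \<pi> permutes (UNIV :: 'd set). \<bar>of_int (sign \<pi>) * (\<Prod>i\<in>UNIV. A $ i $ \<pi> i)\<bar>)"
    unfolding det_def by (rule sum_abs)
  also have "\<dots> \<le> (\<Sum>\<pi> | \<pi> permutes (UNIV :: 'd set). B ^ CARD('d))"
  proof (rule sum_mono)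
    fix \<pi> :: "'d \<Rightarrow> 'd"
    have "\<bar>of_int (sign \<pi>) * (\<Prod>i\<in>UNIV. A $ i $ \<pi> i)\<bar> = (\<Prod>i\<in>UNIV. \<bar>A $ i $ \<pi> i\<bar>)"
      by (simp add: abs_mult abs_prod sign_def)
    also have "\<dots> \<le> (\<Prod>i\<in>(UNIV :: 'd set). B)" using assms by (intro prod_mono) auto
    finally show "\<bar>of_int (sign \<pi>) * (\<Prod>i\<in>UNIV. A $ i $ \<pi> i)\<bar> \<le> B ^ CARD('d)" by simp
  qed
  also have "\<dots> = fact CARD('d) * B ^ CARD('d)"
    using card_permutations[of "UNIV :: 'd set" "CARD('d)"] by simp
  finally show ?thesis .
qed

text \<open>
  An Auerbach basis up to the factor 2. Choose vectors in the unit ball of \<open>F\<close> whose determinant is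
  more than half of the supremum. By Cramer's rule a coordinate of \<open>v\<close> is the quotient of two
  determinants, and the numerator is at most \<open>F v\<close> times the supremum by homogeneity. The factor 2
  is there because the supremum need not be attained.
\<close>

lemma reducing_basis:
  fixes F :: "real ^ 'd::finite \<Rightarrow> real"
  assumes hom: "\<And>c v. F (c *\<^sub>R v) = \<bar>c\<bar> * F v" and c0: "0 < c0" and F_ge: "\<And>v. c0 * norm v \<le> F v"
  obtains b :: "'d \<Rightarrow> real ^ 'd" where "\<And>i. F (b i) \<le> 1"
    "\<And>v. \<exists>\<beta>. v = (\<Sum>i\<in>UNIV. \<beta> i *\<^sub>R b i) \<and> (\<forall>i. \<bar>\<beta> i\<bar> \<le> 2 * F v)"
proof -
  define M where "M b = (\<chi> i. b i)" for b :: "'d \<Rightarrow> real ^ 'd"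
  define \<D> where "\<D> = (\<lambda>b. \<bar>det (M b)\<bar>) ` {b. \<forall>i. F (b i) \<le> 1}"
  have F_pos: "0 < F v" if "v \<noteq> 0" for v
    using F_ge[of v] c0 that by (meson less_le_trans mult_pos_pos zero_less_norm_iff)
  have "\<bar>M b $ i $ j\<bar> \<le> 1 / c0" if "\<forall>i. F (b i) \<le> 1" for b i j
  proof -
    have "c0 * norm (b i) \<le> 1" using F_ge[of "b i"] that by (meson order_trans)
    then have "norm (b i) \<le> 1 / c0" using c0 by (simp add: field_simps)
    then show ?thesis using component_le_norm_cart[of "b i" j] by (simp add: M_def)
  qed
  then have bdd: "bdd_above \<D>"
    unfolding \<D>_def by (intro bdd_aboveI2[of _ _ "fact CARD('d) * (1 / c0) ^ CARD('d)"] abs_det_le) auto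
  define b0 where "b0 i = (1 / F (axis i 1)) *\<^sub>R axis i (1::real)" for i :: 'd
  have ax: "0 < F (axis i 1)" for i :: 'd by (intro F_pos) (simp add: axis_eq_0_iff)
  have "\<bar>det (M b0)\<bar> \<in> \<D>"
    using ax unfolding \<D>_def b0_def by (intro image_eqI[OF refl]) (auto simp: hom less_imp_le abs_of_pos order_less_imp_not_eq2)
  moreover have "0 < \<bar>det (M b0)\<bar>"
  proof -
    have "det (M b0) = (\<Prod>i\<in>UNIV. M b0 $ i $ i)"
      by (intro det_diagonal) (auto simp: M_def b0_def axis_def)
    also have "\<dots> \<noteq> 0" using ax by (auto simp: M_def b0_def axis_def less_le)
    finally show ?thesis by simp
  qed
  ultimately have Sup: "0 < Sup \<D>" using cSup_upper[OF _ bdd] by (meson less_le_trans)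
  obtain b where b: "\<forall>i. F (b i) \<le> 1" "Sup \<D> / 2 < \<bar>det (M b)\<bar>"
    using less_cSupE[of "Sup \<D> / 2" \<D>] Sup \<open>\<bar>det (M b0)\<bar> \<in> \<D>\<close> unfolding \<D>_def by force
  have det: "det (M b) \<noteq> 0" using b Sup by auto
  have upd: "\<bar>det (M (b(k := v)))\<bar> \<le> 2 * F v * \<bar>det (M b)\<bar>" for k v
  proof (cases "v = 0")
    case True
    have "row k (M (b(k := v))) = 0" using True by (simp add: row_def M_def vec_eq_iff)
    then have "det (M (b(k := v))) = 0" by (rule det_zero_row)
    then show ?thesis using hom[of 0 v] True by simp
  next
    case False
    let ?u = "(1 / F v) *\<^sub>R v"
    have "F ?u = 1" using F_pos[OF False] by (simp add: hom)
    then have "\<bar>det (M (b(k := ?u)))\<bar> \<in> \<D>" using b unfolding \<D>_def by auto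
    then have "\<bar>det (M (b(k := ?u)))\<bar> \<le> 2 * \<bar>det (M b)\<bar>"
      using cSup_upper[OF _ bdd] b(2) by (smt (verit) field_sum_of_halves)
    moreover have "det (M (b(k := v))) = F v * det (M (b(k := ?u)))"
    proof -
      have "M (b(k := v)) = (\<chi> i. if i = k then F v *s ?u else b i)"
        using F_pos[OF False] by (auto simp: M_def vec_eq_iff)
      moreover have "M (b(k := ?u)) = (\<chi> i. if i = k then ?u else b i)"
        by (auto simp: M_def vec_eq_iff)
      ultimately show ?thesis by (simp only: det_row_mul)
    qed
    ultimately show ?thesis using F_pos[OF False] by (simp add: abs_mult mult_left_mono)
  qed
  show ?thesis
  proof (rule that[of b])
    show "F (b i) \<le> 1" for i using b by simp
    fix v
    have "det (transpose (M b)) \<noteq> 0" using det by simp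
    then obtain x where x: "transpose (M b) *v x = v" using cramer by blast
    have v: "v = (\<Sum>i\<in>UNIV. x $ i *\<^sub>R b i)"
      unfolding x[symmetric]
      by (simp add: vec_eq_iff matrix_vector_mult_def transpose_def M_def mult.commute)
    have "\<bar>x $ k\<bar> \<le> 2 * F v" for k
    proof -
      have "(\<chi> i. if i = k then sum (\<lambda>i. x $ i *s row i (M b)) UNIV else row i (M b)) = M (b(k := v))"
        by (subst v) (auto simp: M_def row_def vec_eq_iff)
      then have "x $ k * det (M b) = det (M (b(k := v)))"
        using cramer_lemma_transpose[of k x "M b"] by metis
      then have "\<bar>x $ k\<bar> * \<bar>det (M b)\<bar> \<le> 2 * F v * \<bar>det (M b)\<bar>"
        using upd[of k v] by (simp flip: abs_mult)
      then show ?thesis using det by simp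
    qed
    with v show "\<exists>\<beta>. v = (\<Sum>i\<in>UNIV. \<beta> i *\<^sub>R b i) \<and> (\<forall>i. \<bar>\<beta> i\<bar> \<le> 2 * F v)"
      by (intro exI[of _ "\<lambda>i. x $ i"]) auto
  qed
qed

lemma matrix_inv_mult:
  fixes A :: "real ^ 'd ^ 'd"
  assumes "invertible A"
  shows "A ** matrix_inv A = mat 1" "matrix_inv A ** A = mat 1"
  using assms unfolding invertible_def matrix_inv_def by (metis (mono_tags, lifting) someI_ex)+

lemma transpose_matrix_inv:
  fixes A :: "real ^ 'd ^ 'd"
  assumes "invertible A" "transpose A = A"
  shows "transpose (matrix_inv A) = matrix_inv A"
proof -
  have "transpose (matrix_inv A) ** A = mat 1"
    using arg_cong[OF matrix_inv_mult(1)[OF assms(1)], of transpose] assms(2)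
    by (simp add: matrix_transpose_mul)
  then have "transpose (matrix_inv A) ** A ** matrix_inv A = matrix_inv A" by simp
  then show ?thesis by (simp add: matrix_mul_assoc[symmetric] matrix_inv_mult[OF assms(1)])
qed

lemma onorm_matrix_mult_vector: "norm ((A :: real ^ 'd ^ 'm) *v v) \<le> onorm ((*v) A) * norm v"
  by (intro onorm matrix_vector_mul_bounded_linear)

lemma onorm_matrix_nonneg: "0 \<le> onorm ((*v) (A :: real ^ 'd ^ 'm))"
  by (intro onorm_pos_le matrix_vector_mul_bounded_linear)

lemma onorm_transpose_le: "onorm ((*v) (transpose A)) \<le> onorm ((*v) (A :: real ^ 'd ^ 'm))"
proof (rule onorm_bound)
  fix u
  let ?w = "transpose A *v u"
  have "norm ?w * norm ?w = (transpose A *v u) \<bullet> ?w" by (simp add: norm_eq_sqrt_inner)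
  also have "\<dots> = u \<bullet> (A *v ?w)" by (simp add: dot_lmul_matrix transpose_matrix_vector)
  also have "\<dots> \<le> norm u * norm (A *v ?w)" by (rule norm_cauchy_schwarz)
  also have "\<dots> \<le> norm u * (onorm ((*v) A) * norm ?w)"
    by (intro mult_left_mono onorm_matrix_mult_vector) simp
  finally have "norm ?w * norm ?w \<le> (onorm ((*v) A) * norm u) * norm ?w" by (simp add: mult_ac)
  then show "norm ?w \<le> onorm ((*v) A) * norm u"
    by (cases "norm ?w = 0") (auto simp: onorm_matrix_nonneg)
qed (rule onorm_matrix_nonneg)

lemma onorm_transpose: "onorm ((*v) (transpose A)) = onorm ((*v) (A :: real ^ 'd ^ 'm))"
  using onorm_transpose_le[of A] onorm_transpose_le[of "transpose A"] by simp

lemma onorm_matrix_mult_le: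
  fixes A B :: "real ^ 'd ^ 'd"
  shows "onorm ((*v) (A ** B)) \<le> onorm ((*v) A) * onorm ((*v) B)"
  using onorm_compose[OF matrix_vector_mul_bounded_linear[of A] matrix_vector_mul_bounded_linear[of B]]
  by (simp add: o_def matrix_vector_mul_assoc)

lemma measurable_matrix_iff:
  fixes f :: "'x \<Rightarrow> real ^ 'd ^ 'm"
  assumes "\<And>i j. (\<lambda>x. f x $ i $ j) \<in> borel_measurable M"
  shows "f \<in> borel_measurable M"
proof (rule borel_measurable_euclidean_space[THEN iffD2], rule ballI)
  fix b :: "real ^ 'd ^ 'm" assume "b \<in> Basis"
  then obtain i j where "b = axis i (axis j 1)" by (auto simp: Basis_vec_def)
  then show "(\<lambda>x. f x \<bullet> b) \<in> borel_measurable M" using assms by (simp add: inner_axis)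
qed

lemma measurable_matrix_entry [measurable (raw)]:
  fixes f :: "'x \<Rightarrow> real ^ 'd ^ 'm"
  assumes "f \<in> borel_measurable M"
  shows "(\<lambda>x. f x $ i $ j) \<in> borel_measurable M"
proof -
  have "(\<lambda>A::real ^ 'd ^ 'm. A $ i $ j) \<in> borel_measurable borel"
    by (intro borel_measurable_continuous_onI continuous_intros)
  from measurable_compose[OF assms this] show ?thesis .
qed

lemma measurable_det [measurable (raw)]:
  fixes f :: "'x \<Rightarrow> real ^ 'd ^ 'd"
  assumes "f \<in> borel_measurable M"
  shows "(\<lambda>x. det (f x)) \<in> borel_measurable M"
  unfolding det_def using assms by measurable

text \<open>
  Cramer's rule exhibits the entries of the inverse as rational functions, from which its
  measurability is read off.
\<close>

lemma matrix_inv_component: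
  fixes A :: "real ^ 'd ^ 'd"
  assumes "invertible A"
  shows "matrix_inv A $ i $ j = det (\<chi> r c. if c = i then axis j 1 $ r else A $ r $ c) / det A"
proof -
  have "det A \<noteq> 0" using assms by (simp add: invertible_det_nz)
  moreover have "A *v (matrix_inv A *v axis j 1) = axis j 1"
    by (simp add: matrix_vector_mul_assoc matrix_inv_mult[OF assms])
  ultimately have "matrix_inv A *v axis j 1 = (\<chi> k. det (\<chi> r c. if c = k then axis j 1 $ r else A $ r $ c) / det A)"
    using cramer by blast
  moreover have "(matrix_inv A *v axis j 1) $ i = matrix_inv A $ i $ j"
    by (simp add: matrix_vector_mult_def axis_def if_distrib cong: if_cong)
  ultimately show ?thesis by (simp add: vec_eq_iff)
qed

lemma measurable_matrix_inv:
  fixes f :: "'x \<Rightarrow> real ^ 'd ^ 'd"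
  assumes f [measurable]: "f \<in> borel_measurable M" and "\<And>x. invertible (f x)"
  shows "(\<lambda>x. matrix_inv (f x)) \<in> borel_measurable M"
proof (rule measurable_matrix_iff)
  fix i j
  have "(\<lambda>x. (\<chi> r c. if c = i then axis j 1 $ r else f x $ r $ c) :: real ^ 'd ^ 'd) \<in> borel_measurable M"
    by (rule measurable_matrix_iff) (auto intro!: measurable_matrix_entry f)
  then show "(\<lambda>x. matrix_inv (f x) $ i $ j) \<in> borel_measurable M"
    unfolding matrix_inv_component[OF assms(2)] by measurable
qed

lemma measurable_matrix_mult:
  fixes f g :: "'x \<Rightarrow> real ^ 'd ^ 'd"
  assumes [measurable]: "f \<in> borel_measurable M" "g \<in> borel_measurable M"
  shows "(\<lambda>x. f x ** g x) \<in> borel_measurable M"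
  by (rule measurable_matrix_iff) (simp add: matrix_matrix_mult_def, measurable)

lemma measurable_matrix_vector:
  fixes f :: "'x \<Rightarrow> real ^ 'd ^ 'd" and g :: "'x \<Rightarrow> real ^ 'd"
  assumes [measurable]: "f \<in> borel_measurable M" "g \<in> borel_measurable M"
  shows "(\<lambda>x. f x *v g x) \<in> borel_measurable M"
proof (rule borel_measurable_euclidean_space[THEN iffD2], rule ballI)
  fix b :: "real ^ 'd" assume "b \<in> Basis"
  then obtain i where "b = axis i 1" by (auto simp: Basis_vec_def)
  moreover have "(\<lambda>x. g x $ j) \<in> borel_measurable M" for j
    using borel_measurable_inner[OF assms(2) borel_measurable_const, of "axis j 1"]
    by (simp add: inner_axis)
  ultimately show "(\<lambda>x. (f x *v g x) \<bullet> b) \<in> borel_measurable M"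
    by (auto simp: inner_axis matrix_vector_mult_def
        intro!: borel_measurable_sum borel_measurable_times measurable_matrix_entry assms(1))
qed

lemma measurable_onorm:
  fixes f :: "'x \<Rightarrow> real ^ 'd ^ 'd"
  assumes "f \<in> borel_measurable M"
  shows "(\<lambda>x. onorm ((*v) (f x))) \<in> borel_measurable M"
proof -
  have tri: "onorm ((*v) (A + B)) \<le> onorm ((*v) A) + onorm ((*v) B)" for A B :: "real ^ 'd ^ 'd"
  proof -
    have "(*v) (A + B) = (\<lambda>v. A *v v + B *v v)" by (simp add: matrix_vector_mult_add_rdistrib fun_eq_iff)
    then show ?thesis
      using onorm_triangle[OF matrix_vector_mul_bounded_linear[of A] matrix_vector_mul_bounded_linear[of B]]
      by simp
  qed
  have le: "onorm ((*v) A) \<le> real CARD('d) * real CARD('d) * norm A" for A :: "real ^ 'd ^ 'd"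
  proof (rule onorm_le_matrix_component)
    show "\<bar>A $ i $ j\<bar> \<le> norm A" for i j
      by (metis Finite_Cartesian_Product.norm_nth_le component_le_norm_cart order_trans)
  qed
  have "continuous_on UNIV (\<lambda>A::real ^ 'd ^ 'd. onorm ((*v) A))"
  proof (rule lipschitz_on_continuous_on, rule lipschitz_onI)
    show "0 \<le> real CARD('d) * real CARD('d)" by simp
    fix A B :: "real ^ 'd ^ 'd"
    show "dist (onorm ((*v) A)) (onorm ((*v) B)) \<le> real CARD('d) * real CARD('d) * dist A B"
      unfolding dist_norm real_norm_def
      using tri[of B "A - B"] tri[of A "B - A"] le[of "A - B"] le[of "B - A"]
      by (simp add: norm_minus_commute)
  qed
  from measurable_compose[OF assms borel_measurable_continuous_onI[OF this]] show ?thesis .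
qed

section \<open>The kernel of a weight on cells\<close>

lemma ennreal_divide_mult_cancel: "c \<noteq> 0 \<Longrightarrow> c < top \<Longrightarrow> a / c * c = (a :: ennreal)"
  by (simp add: ennreal_divide_times)

lemma ennreal_divide_le_iff: "c \<noteq> 0 \<Longrightarrow> c < top \<Longrightarrow> a / c \<le> b \<longleftrightarrow> a \<le> b * (c :: ennreal)"
  using mult_right_mono[of "a / c" b c] divide_right_mono_ennreal[of a "b * c" c]
  by (auto simp: ennreal_divide_mult_cancel simp flip: ennreal_times_divide)

text \<open>
  Every matrix weight agrees almost everywhere with one of this kind, for which the algebra holds at
  every point.
\<close>

locale invertible_weight =
  fixes W :: "real ^ 'n::finite \<Rightarrow> real ^ 'd::finite ^ 'd"
  assumes measurable_W: "W \<in> borel_measurable lebesgue"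
    and symmetric_W: "transpose (W x) = W x"
    and invertible_W: "invertible (W x)"
begin

abbreviation t :: "real ^ 'n \<Rightarrow> real ^ 'n \<Rightarrow> real" where
  "t \<equiv> transfer_norm W"

definition dual :: "real ^ 'd \<Rightarrow> real ^ 'n \<Rightarrow> real" where
  "dual u y = norm (matrix_inv (W y) *v u)"

lemma dual_nonneg [simp]: "0 \<le> dual u y"
  by (simp add: dual_def)

lemma t_nonneg [simp]: "0 \<le> t x y"
  by (simp add: transfer_norm_def onorm_matrix_nonneg)

lemma t_submultiplicative: "t x z \<le> t x y * t y z"
proof -
  have "W x ** matrix_inv (W z) = (W x ** matrix_inv (W y)) ** (W y ** matrix_inv (W z))"
    by (metis invertible_W matrix_inv_mult(2) matrix_mul_assoc matrix_mul_rid)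
  then show ?thesis unfolding transfer_norm_def using onorm_matrix_mult_le by metis
qed

text \<open>
  The product \<open>W\<^sup>-\<^sup>1(y) W(x)\<close> is the transpose, as the values of \<open>W\<close> are symmetric. In this form \<open>x\<close>
  enters only through the vectors \<open>W(x) e\<close>, to which the bound of \<open>dual\<close> over a fixed cell can be
  applied.
\<close>

lemma t_adjoint: "t x y = onorm ((*v) (matrix_inv (W y) ** W x))"
proof -
  have "transpose (W x ** matrix_inv (W y)) = matrix_inv (W y) ** W x"
    by (simp add: matrix_transpose_mul transpose_matrix_inv invertible_W symmetric_W)
  then show ?thesis
    unfolding transfer_norm_def using onorm_transpose[of "W x ** matrix_inv (W y)"] by simp
qed

lemma dual_W_le: "dual (W x *v e) y \<le> t x y * norm e"
  unfolding dual_def t_adjoint matrix_vector_mul_assoc by (rule onorm_matrix_mult_vector)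

lemma t_le: "(\<And>e. dual (W x *v e) y \<le> c * norm e) \<Longrightarrow> t x y \<le> c"
  unfolding dual_def t_adjoint matrix_vector_mul_assoc by (rule onorm_le)

lemma dual_le: "dual u y \<le> t x y * dual u x"
proof -
  have "u = W x *v (matrix_inv (W x) *v u)"
    by (simp add: matrix_vector_mul_assoc matrix_inv_mult[OF invertible_W])
  then show ?thesis using dual_W_le[of x "matrix_inv (W x) *v u" y] by (simp add: dual_def)
qed

lemma norm_le_dual: "norm u \<le> onorm ((*v) (W y)) * dual u y"
proof -
  have "u = W y *v (matrix_inv (W y) *v u)"
    by (simp add: matrix_vector_mul_assoc matrix_inv_mult[OF invertible_W])
  then show ?thesis
    using onorm_matrix_mult_vector[of "W y" "matrix_inv (W y) *v u"] by (simp add: dual_def)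
qed

lemma dual_scaleR: "dual (c *\<^sub>R u) y = \<bar>c\<bar> * dual u y"
  by (simp add: dual_def matrix_vector_mult_scaleR)

lemma dual_sum_le: "dual (\<Sum>i\<in>I. f i) y \<le> (\<Sum>i\<in>I. dual (f i) y)"
  unfolding dual_def vec.linear_sum[OF matrix_vector_mul_linear_gen] by (rule norm_sum)

lemma dual_pos: "u \<noteq> 0 \<Longrightarrow> 0 < dual u y"
  using norm_le_dual[of u y] by (auto simp: less_le)

lemma measurable_dual [measurable]: "dual u \<in> borel_measurable lebesgue"
  unfolding dual_def
  by (intro measurable_compose[OF _ borel_measurable_norm] measurable_matrix_vector
      measurable_matrix_inv measurable_W invertible_W borel_measurable_const)

lemma measurable_t [measurable (raw)]:
  assumes "f \<in> M \<rightarrow>\<^sub>M lebesgue" "g \<in> M \<rightarrow>\<^sub>M lebesgue"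
  shows "(\<lambda>z. t (f z) (g z)) \<in> borel_measurable M"
  unfolding transfer_norm_def
  using measurable_compose[OF assms(1) measurable_W] measurable_compose[OF assms(2) measurable_W]
  by (intro measurable_onorm measurable_matrix_mult measurable_matrix_inv invertible_W)

end

text \<open>
  The map \<open>\<iota>\<close> sends a point to the finest cube that contains it.
\<close>

locale cell_space = nested_cells cell D
  for cell :: "nat \<Rightarrow> 'x::countable \<Rightarrow> 'x set" and D :: real +
  fixes \<iota> :: "real ^ 'n::finite \<Rightarrow> 'x" and \<nu> :: real
  assumes measurable_\<iota>: "\<iota> \<in> lebesgue \<rightarrow>\<^sub>M count_space UNIV"
    and emeasure_fibre: "emeasure lebesgue (\<iota> -` {m}) = ennreal \<nu>"
    and \<nu>_pos: "0 < \<nu>"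
begin

abbreviation reg :: "'x set \<Rightarrow> (real ^ 'n) set" where
  "reg Q \<equiv> \<iota> -` Q"

definition av :: "'x set \<Rightarrow> (real ^ 'n \<Rightarrow> ennreal) \<Rightarrow> ennreal" where
  "av Q g = (\<integral>\<^sup>+x\<in>reg Q. g x \<partial>lebesgue) / ennreal (card Q * \<nu>)"

lemma sets_reg [measurable]: "reg Q \<in> sets lebesgue"
  using measurable_sets[OF measurable_\<iota>, of Q] by simp

lemma indicator_reg: "finite Q \<Longrightarrow> (indicator (reg Q) x :: ennreal) = (\<Sum>m\<in>Q. indicator (reg {m}) x)"
  by (simp add: indicator_def sum.If_cases if_distrib cong: if_cong)

lemma integral_reg:
  assumes "finite Q" and [measurable]: "g \<in> borel_measurable lebesgue"
  shows "(\<integral>\<^sup>+x\<in>reg Q. g x \<partial>lebesgue) = (\<Sum>m\<in>Q. \<integral>\<^sup>+x\<in>reg {m}. g x \<partial>lebesgue)"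
  unfolding indicator_reg[OF assms(1)] sum_distrib_left by (rule nn_integral_sum) measurable

lemma emeasure_reg: "finite Q \<Longrightarrow> emeasure lebesgue (reg Q) = ennreal (card Q * \<nu>)"
  using integral_reg[of Q "\<lambda>_. 1"] \<nu>_pos
  by (simp add: emeasure_fibre ennreal_of_nat_eq_real_of_nat ennreal_mult)

lemma card_\<nu>_pos: "finite Q \<Longrightarrow> Q \<noteq> {} \<Longrightarrow> 0 < card Q * \<nu>"
  using \<nu>_pos by (simp add: card_gt_0_iff)

lemma integral_eq_av:
  assumes "finite Q" "Q \<noteq> {}"
  shows "(\<integral>\<^sup>+x\<in>reg Q. g x \<partial>lebesgue) = av Q g * ennreal (card Q * \<nu>)"
  unfolding av_def using card_\<nu>_pos[OF assms] assms
  by (subst ennreal_divide_mult_cancel) (auto simp: card_gt_0_iff)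

lemma av_le_iff:
  assumes "finite Q" "Q \<noteq> {}"
  shows "av Q g \<le> c \<longleftrightarrow> (\<integral>\<^sup>+x\<in>reg Q. g x \<partial>lebesgue) \<le> c * ennreal (card Q * \<nu>)"
  unfolding av_def using card_\<nu>_pos[OF assms] assms by (intro ennreal_divide_le_iff) (auto simp: card_gt_0_iff)

lemma av_mono: "(\<And>x. g x \<le> h x) \<Longrightarrow> av Q g \<le> av Q h"
  unfolding av_def by (intro divide_right_mono_ennreal nn_integral_mono mult_right_mono) auto

lemma av_cmult:
  assumes [measurable]: "g \<in> borel_measurable lebesgue"
  shows "av Q (\<lambda>x. c * g x) = c * av Q g"
  unfolding av_def by (simp add: nn_integral_cmult mult.assoc ennreal_times_divide)

lemma integral_reg_pos:
  assumes "finite Q" "Q \<noteq> {}" and [measurable]: "g \<in> borel_measurable lebesgue" and "\<And>x. 0 < g x"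
  shows "0 < (\<integral>\<^sup>+x\<in>reg Q. g x \<partial>lebesgue)"
proof (rule ccontr)
  assume "\<not> ?thesis"
  then have "AE x in lebesgue. g x * indicator (reg Q) x = 0"
    by (simp add: nn_integral_0_iff_AE)
  then have "AE x in lebesgue. x \<notin> reg Q"
    by eventually_elim (use assms(4) in \<open>auto simp: indicator_def less_le split: if_splits\<close>)
  then have "emeasure lebesgue (reg Q) = 0"
    by (subst (asm) AE_iff_measurable[OF sets_reg]) auto
  moreover have "0 < emeasure lebesgue (reg Q)"
    using card_\<nu>_pos[OF assms(1,2)] unfolding emeasure_reg[OF assms(1)] by simp
  ultimately show False by simp
qed

end

locale weighted_cells = invertible_weight W + cell_space cell D \<iota> \<nu>
  for W :: "real ^ 'n::finite \<Rightarrow> real ^ 'd::finite ^ 'd"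
    and cell :: "nat \<Rightarrow> 'x::countable \<Rightarrow> 'x set" and D :: real
    and \<iota> :: "real ^ 'n \<Rightarrow> 'x" and \<nu> :: real +
  fixes p :: real
  assumes p: "1 < p"
begin

abbreviation p' :: real where "p' \<equiv> p / (p - 1)"

text \<open>
  The inner mean in the \<open>A\<^sub>p\<close> condition.
\<close>

definition \<tau> :: "'x set \<Rightarrow> real ^ 'n \<Rightarrow> ennreal" where
  "\<tau> Q x = ennpowr (av Q (\<lambda>y. ennpowr (ennreal (t x y)) p')) (1 / p')"

definition mass :: "real ^ 'd \<Rightarrow> 'x set \<Rightarrow> ennreal" where
  "mass u Q = (\<integral>\<^sup>+y\<in>reg Q. ennreal (dual u y powr p') \<partial>lebesgue)"

lemma p': "1 < p'" "1 / p + 1 / p' = 1" "p' / p = p' - 1" "1 < p"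
  using p by (auto simp: field_simps)

lemma measurable_\<tau> [measurable]: "\<tau> Q \<in> borel_measurable lebesgue"
proof -
  interpret lebesgue: sigma_finite_measure "lebesgue :: (real ^ 'n) measure"
    by (rule sigma_finite_lebesgue)
  show ?thesis unfolding \<tau>_def av_def by measurable
qed

lemma mass_mono: "E \<subseteq> Q \<Longrightarrow> mass u E \<le> mass u Q"
  unfolding mass_def by (intro nn_integral_mono mult_left_mono) (auto simp: indicator_def)

lemma mass_pos: "finite Q \<Longrightarrow> Q \<noteq> {} \<Longrightarrow> u \<noteq> 0 \<Longrightarrow> 0 < mass u Q"
  unfolding mass_def using dual_pos[of u] p'
  by (intro integral_reg_pos) (auto simp: less_le)

text \<open>
  Averaged over a cell, \<open>dual u y \<le> t x y * dual u x\<close> compares the \<open>L\<^bsup>p'\<^esup>\<close> mean of \<open>dual u\<close> with its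
  value at any point. This turns the matrix condition on \<open>W\<close> into a scalar one for every direction
  \<open>u\<close>.
\<close>

lemma av_dual_le: "av Q (\<lambda>y. ennreal (dual u y powr p'))
    \<le> av Q (\<lambda>y. ennpowr (ennreal (t x y)) p') * ennreal (dual u x powr p')"
proof -
  have "ennreal (dual u y powr p') \<le> ennreal (dual u x powr p') * ennpowr (ennreal (t x y)) p'" for y
    using powr_mono2[OF _ _ dual_le, of p' u y x] p'
    by (simp add: powr_mult mult.commute flip: ennreal_mult)
  then show ?thesis by (subst mult.commute, subst av_cmult[symmetric]) (auto intro: av_mono)
qed

end

locale Ap_cells = weighted_cells W cell D \<iota> \<nu> p
  for W :: "real ^ 'n::finite \<Rightarrow> real ^ 'd::finite ^ 'd"
    and cell :: "nat \<Rightarrow> 'x::countable \<Rightarrow> 'x set" and D :: real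
    and \<iota> :: "real ^ 'n \<Rightarrow> 'x" and \<nu> p :: real +
  fixes A :: real
  assumes A_nonneg: "0 \<le> A"
    and Ap: "(\<integral>\<^sup>+x\<in>reg (cell i m). ennpowr (\<tau> (cell i m) x) p \<partial>lebesgue)
      \<le> ennreal (A powr p) * ennreal (card (cell i m) * \<nu>)"
begin

text \<open>
  The \<open>A\<^sub>p\<close> condition yields one point where \<open>\<tau>\<close> is finite, and submultiplicativity of \<open>t\<close> carries
  this to all points.
\<close>

lemma \<tau>_finite: "\<tau> (cell i m) x < top"
proof -
  let ?Q = "cell i m"
  have "\<exists>x0. \<tau> ?Q x0 < top"
  proof (rule ccontr)
    assume "\<not> ?thesis"
    then have "\<tau> ?Q x0 = top" for x0 by (auto simp: not_less top_unique)
    then have "(\<integral>\<^sup>+x\<in>reg ?Q. ennpowr (\<tau> ?Q x) p \<partial>lebesgue) = top * emeasure lebesgue (reg ?Q)"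
      using nn_integral_cmult_indicator[OF sets_reg, of top ?Q] by simp
    also have "\<dots> = top"
      unfolding emeasure_reg[OF finite_cell] using \<nu>_pos by (simp add: ennreal_top_mult)
    finally show False using Ap[of i m] by (simp add: top_unique ennreal_mult_eq_top_iff)
  qed
  then obtain x0 where x0: "\<tau> ?Q x0 < top" by blast
  have "ennpowr (ennreal (t x y)) p' \<le> ennreal (t x x0 powr p') * ennpowr (ennreal (t x0 y)) p'" for y
    using powr_mono2[OF _ _ t_submultiplicative[of x y x0], of p'] p'
    by (simp add: powr_mult flip: ennreal_mult)
  then have "av ?Q (\<lambda>y. ennpowr (ennreal (t x y)) p')
      \<le> ennreal (t x x0 powr p') * av ?Q (\<lambda>y. ennpowr (ennreal (t x0 y)) p')"
    by (subst av_cmult[symmetric]) (auto intro: av_mono)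
  also have "\<dots> < top" using x0 by (simp add: \<tau>_def ennreal_mult_less_top)
  finally show ?thesis by (simp add: \<tau>_def)
qed

lemma mass_finite: "mass u (cell i m) < top"
proof -
  have "av (cell i m) (\<lambda>y. ennreal (dual u y powr p')) < top"
    using av_dual_le[of "cell i m" u undefined] \<tau>_finite[of i m undefined]
    by (auto simp: \<tau>_def ennreal_mult_less_top intro: le_less_trans)
  then show ?thesis
    by (simp add: mass_def integral_eq_av ennreal_mult_less_top)
qed

text \<open>
  By \<open>av_dual_le\<close> the function \<open>\<tau> Q * dual u\<close> is bounded below by the \<open>L\<^bsup>p'\<^esup>\<close> mean of \<open>dual u\<close> over
  the cell \<open>Q\<close>. Integrate this over \<open>E\<close> and apply Hoelder's inequality to the product: the factor
  with \<open>\<tau>\<close> is controlled by \<open>A\<close>, the other one is the mass of \<open>E\<close>.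
\<close>

lemma mass_A_infinity:
  fixes \<kappa> :: real
  assumes E: "E \<subseteq> cell i m" and \<kappa>: "0 \<le> \<kappa>" "card (cell i m) \<le> \<kappa> * card E"
  shows "mass u (cell i m) \<le> ennreal (\<kappa> powr p' * A powr p') * mass u E"
proof -
  let ?Q = "cell i m"
  obtain n where n: "mass u ?Q = ennreal n" "0 \<le> n"
    using mass_finite[of u i m] by (cases "mass u ?Q") auto
  obtain j where j: "mass u E = ennreal j" "0 \<le> j"
    using le_less_trans[OF mass_mono[OF E] mass_finite, of u] by (cases "mass u E") auto
  define q e where "q = card ?Q * \<nu>" and "e = card E * \<nu>"
  have q: "0 < q" "q \<le> \<kappa> * e" and e: "0 \<le> e"
    using \<nu>_pos \<kappa>(2) unfolding q_def e_def by (auto simp: card_gt_0_iff intro: mult_right_mono)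
  have finE: "finite E" using E by (rule finite_subset) simp
  have "av ?Q (\<lambda>y. ennreal (dual u y powr p')) = ennreal (n / q)"
    using n q unfolding av_def mass_def q_def by (simp add: divide_ennreal)
  then have "ennpowr (ennreal (n / q)) (1 / p')
      \<le> ennpowr (av ?Q (\<lambda>y. ennpowr (ennreal (t x y)) p') * ennreal (dual u x powr p')) (1 / p')" for x
    using av_dual_le[of ?Q u x] p by (intro ennpowr_mono) auto
  then have low: "ennreal ((n / q) powr (1 / p')) \<le> \<tau> ?Q x * ennreal (dual u x)" for x
    using n q p by (simp add: ennpowr_mult \<tau>_def powr_powr)
  have "ennreal ((n / q) powr (1 / p') * e) = (\<integral>\<^sup>+x\<in>reg E. ennreal ((n / q) powr (1 / p')) \<partial>lebesgue)"
    unfolding nn_integral_cmult_indicator[OF sets_reg] emeasure_reg[OF finE] e_def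
    using \<nu>_pos by (intro ennreal_mult) auto
  also have "\<dots> \<le> (\<integral>\<^sup>+x. (\<tau> ?Q x * indicator (reg ?Q) x) * (ennreal (dual u x) * indicator (reg E) x) \<partial>lebesgue)"
    using low E by (intro nn_integral_mono) (auto simp: indicator_def)
  also have "\<dots> \<le> ennpowr (\<integral>\<^sup>+x. ennpowr (\<tau> ?Q x * indicator (reg ?Q) x) p \<partial>lebesgue) (1 / p) *
      ennpowr (\<integral>\<^sup>+x. ennpowr (ennreal (dual u x) * indicator (reg E) x) p' \<partial>lebesgue) (1 / p')"
    by (intro nn_integral_Holder p p') auto
  also have "(\<lambda>x. ennpowr (\<tau> ?Q x * indicator (reg ?Q) x) p) = (\<lambda>x. ennpowr (\<tau> ?Q x) p * indicator (reg ?Q) x)"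
    by (auto simp: indicator_def)
  also have "(\<lambda>x. ennpowr (ennreal (dual u x) * indicator (reg E) x) p') =
      (\<lambda>x. ennreal (dual u x powr p') * indicator (reg E) x)"
    by (auto simp: indicator_def)
  also have "(\<integral>\<^sup>+x. ennreal (dual u x powr p') * indicator (reg E) x \<partial>lebesgue) = ennreal j"
    using j(1) unfolding mass_def .
  also have "ennpowr (\<integral>\<^sup>+x\<in>reg ?Q. ennpowr (\<tau> ?Q x) p \<partial>lebesgue) (1 / p) * ennpowr (ennreal j) (1 / p')
      \<le> ennpowr (ennreal (A powr p * q)) (1 / p) * ennpowr (ennreal j) (1 / p')"
    using Ap[of i m] p q by (intro mult_right_mono ennpowr_mono) (auto simp: q_def ennreal_mult)
  also have "\<dots> = ennreal (A * q powr (1 / p) * j powr (1 / p'))"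
    using A_nonneg p q j by (simp add: powr_mult powr_powr flip: ennreal_mult)
  finally have 1: "(n / q) powr (1 / p') * e \<le> A * q powr (1 / p) * j powr (1 / p')"
    using A_nonneg by (subst (asm) ennreal_le_iff) auto
  have "(n / q) powr (1 / p') * q \<le> (n / q) powr (1 / p') * (\<kappa> * e)"
    using q by (intro mult_left_mono) auto
  also have "\<dots> \<le> \<kappa> * (A * q powr (1 / p) * j powr (1 / p'))"
    using mult_left_mono[OF 1 \<kappa>(1)] by (simp add: mult_ac)
  finally have "((n / q) powr (1 / p') * q) powr p' \<le> (\<kappa> * (A * q powr (1 / p) * j powr (1 / p'))) powr p'"
    using q p' by (intro powr_mono2) auto
  then have "n / q * q powr p' \<le> \<kappa> powr p' * (A powr p' * q powr (p' - 1) * j)"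
    using n q j A_nonneg \<kappa>(1) p' by (simp add: powr_mult powr_powr)
  moreover have "q powr p' = q * q powr (p' - 1)" using powr_mult_base[of q "p' - 1"] q by simp
  ultimately have "n * q powr (p' - 1) \<le> (\<kappa> powr p' * A powr p' * j) * q powr (p' - 1)"
    using q by (simp add: mult_ac)
  then have "n \<le> \<kappa> powr p' * A powr p' * j" using q by simp
  then have "ennreal n \<le> ennreal (\<kappa> powr p' * A powr p' * j)" by (rule ennreal_leI)
  then show ?thesis using n j by (simp add: ennreal_mult)
qed

lemma A_ge_1: "1 \<le> A"
proof -
  fix m :: 'x
  obtain u :: "real ^ 'd" where u: "u \<noteq> 0"
    using that[of "axis undefined 1"] by (simp add: axis_eq_0_iff)
  obtain n where n: "mass u (cell 0 m) = ennreal n" "0 < n"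
    using mass_finite[of u 0 m] mass_pos[OF _ _ u, of "cell 0 m"]
    by (cases "mass u (cell 0 m)") (auto simp del: cell_0)
  have "ennreal n \<le> ennreal (A powr p' * n)"
    using mass_A_infinity[of "cell 0 m" 0 m 1 u] n by (simp add: ennreal_mult)
  then have "1 \<le> A powr p'" using n by (subst (asm) ennreal_le_iff) auto
  then show ?thesis using A_nonneg p' powr_less_one[of A p'] by (smt (verit) powr_less_mono2 powr_one_eq_one)
qed

text \<open>
  Apply \<open>reducing_basis\<close> to the normalized \<open>L\<^bsup>p'\<^esup>\<close> mean \<open>F u\<close> of \<open>dual u\<close> over the cell and expand
  \<open>W(x) e\<close> in the resulting basis. Its coefficients are at most \<open>2 F (W(x) e)\<close>, and \<open>F (W(x) e)\<close> is
  at most \<open>\<tau> x * norm e\<close>.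
\<close>

lemma reducing_vectors:
  obtains b :: "'d \<Rightarrow> real ^ 'd" where
    "\<And>l. mass (b l) (cell i m) \<le> ennreal (card (cell i m) * \<nu>)"
    "\<And>x y. ennreal (t x y) \<le> 2 * \<tau> (cell i m) x * ennreal (\<Sum>l\<in>UNIV. dual (b l) y)"
proof -
  let ?Q = "cell i m"
  define q where "q = card ?Q * \<nu>"
  have q: "0 < q" using \<nu>_pos by (simp add: q_def)
  define F where "F u = (enn2real (mass u ?Q) / q) powr (1 / p')" for u
  have mass_F: "mass u ?Q = ennreal (F u powr p' * q)" for u
    using mass_finite[of u i m] q p' unfolding F_def
    by (cases "mass u ?Q") (auto simp: powr_powr)
  have F0: "0 \<le> F u" for u by (simp add: F_def)
  have F_le: "F u \<le> s" if "mass u ?Q \<le> ennreal (s powr p' * q)" "0 \<le> s" for u s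
  proof (rule ccontr)
    assume "\<not> F u \<le> s"
    then have "s powr p' * q < F u powr p' * q" using that p' q by (intro mult_strict_right_mono powr_less_mono2) auto
    then show False using that(1) q unfolding mass_F by (subst (asm) ennreal_le_iff) auto
  qed
  have hom: "F (c *\<^sub>R u) = \<bar>c\<bar> * F u" for c u
  proof -
    have "mass (c *\<^sub>R u) ?Q = ennreal (\<bar>c\<bar> powr p') * mass u ?Q"
      unfolding mass_def dual_scaleR
      by (simp add: powr_mult ennreal_mult nn_integral_cmult mult.assoc)
    then have "enn2real (mass (c *\<^sub>R u) ?Q) = \<bar>c\<bar> powr p' * enn2real (mass u ?Q)"
      by (simp add: enn2real_mult)
    then show ?thesis using q p unfolding F_def
      by (simp add: powr_mult powr_powr powr_divide)
  qed
  \<comment> \<open>A lower bound for the masses of unit vectors; it makes \<open>F\<close> coercive.\<close>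
  define c1 where "c1 = (\<integral>\<^sup>+y\<in>reg ?Q. ennreal ((1 / onorm ((*v) (W y))) powr p') \<partial>lebesgue)"
  have onW: "0 < onorm ((*v) (W y))" for y
  proof -
    have "axis undefined 1 \<noteq> (0 :: real ^ 'd)" by (simp add: axis_eq_0_iff)
    then have "0 < onorm ((*v) (W y)) * dual (axis undefined 1) y"
      using norm_le_dual[of "axis undefined 1" y] by (metis less_le_trans zero_less_norm_iff)
    then have "onorm ((*v) (W y)) \<noteq> 0" by auto
    then show ?thesis using onorm_matrix_nonneg[of "W y"] by simp
  qed
  have [measurable]: "(\<lambda>y. onorm ((*v) (W y))) \<in> borel_measurable lebesgue"
    by (intro measurable_onorm measurable_W)
  have c1_pos: "0 < c1" unfolding c1_def using onW p' by (intro integral_reg_pos) (auto simp: less_le)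
  have c1_le: "ennreal (norm u powr p') * c1 \<le> mass u ?Q" for u
  proof -
    have "norm u powr p' * (1 / onorm ((*v) (W y))) powr p' \<le> dual u y powr p'" for y
    proof -
      have "norm u / onorm ((*v) (W y)) \<le> dual u y"
        using norm_le_dual[of u y] onW[of y] by (simp add: divide_le_eq mult.commute)
      then have "(norm u / onorm ((*v) (W y))) powr p' \<le> dual u y powr p'"
        using p' onW[of y] by (intro powr_mono2) auto
      then show ?thesis using onW[of y] by (simp add: powr_divide)
    qed
    then have "ennreal (norm u powr p') * ennreal ((1 / onorm ((*v) (W y))) powr p') * indicator (reg ?Q) y
       \<le> ennreal (dual u y powr p') * indicator (reg ?Q) y" for y
      by (intro mult_right_mono) (auto simp flip: ennreal_mult)
    then show ?thesis
      unfolding mass_def c1_def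
      by (subst nn_integral_cmult[symmetric]) (auto simp: mult.assoc intro!: nn_integral_mono)
  qed
  have "c1 < top"
    using c1_le[of "axis undefined 1"] mass_finite[of "axis undefined 1" i m]
    by (auto intro: le_less_trans)
  then obtain c2 where c2: "c1 = ennreal c2" "0 < c2" using c1_pos by (cases c1) auto
  define c0 where "c0 = (c2 / q) powr (1 / p')"
  have c0: "0 < c0" "c0 powr p' = c2 / q" using c2 q p' by (auto simp: c0_def powr_powr)
  have F_ge: "c0 * norm u \<le> F u" for u
  proof (rule ccontr)
    assume "\<not> c0 * norm u \<le> F u"
    then have "F u powr p' * q < (c0 * norm u) powr p' * q"
      using F0[of u] p' q by (intro mult_strict_right_mono powr_less_mono2) auto
    also have "\<dots> = norm u powr p' * c2" using c0 q by (simp add: powr_mult)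
    finally show False using c1_le[of u] c2 q unfolding mass_F
      by (simp flip: ennreal_mult)
  qed
  obtain b :: "'d \<Rightarrow> real ^ 'd" where b: "\<And>l. F (b l) \<le> 1"
    "\<And>v. \<exists>\<beta>. v = (\<Sum>l\<in>UNIV. \<beta> l *\<^sub>R b l) \<and> (\<forall>l. \<bar>\<beta> l\<bar> \<le> 2 * F v)"
    using reducing_basis[of F, OF hom c0(1) F_ge] by blast
  show ?thesis
  proof (rule that[of b])
    fix l
    have "F (b l) powr p' * q \<le> 1 * q"
      using b(1)[of l] F0[of "b l"] p' q by (intro mult_right_mono powr_le1) auto
    then show "mass (b l) ?Q \<le> ennreal (card ?Q * \<nu>)"
      unfolding mass_F q_def by (intro ennreal_leI) simp
  next
    fix x y
    obtain s where s: "\<tau> ?Q x = ennreal s" "0 \<le> s" using \<tau>_finite[of i m x] by (cases "\<tau> ?Q x") auto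
    have s_av: "av ?Q (\<lambda>y. ennpowr (ennreal (t x y)) p') = ennreal (s powr p')"
      using arg_cong[OF s(1), of "\<lambda>z. ennpowr z p'"] s(2) p' by (simp add: \<tau>_def ennpowr_ennpowr)
    have FW: "F (W x *v e) \<le> norm e * s" for e
    proof (rule F_le)
      have "mass (W x *v e) ?Q \<le> (\<integral>\<^sup>+y\<in>reg ?Q. ennreal (norm e powr p') * ennpowr (ennreal (t x y)) p' \<partial>lebesgue)"
        unfolding mass_def
      proof (intro nn_integral_mono mult_right_mono)
        fix y
        have "dual (W x *v e) y powr p' \<le> (t x y * norm e) powr p'"
          using p' by (intro powr_mono2 dual_W_le) auto
        then show "ennreal (dual (W x *v e) y powr p') \<le> ennreal (norm e powr p') * ennpowr (ennreal (t x y)) p'"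
          by (simp add: powr_mult mult.commute flip: ennreal_mult)
      qed auto
      also have "\<dots> = ennreal (norm e powr p') * ennreal (s powr p') * ennreal q"
        unfolding s_av[symmetric] mult.assoc q_def by (simp add: nn_integral_cmult integral_eq_av)
      also have "\<dots> = ennreal ((norm e * s) powr p' * q)"
        using s q by (simp add: powr_mult flip: ennreal_mult)
      finally show "mass (W x *v e) ?Q \<le> ennreal ((norm e * s) powr p' * q)" .
    qed (use s in simp)
    define \<Sigma> where "\<Sigma> = (\<Sum>l\<in>UNIV. dual (b l) y)"
    have \<Sigma>0: "0 \<le> \<Sigma>" by (simp add: \<Sigma>_def sum_nonneg)
    have "t x y \<le> 2 * s * \<Sigma>"
    proof (rule t_le)
      fix e
      obtain \<beta> where \<beta>: "W x *v e = (\<Sum>l\<in>UNIV. \<beta> l *\<^sub>R b l)" "\<And>l. \<bar>\<beta> l\<bar> \<le> 2 * F (W x *v e)"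
        using b(2)[of "W x *v e"] by blast
      have "dual (W x *v e) y \<le> (\<Sum>l\<in>UNIV. \<bar>\<beta> l\<bar> * dual (b l) y)"
        unfolding \<beta>(1) using dual_sum_le[of "\<lambda>l. \<beta> l *\<^sub>R b l" UNIV y] by (simp add: dual_scaleR)
      also have "\<dots> \<le> (\<Sum>l\<in>UNIV. 2 * F (W x *v e) * dual (b l) y)"
        using \<beta>(2) by (intro sum_mono mult_right_mono) auto
      also have "\<dots> = 2 * F (W x *v e) * \<Sigma>" by (simp add: \<Sigma>_def sum_distrib_left)
      also have "\<dots> \<le> 2 * (norm e * s) * \<Sigma>" using FW[of e] \<Sigma>0 by (intro mult_right_mono mult_left_mono) auto
      finally show "dual (W x *v e) y \<le> 2 * s * \<Sigma> * norm e" by (simp add: mult_ac)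
    qed
    then have "ennreal (t x y) \<le> ennreal (2 * s * \<Sigma>)" by (rule ennreal_leI)
    then show "ennreal (t x y) \<le> 2 * \<tau> ?Q x * ennreal (\<Sum>l\<in>UNIV. dual (b l) y)"
      using s \<Sigma>0 by (simp add: ennreal_mult flip: \<Sigma>_def)
  qed
qed

text \<open>
  A scalar weight through which the kernel almost factorizes on \<open>S\<close>. Its normalization refers to \<open>S\<close>
  only, whereas the \<open>A\<^sub>\<infinity>\<close> condition holds on all cells.
\<close>

definition adapted :: "'x set \<Rightarrow> (real ^ 'n \<Rightarrow> real) \<Rightarrow> bool" where
  "adapted S \<sigma> \<longleftrightarrow> \<sigma> \<in> borel_measurable lebesgue \<and> (\<forall>y. 0 \<le> \<sigma> y) \<and>
    (\<forall>x y. ennreal (t x y) \<le> 2 * \<tau> S x * ennreal (\<sigma> y powr (1 / p'))) \<and>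
    (\<integral>\<^sup>+y\<in>reg S. ennreal (\<sigma> y) \<partial>lebesgue) \<le> ennreal (CARD('d) powr (p' + 1) * (card S * \<nu>)) \<and>
    (\<forall>l k. (\<integral>\<^sup>+y\<in>reg (cell l k). ennreal (\<sigma> y) \<partial>lebesgue) < top) \<and>
    (\<forall>l k E. E \<subseteq> cell l k \<longrightarrow> card (cell l k) \<le> 2 * card E \<longrightarrow>
      (\<integral>\<^sup>+y\<in>reg (cell l k). ennreal (\<sigma> y) \<partial>lebesgue)
        \<le> ennreal (2 powr p' * A powr p') * (\<integral>\<^sup>+y\<in>reg E. ennreal (\<sigma> y) \<partial>lebesgue))"

text \<open>
  The sum of the powers \<open>(dual (b l))\<^bsup>p'\<^esup>\<close> for a basis \<open>b\<close> as in \<open>reducing_vectors\<close>. Being a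
  positive combination, it inherits the \<open>A\<^sub>\<infinity>\<close> condition of its summands. The factor \<open>d\<^bsup>p'\<^esup>\<close> pays for
  replacing the sum of \<open>dual (b l)\<close> by a power mean.
\<close>

lemma ex_adapted: "\<exists>\<sigma>. adapted (cell i m) \<sigma>"
proof -
  obtain b :: "'d \<Rightarrow> real ^ 'd" where b: "\<And>l. mass (b l) (cell i m) \<le> ennreal (card (cell i m) * \<nu>)"
    "\<And>x y. ennreal (t x y) \<le> 2 * \<tau> (cell i m) x * ennreal (\<Sum>l\<in>UNIV. dual (b l) y)"
    using reducing_vectors[of i m] by blast
  define N where "N = real CARD('d)"
  define \<sigma> where "\<sigma> y = N powr p' * (\<Sum>l\<in>UNIV. dual (b l) y powr p')" for y
  have N: "0 < N" by (simp add: N_def)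
  have meas [measurable]: "\<sigma> \<in> borel_measurable lebesgue" unfolding \<sigma>_def by measurable
  have \<sigma>0: "0 \<le> \<sigma> y" for y unfolding \<sigma>_def by (intro mult_nonneg_nonneg sum_nonneg) auto
  have int: "(\<integral>\<^sup>+y\<in>reg Q. ennreal (\<sigma> y) \<partial>lebesgue) = ennreal (N powr p') * (\<Sum>l\<in>UNIV. mass (b l) Q)" for Q
  proof -
    have eq: "ennreal (\<sigma> y) * indicator (reg Q) y =
        ennreal (N powr p') * (\<Sum>l\<in>UNIV. ennreal (dual (b l) y powr p') * indicator (reg Q) y)" for y
    proof -
      have "ennreal (\<sigma> y) = ennreal (N powr p') * (\<Sum>l\<in>UNIV. ennreal (dual (b l) y powr p'))"
        unfolding \<sigma>_def by (simp add: ennreal_mult sum_nonneg sum_ennreal)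
      then show ?thesis by (simp only: sum_distrib_right mult.assoc)
    qed
    have [measurable]: "(\<lambda>y. ennreal (dual (b l) y powr p') * indicator (reg Q) y) \<in> borel_measurable lebesgue" for l
      by measurable
    show ?thesis unfolding eq mass_def
      by (subst nn_integral_cmult, measurable, subst nn_integral_sum) simp_all
  qed
  have sum_le: "(\<Sum>l\<in>UNIV. dual (b l) y) \<le> \<sigma> y powr (1 / p')" for y
  proof -
    let ?r = "(\<Sum>l\<in>UNIV. dual (b l) y powr p') powr (1 / p')"
    have "dual (b l) y \<le> ?r" for l
    proof -
      have "dual (b l) y powr p' \<le> (\<Sum>l\<in>UNIV. dual (b l) y powr p')"
        by (intro member_le_sum) auto
      then have "(dual (b l) y powr p') powr (1 / p') \<le> ?r" using p by (intro powr_mono2) auto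
      then show ?thesis using p by (simp add: powr_powr)
    qed
    then have "(\<Sum>l\<in>UNIV. dual (b l) y) \<le> (\<Sum>l\<in>(UNIV :: 'd set). ?r)" by (rule sum_mono)
    also have "\<dots> = \<sigma> y powr (1 / p')"
      using N p' unfolding \<sigma>_def N_def by (simp add: powr_mult sum_nonneg powr_powr)
    finally show ?thesis .
  qed
  show ?thesis
    unfolding adapted_def
  proof (intro exI[of _ \<sigma>] conjI allI impI meas \<sigma>0)
    fix x y
    show "ennreal (t x y) \<le> 2 * \<tau> (cell i m) x * ennreal (\<sigma> y powr (1 / p'))"
      using b(2)[of x y] by (rule order_trans) (intro mult_left_mono ennreal_leI sum_le; simp)
  next
    have "(\<Sum>l\<in>UNIV. mass (b l) (cell i m)) \<le> (\<Sum>l\<in>(UNIV :: 'd set). ennreal (card (cell i m) * \<nu>))"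
      by (intro sum_mono b)
    also have "\<dots> = ennreal (N * (card (cell i m) * \<nu>))"
      using \<nu>_pos by (simp add: N_def ennreal_mult ennreal_of_nat_eq_real_of_nat)
    finally have "(\<integral>\<^sup>+y\<in>reg (cell i m). ennreal (\<sigma> y) \<partial>lebesgue)
        \<le> ennreal (N powr p') * ennreal (N * (card (cell i m) * \<nu>))"
      unfolding int by (intro mult_left_mono) auto
    also have "\<dots> = ennreal (N powr (p' + 1) * (card (cell i m) * \<nu>))"
      using N \<nu>_pos by (simp add: powr_add mult_ac flip: ennreal_mult)
    finally show "(\<integral>\<^sup>+y\<in>reg (cell i m). ennreal (\<sigma> y) \<partial>lebesgue)
      \<le> ennreal (CARD('d) powr (p' + 1) * (card (cell i m) * \<nu>))" unfolding N_def .
  next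
    fix l k
    show "(\<integral>\<^sup>+y\<in>reg (cell l k). ennreal (\<sigma> y) \<partial>lebesgue) < top"
      unfolding int using mass_finite by (simp add: ennreal_mult_less_top)
    fix E assume E: "E \<subseteq> cell l k" "card (cell l k) \<le> 2 * card E"
    have "(\<Sum>i\<in>UNIV. mass (b i) (cell l k)) \<le> (\<Sum>i\<in>UNIV. ennreal (2 powr p' * A powr p') * mass (b i) E)"
      using E by (intro sum_mono mass_A_infinity) (auto simp flip: of_nat_mult)
    then show "(\<integral>\<^sup>+y\<in>reg (cell l k). ennreal (\<sigma> y) \<partial>lebesgue)
        \<le> ennreal (2 powr p' * A powr p') * (\<integral>\<^sup>+y\<in>reg E. ennreal (\<sigma> y) \<partial>lebesgue)"
      unfolding int by (subst mult.left_commute) (auto simp flip: sum_distrib_left intro: mult_left_mono)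
  qed
qed

end

section \<open>The one-parameter maximal operator\<close>

text \<open>
  The constant of the one-parameter bound for matrices of size \<open>d\<close> and cells that grow by at most
  the factor \<open>D\<close> from one level to the next. The first factor comes from the two stopping and kernel
  factors 2, the middle ones from \<open>sparse_weighted_means\<close> with \<open>H = d\<^bsup>p' + 1\<^esup>\<close>, and the last one
  from \<open>L = (2 A)\<^bsup>p'\<^esup>\<close>.
\<close>

definition bound_const :: "real \<Rightarrow> real \<Rightarrow> real \<Rightarrow> real" where
  "bound_const p d D = 4 powr p * (4 * d powr (p / (p - 1) + 1)) powr p * exp p *
     (16 * D * (1 + p) / (p - 1)) * 2 powr (p / (p - 1))"

context cell_space
begin

lemma av_eq_mult: "finite Q \<Longrightarrow> Q \<noteq> {} \<Longrightarrow>
    av Q g = (\<integral>\<^sup>+x\<in>reg Q. g x \<partial>lebesgue) * ennreal (1 / (card Q * \<nu>))"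
  using inverse_ennreal[OF card_\<nu>_pos[of Q]] unfolding av_def
  by (simp add: divide_ennreal_def inverse_eq_divide)

lemma av_Holder:
  assumes pq: "1 < p" "1 < q" "1 / p + 1 / q = 1" and Q: "finite Q" "Q \<noteq> {}"
    and [measurable]: "f \<in> borel_measurable lebesgue" "g \<in> borel_measurable lebesgue"
  shows "av Q (\<lambda>x. f x * g x) \<le>
    ennpowr (av Q (\<lambda>x. ennpowr (f x) p)) (1 / p) * ennpowr (av Q (\<lambda>x. ennpowr (g x) q)) (1 / q)"
proof -
  define c where "c = 1 / (card Q * \<nu>)"
  have c: "0 < c" using card_\<nu>_pos[OF Q] by (simp add: c_def)
  have "(\<integral>\<^sup>+x\<in>reg Q. f x * g x \<partial>lebesgue) =
      (\<integral>\<^sup>+x. (f x * indicator (reg Q) x) * (g x * indicator (reg Q) x) \<partial>lebesgue)"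
    by (intro nn_integral_cong) (auto simp: indicator_def)
  also have "\<dots> \<le> ennpowr (\<integral>\<^sup>+x. ennpowr (f x * indicator (reg Q) x) p \<partial>lebesgue) (1 / p) *
      ennpowr (\<integral>\<^sup>+x. ennpowr (g x * indicator (reg Q) x) q \<partial>lebesgue) (1 / q)"
    by (intro nn_integral_Holder pq) auto
  also have "(\<lambda>x. ennpowr (f x * indicator (reg Q) x) p) = (\<lambda>x. ennpowr (f x) p * indicator (reg Q) x)"
    by (auto simp: indicator_def)
  also have "(\<lambda>x. ennpowr (g x * indicator (reg Q) x) q) = (\<lambda>x. ennpowr (g x) q * indicator (reg Q) x)"
    by (auto simp: indicator_def)
  finally have le: "(\<integral>\<^sup>+x\<in>reg Q. f x * g x \<partial>lebesgue) * ennreal c \<le>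
      (ennpowr (\<integral>\<^sup>+x\<in>reg Q. ennpowr (f x) p \<partial>lebesgue) (1 / p) *
       ennpowr (\<integral>\<^sup>+x\<in>reg Q. ennpowr (g x) q \<partial>lebesgue) (1 / q)) * ennreal c"
    by (rule mult_right_mono) simp
  have cc: "ennreal c = ennpowr (ennreal c) (1 / p) * ennpowr (ennreal c) (1 / q)"
    using c pq by (simp flip: ennreal_mult powr_add)
  note le
  also have "(ennpowr (\<integral>\<^sup>+x\<in>reg Q. ennpowr (f x) p \<partial>lebesgue) (1 / p) *
       ennpowr (\<integral>\<^sup>+x\<in>reg Q. ennpowr (g x) q \<partial>lebesgue) (1 / q)) * ennreal c =
      ennpowr ((\<integral>\<^sup>+x\<in>reg Q. ennpowr (f x) p \<partial>lebesgue) * ennreal c) (1 / p) *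
      ennpowr ((\<integral>\<^sup>+x\<in>reg Q. ennpowr (g x) q \<partial>lebesgue) * ennreal c) (1 / q)"
    unfolding ennpowr_mult by (subst cc) (simp only: mult_ac)
  finally show ?thesis unfolding av_eq_mult[OF Q] c_def .
qed

lemma av_le_mean:
  assumes C: "finite C" "C \<noteq> {}" and [measurable]: "g \<in> borel_measurable lebesgue"
    and h: "\<And>z. z \<in> C \<Longrightarrow> av {z} g \<le> ennreal (h z)" "\<And>z. z \<in> C \<Longrightarrow> 0 \<le> h z"
  shows "av C g \<le> ennreal (mean C h)"
proof (subst av_le_iff[OF C])
  have "(\<integral>\<^sup>+x\<in>reg C. g x \<partial>lebesgue) = (\<Sum>z\<in>C. av {z} g * ennreal \<nu>)"
    unfolding integral_reg[OF C(1) assms(3)] by (simp add: integral_eq_av)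
  also have "\<dots> \<le> (\<Sum>z\<in>C. ennreal (h z) * ennreal \<nu>)"
    using h by (intro sum_mono mult_right_mono) auto
  also have "\<dots> = (\<Sum>z\<in>C. ennreal (h z * \<nu>))"
    using h \<nu>_pos by (intro sum.cong) (auto simp: ennreal_mult)
  also have "\<dots> = ennreal (\<Sum>z\<in>C. h z * \<nu>)"
    using h \<nu>_pos by (intro sum_ennreal) auto
  also have "(\<Sum>z\<in>C. h z * \<nu>) = mean C h * (card C * \<nu>)"
    unfolding sum_distrib_right[symmetric] card_times_mean[OF C(1), of h, symmetric] by simp
  also have "ennreal \<dots> = ennreal (mean C h) * ennreal (card C * \<nu>)"
    using h \<nu>_pos by (intro ennreal_mult mean_nonneg) auto
  finally show "(\<integral>\<^sup>+x\<in>reg C. g x \<partial>lebesgue) \<le> ennreal (mean C h) * ennreal (card C * \<nu>)" .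
qed

lemma nn_integral_split_cells:
  assumes [measurable]: "g \<in> borel_measurable lebesgue"
  shows "(\<integral>\<^sup>+x. g x \<partial>lebesgue) =
    (\<integral>\<^sup>+Q. (\<integral>\<^sup>+x\<in>reg Q. g x \<partial>lebesgue) \<partial>count_space (range (cell k)))"
proof -
  have "g x = (\<integral>\<^sup>+Q. g x * indicator (reg Q) x \<partial>count_space (range (cell k)))" for x
  proof -
    have "(indicator (reg Q) x :: ennreal) = indicator {cell k (\<iota> x)} Q" if "Q \<in> range (cell k)" for Q
      using that cell_eq by (auto simp: indicator_def)
    then have "(\<integral>\<^sup>+Q. g x * indicator (reg Q) x \<partial>count_space (range (cell k))) =
        (\<integral>\<^sup>+Q. g x * indicator {cell k (\<iota> x)} Q \<partial>count_space (range (cell k)))"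
      by (intro nn_integral_cong) simp
    also have "\<dots> = g x" by (subst nn_integral_cmult_indicator) auto
    finally show ?thesis by simp
  qed
  then have "(\<integral>\<^sup>+x. g x \<partial>lebesgue) =
      (\<integral>\<^sup>+x. (\<integral>\<^sup>+Q. g x * indicator (reg Q) x \<partial>count_space (range (cell k))) \<partial>lebesgue)"
    by simp
  also have "\<dots> = (\<integral>\<^sup>+Q. (\<integral>\<^sup>+x\<in>reg Q. g x \<partial>lebesgue) \<partial>count_space (range (cell k)))"
    by (rule nn_integral_count_space_nn_integral) auto
  finally show ?thesis .
qed

end

context weighted_cells
begin

definition T :: "nat \<Rightarrow> (real ^ 'n \<Rightarrow> ennreal) \<Rightarrow> real ^ 'n \<Rightarrow> ennreal" where
  "T N \<phi> x = (SUP i\<in>{..N}. av (cell i (\<iota> x)) (\<lambda>y. \<phi> y * ennreal (t x y)))"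

lemma measurable_T:
  assumes [measurable]: "\<phi> \<in> borel_measurable lebesgue"
  shows "T N \<phi> \<in> borel_measurable lebesgue"
proof -
  interpret lebesgue: sigma_finite_measure "lebesgue :: (real ^ 'n) measure"
    by (rule sigma_finite_lebesgue)
  have "(\<lambda>x. av Q (\<lambda>y. \<phi> y * ennreal (t x y))) \<in> borel_measurable lebesgue" for Q
    unfolding av_def by measurable
  then have "(\<lambda>x. av (cell i (\<iota> x)) (\<lambda>y. \<phi> y * ennreal (t x y))) \<in> borel_measurable lebesgue" for i
    by (rule measurable_compose_countable[OF _ measurable_\<iota>])
  then show ?thesis unfolding T_def by (intro borel_measurable_SUP) auto
qed

end

context Ap_cells
begin

text \<open>
  Replace \<open>\<phi>\<close> by its \<open>L\<^sup>p\<close> mean \<open>\<phi>0\<close> and each adapted weight \<open>\<sigma> S\<close> by its mean \<open>s S\<close> over every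
  finest cube. Hoelder's inequality on one cube shows that the averages of \<open>\<phi> (\<sigma> S)\<^bsup>1/p'\<^esup>\<close> only
  grow, while \<open>\<integral> \<phi>\<^sup>p\<close> and the \<open>A\<^sub>\<infinity>\<close> condition are preserved. Then \<open>(T N \<phi>)\<^sup>p\<close> is dominated by a sum
  over the sparse family in which \<open>x\<close> occurs only through \<open>\<tau> S x\<close>, and the \<open>A\<^sub>p\<close> condition evaluates
  the integral of its \<open>p\<close>-th power.
\<close>

lemma T_bound_cell:
  assumes [measurable]: "\<phi> \<in> borel_measurable lebesgue"
  shows "(\<integral>\<^sup>+x\<in>reg (cell N m). ennpowr (T N \<phi> x) p \<partial>lebesgue) \<le>
    ennreal (bound_const p CARD('d) D * A powr (p + p')) * (\<integral>\<^sup>+x\<in>reg (cell N m). ennpowr (\<phi> x) p \<partial>lebesgue)"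
proof -
  let ?Q = "cell N m"
  let ?I = "\<integral>\<^sup>+x\<in>reg ?Q. ennpowr (\<phi> x) p \<partial>lebesgue"
  have K: "0 < bound_const p CARD('d) D * A powr (p + p')"
    using p D_ge A_ge_1 unfolding bound_const_def by (auto intro!: mult_pos_pos divide_pos_pos)
  show ?thesis
  proof (cases "?I = top")
    case True
    moreover have "ennreal (bound_const p CARD('d) D * A powr (p + p')) \<noteq> 0" using K by (simp only: ennreal_eq_0_iff not_le)
    ultimately show ?thesis by (simp only: ennreal_mult_top) simp
  next
    case False
    define \<sigma> where "\<sigma> S = (SOME \<sigma>. adapted S \<sigma>)" for S
    have \<sigma>: "adapted (cell i k) (\<sigma> (cell i k))" for i k
      unfolding \<sigma>_def using ex_adapted by (rule someI_ex)
    \<comment> \<open>Zero outside of the cells, so that the hypotheses of \<open>sparse_weighted_means\<close> hold for all sets \<open>S\<close>.\<close>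
    define s where "s S z = (if S \<in> (\<Union>i. range (cell i)) then enn2real (av {z} (\<lambda>y. ennreal (\<sigma> S y))) else 0)" for S z
    define \<phi>0 where "\<phi>0 z = enn2real (ennpowr (av {z} (\<lambda>y. ennpowr (\<phi> y) p)) (1 / p))" for z
    define L where "L = 2 powr p' * A powr p'"
    define H where "H = CARD('d) powr (p' + 1)"
    have L: "1 \<le> L" using A_ge_1 p' mult_mono[of 1 "2 powr p'" 1 "A powr p'"]
      by (simp add: L_def ge_one_powr_ge_zero)
    have H: "1 \<le> H" using p' unfolding H_def by (intro ge_one_powr_ge_zero) auto
    have s_int: "ennreal ((\<Sum>z\<in>E. s S z) * \<nu>) = (\<integral>\<^sup>+y\<in>reg E. ennreal (\<sigma> S y) \<partial>lebesgue)"
      if S: "S = cell i k" and E: "finite E" for S i k E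
    proof -
      have m [measurable]: "\<sigma> S \<in> borel_measurable lebesgue" using \<sigma>[of i k] by (simp add: S adapted_def)
      have eq: "ennreal (s S z * \<nu>) = (\<integral>\<^sup>+y\<in>reg {z}. ennreal (\<sigma> S y) \<partial>lebesgue)" for z
      proof -
        have "(\<integral>\<^sup>+y\<in>reg (cell 0 z). ennreal (\<sigma> S y) \<partial>lebesgue) < top"
          using \<sigma>[of i k] unfolding S adapted_def by blast
        then have "av {z} (\<lambda>y. ennreal (\<sigma> S y)) * ennreal \<nu> < top" by (simp add: integral_eq_av)
        then have "av {z} (\<lambda>y. ennreal (\<sigma> S y)) < top" using \<nu>_pos by (auto simp: ennreal_mult_less_top)
        moreover have "S \<in> (\<Union>i. range (cell i))" by (auto simp: S)
        ultimately show ?thesis using \<nu>_pos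
          by (simp add: s_def integral_eq_av ennreal_mult)
      qed
      have "(\<integral>\<^sup>+y\<in>reg E. ennreal (\<sigma> S y) \<partial>lebesgue) = (\<Sum>z\<in>E. ennreal (s S z * \<nu>))"
        unfolding eq by (intro integral_reg[OF E]) measurable
      also have "\<dots> = ennreal ((\<Sum>z\<in>E. s S z) * \<nu>)"
        unfolding sum_distrib_right using \<nu>_pos by (intro sum_ennreal) (auto simp: s_def)
      finally show ?thesis by simp
    qed
    have s0: "0 \<le> s S z" for S z by (simp add: s_def)
    have s_mean: "mean (cell i k) (s (cell i k)) \<le> H" for i k
    proof -
      let ?S = "cell i k"
      have "ennreal ((\<Sum>z\<in>?S. s ?S z) * \<nu>) \<le> ennreal (H * (card ?S * \<nu>))"
        unfolding s_int[OF refl finite_cell] using \<sigma>[of i k] unfolding adapted_def H_def by blast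
      then have "(\<Sum>z\<in>?S. s ?S z) * \<nu> \<le> H * (card ?S * \<nu>)"
        using H \<nu>_pos by (subst (asm) ennreal_le_iff) auto
      then have "(\<Sum>z\<in>?S. s ?S z) \<le> H * card ?S" using \<nu>_pos by (simp flip: mult.assoc)
      then show ?thesis by (simp add: mean_def divide_le_eq)
    qed
    have s_A: "(\<Sum>z\<in>cell l k. s S z) \<le> L * (\<Sum>z\<in>E. s S z)"
      if E: "E \<subseteq> cell l k" "card (cell l k) \<le> 2 * card E" for S l k E
    proof (cases "S \<in> (\<Union>i. range (cell i))")
      case True
      then obtain i k' where S: "S = cell i k'" by auto
      have finE: "finite E" using E(1) by (rule finite_subset) simp
      have "ennreal ((\<Sum>z\<in>cell l k. s S z) * \<nu>) \<le> ennreal L * ennreal ((\<Sum>z\<in>E. s S z) * \<nu>)"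
        unfolding s_int[OF S finite_cell] s_int[OF S finE] L_def
        using \<sigma>[of i k'] E unfolding adapted_def S by blast
      also have "\<dots> = ennreal (L * (\<Sum>z\<in>E. s S z) * \<nu>)"
        using L s0 \<nu>_pos by (simp add: mult.assoc sum_nonneg flip: ennreal_mult)
      finally have "(\<Sum>z\<in>cell l k. s S z) * \<nu> \<le> L * (\<Sum>z\<in>E. s S z) * \<nu>"
        using L s0 \<nu>_pos by (subst (asm) ennreal_le_iff) (auto intro!: mult_nonneg_nonneg sum_nonneg)
      then show ?thesis using \<nu>_pos by simp
    qed (simp add: s_def)
    have \<phi>_fin: "av {z} (\<lambda>y. ennpowr (\<phi> y) p) < top" if "z \<in> ?Q" for z
    proof -
      have "(\<integral>\<^sup>+y\<in>reg {z}. ennpowr (\<phi> y) p \<partial>lebesgue) \<le> ?I"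
        using that by (intro nn_integral_mono mult_left_mono) (auto simp: indicator_def)
      then have "av {z} (\<lambda>y. ennpowr (\<phi> y) p) * ennreal \<nu> < top"
        using False by (simp add: integral_eq_av less_top[symmetric] top_unique) (metis top.not_eq_extremum top_unique)
      then show ?thesis using \<nu>_pos by (auto simp: ennreal_mult_less_top)
    qed
    have \<phi>0_eq: "ennreal (\<phi>0 z) = ennpowr (av {z} (\<lambda>y. ennpowr (\<phi> y) p)) (1 / p)" if "z \<in> ?Q" for z
      using \<phi>_fin[OF that] by (simp add: \<phi>0_def)
    have \<phi>0_int: "ennreal ((\<Sum>z\<in>?Q. \<phi>0 z powr p) * \<nu>) = ?I"
    proof -
      have "?I = (\<Sum>z\<in>?Q. av {z} (\<lambda>y. ennpowr (\<phi> y) p) * ennreal \<nu>)"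
        by (subst integral_reg) (auto simp: integral_eq_av)
      also have "\<dots> = (\<Sum>z\<in>?Q. ennreal (\<phi>0 z powr p * \<nu>))"
      proof (rule sum.cong[OF refl])
        fix z assume "z \<in> ?Q"
        have "av {z} (\<lambda>y. ennpowr (\<phi> y) p) = ennpowr (ennreal (\<phi>0 z)) p"
          unfolding \<phi>0_eq[OF \<open>z \<in> ?Q\<close>] using p by (simp add: ennpowr_ennpowr)
        also have "\<dots> = ennreal (\<phi>0 z powr p)" by (simp add: \<phi>0_def)
        finally show "av {z} (\<lambda>y. ennpowr (\<phi> y) p) * ennreal \<nu> = ennreal (\<phi>0 z powr p * \<nu>)"
          using \<nu>_pos by (simp add: ennreal_mult)
      qed
      also have "\<dots> = ennreal ((\<Sum>z\<in>?Q. \<phi>0 z powr p) * \<nu>)"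
        unfolding sum_distrib_right using \<nu>_pos by (intro sum_ennreal) auto
      finally show ?thesis by simp
    qed
    define a where "a = (\<lambda>S z. \<phi>0 z * s S z powr (1 / p'))"
    have a0: "0 \<le> a S z" for S z by (simp add: a_def \<phi>0_def)
    define B where "B = (4 * H) powr p * exp p * (16 * D * (1 + p) / (p - 1)) * L"
    have "\<exists>\<S>. finite \<S> \<and> (\<forall>S\<in>\<S>. \<exists>i\<le>N. \<exists>y\<in>?Q. S = cell i y) \<and>
      (\<forall>y\<in>?Q. \<forall>i\<le>N. \<exists>S\<in>\<S>. cell i y \<subseteq> S \<and> mean (cell i y) (a S) \<le> 2 * mean S (a S)) \<and>
      (\<Sum>S\<in>\<S>. card S * mean S (a S) powr p) \<le> B * (\<Sum>y\<in>?Q. \<phi>0 y powr p)"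
      unfolding B_def a_def
      by (rule sparse_weighted_means[OF p L H _ s0 s_mean s_A]) (auto simp: \<phi>0_def)
    then obtain \<S> where \<S>: "finite \<S>" "\<forall>S\<in>\<S>. \<exists>i\<le>N. \<exists>y\<in>?Q. S = cell i y"
      "\<forall>y\<in>?Q. \<forall>i\<le>N. \<exists>S\<in>\<S>. cell i y \<subseteq> S \<and> mean (cell i y) (a S) \<le> 2 * mean S (a S)"
      "(\<Sum>S\<in>\<S>. card S * mean S (a S) powr p) \<le> B * (\<Sum>y\<in>?Q. \<phi>0 y powr p)"
      by (elim exE conjE) (rule that)
    have cube: "av {z} (\<lambda>y. \<phi> y * ennreal (\<sigma> S y powr (1 / p'))) \<le> ennreal (a S z)"
      if S: "S = cell i k" and z: "z \<in> ?Q" for S i k z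
    proof -
      have m [measurable]: "\<sigma> S \<in> borel_measurable lebesgue" and \<sigma>0: "\<And>y. 0 \<le> \<sigma> S y"
        using \<sigma>[of i k] by (auto simp: S adapted_def)
      have "av {z} (\<lambda>y. \<phi> y * ennreal (\<sigma> S y powr (1 / p'))) \<le>
          ennpowr (av {z} (\<lambda>y. ennpowr (\<phi> y) p)) (1 / p) *
          ennpowr (av {z} (\<lambda>y. ennpowr (ennreal (\<sigma> S y powr (1 / p'))) p')) (1 / p')"
        by (intro av_Holder p p') auto
      also have "(\<lambda>y. ennpowr (ennreal (\<sigma> S y powr (1 / p'))) p') = (\<lambda>y. ennreal (\<sigma> S y))"
        using p \<sigma>0 by (auto simp: powr_powr)
      also have "av {z} (\<lambda>y. ennreal (\<sigma> S y)) = ennreal (s S z)"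
        unfolding av_def s_int[OF S, of "{z}", OF finite.insertI[OF finite.emptyI], symmetric]
        using \<nu>_pos s0 by (simp add: divide_ennreal)
      also have "ennpowr (av {z} (\<lambda>y. ennpowr (\<phi> y) p)) (1 / p) * ennpowr (ennreal (s S z)) (1 / p') = ennreal (a S z)"
        unfolding \<phi>0_eq[OF z, symmetric] using s0 by (simp add: a_def \<phi>0_def ennreal_mult)
      finally show ?thesis .
    qed
    let ?R = "\<lambda>x. \<Sum>S\<in>\<S>. ennreal (4 powr p * mean S (a S) powr p) * (ennpowr (\<tau> S x) p * indicator (reg S) x)"
    have dom: "ennpowr (T N \<phi> x) p \<le> ?R x" if x: "x \<in> reg ?Q" for x
    proof -
      have "ennpowr (av (cell i (\<iota> x)) (\<lambda>y. \<phi> y * ennreal (t x y))) p \<le> ?R x" if i: "i \<le> N" for i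
      proof -
        let ?C = "cell i (\<iota> x)"
        obtain S where S: "S \<in> \<S>" "?C \<subseteq> S" "mean ?C (a S) \<le> 2 * mean S (a S)"
          using \<S>(3) x i by blast
        obtain j k where jk: "S = cell j k" using \<S>(2) S(1) by blast
        have m [measurable]: "\<sigma> S \<in> borel_measurable lebesgue"
          using \<sigma>[of j k] by (auto simp: jk adapted_def)
        have CQ: "?C \<subseteq> ?Q" using x i cell_subset by auto
        have "av ?C (\<lambda>y. \<phi> y * ennreal (t x y)) \<le>
            av ?C (\<lambda>y. (2 * \<tau> S x) * (\<phi> y * ennreal (\<sigma> S y powr (1 / p'))))"
        proof (rule av_mono)
          fix y
          have "ennreal (t x y) \<le> 2 * \<tau> S x * ennreal (\<sigma> S y powr (1 / p'))"
            using \<sigma>[of j k] unfolding jk adapted_def by blast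
          then have "\<phi> y * ennreal (t x y) \<le> \<phi> y * (2 * \<tau> S x * ennreal (\<sigma> S y powr (1 / p')))"
            by (rule mult_left_mono) simp
          then show "\<phi> y * ennreal (t x y) \<le> (2 * \<tau> S x) * (\<phi> y * ennreal (\<sigma> S y powr (1 / p')))"
            by (simp add: mult_ac)
        qed
        also have "\<dots> = (2 * \<tau> S x) * av ?C (\<lambda>y. \<phi> y * ennreal (\<sigma> S y powr (1 / p')))"
          by (rule av_cmult) measurable
        also have "\<dots> \<le> (2 * \<tau> S x) * ennreal (mean ?C (a S))"
          using CQ a0 by (intro mult_left_mono av_le_mean cube[OF jk]) auto
        also have "\<dots> \<le> (2 * \<tau> S x) * ennreal (2 * mean S (a S))"
          using S(3) by (intro mult_left_mono ennreal_leI) auto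
        also have "\<dots> = ennreal (4 * mean S (a S)) * \<tau> S x"
          using a0 by (simp add: ennreal_mult mean_nonneg mult_ac)
        finally have "ennpowr (av ?C (\<lambda>y. \<phi> y * ennreal (t x y))) p \<le> ennpowr (ennreal (4 * mean S (a S)) * \<tau> S x) p"
          using p by (intro ennpowr_mono) auto
        also have "\<dots> = ennreal (4 powr p * mean S (a S) powr p) * (ennpowr (\<tau> S x) p * indicator (reg S) x)"
          using S(2) a0 by (auto simp: ennpowr_mult powr_mult mean_nonneg indicator_def dest: subsetD[OF _ cell_self])
        also have "\<dots> \<le> ?R x"
          using S(1) \<S>(1) by (intro member_le_sum) auto
        finally show ?thesis .
      qed
      then show ?thesis
        unfolding T_def using p by (intro order_trans[OF ennpowr_SUP_le] SUP_least) auto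
    qed
    have "(\<integral>\<^sup>+x\<in>reg ?Q. ennpowr (T N \<phi> x) p \<partial>lebesgue) \<le> (\<integral>\<^sup>+x. ?R x \<partial>lebesgue)"
      using dom by (intro nn_integral_mono) (auto simp: indicator_def)
    also have "\<dots> = (\<Sum>S\<in>\<S>. ennreal (4 powr p * mean S (a S) powr p) *
        (\<integral>\<^sup>+x\<in>reg S. ennpowr (\<tau> S x) p \<partial>lebesgue))"
      by (subst nn_integral_sum) (auto intro!: sum.cong nn_integral_cmult)
    also have "\<dots> \<le> (\<Sum>S\<in>\<S>. ennreal (4 powr p * A powr p * \<nu> * (card S * mean S (a S) powr p)))"
    proof (rule sum_mono)
      fix S assume "S \<in> \<S>"
      then obtain j k where jk: "S = cell j k" using \<S>(2) by blast
      have "ennreal (4 powr p * mean S (a S) powr p) * (\<integral>\<^sup>+x\<in>reg S. ennpowr (\<tau> S x) p \<partial>lebesgue) \<le>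
          ennreal (4 powr p * mean S (a S) powr p) * (ennreal (A powr p) * ennreal (card S * \<nu>))"
        unfolding jk by (intro mult_left_mono Ap) simp
      also have "\<dots> = ennreal (4 powr p * A powr p * \<nu> * (card S * mean S (a S) powr p))"
        using \<nu>_pos by (simp add: mult_ac flip: ennreal_mult)
      finally show "ennreal (4 powr p * mean S (a S) powr p) * (\<integral>\<^sup>+x\<in>reg S. ennpowr (\<tau> S x) p \<partial>lebesgue) \<le>
          ennreal (4 powr p * A powr p * \<nu> * (card S * mean S (a S) powr p))" .
    qed
    also have "\<dots> = ennreal (4 powr p * A powr p * \<nu> * (\<Sum>S\<in>\<S>. card S * mean S (a S) powr p))"
      unfolding sum_distrib_left using \<nu>_pos by (intro sum_ennreal) auto
    also have "\<dots> \<le> ennreal (4 powr p * A powr p * \<nu> * (B * (\<Sum>z\<in>?Q. \<phi>0 z powr p)))"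
      using \<S>(4) \<nu>_pos by (intro ennreal_leI mult_left_mono) auto
    also have "4 powr p * A powr p * \<nu> * (B * (\<Sum>z\<in>?Q. \<phi>0 z powr p)) =
        (bound_const p CARD('d) D * A powr (p + p')) * ((\<Sum>z\<in>?Q. \<phi>0 z powr p) * \<nu>)"
      by (simp add: B_def bound_const_def L_def H_def powr_add mult_ac)
    also have "ennreal \<dots> = ennreal (bound_const p CARD('d) D * A powr (p + p')) * ?I"
      using K \<nu>_pos by (subst ennreal_mult) (auto simp: \<phi>0_int intro!: mult_nonneg_nonneg sum_nonneg)
    finally show ?thesis .
  qed
qed

lemma T_bound:
  assumes [measurable]: "\<phi> \<in> borel_measurable lebesgue"
  shows "(\<integral>\<^sup>+x. ennpowr (T N \<phi> x) p \<partial>lebesgue) \<le>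
    ennreal (bound_const p CARD('d) D * A powr (p + p')) * (\<integral>\<^sup>+x. ennpowr (\<phi> x) p \<partial>lebesgue)"
proof -
  note [measurable] = measurable_T[OF assms]
  have "(\<integral>\<^sup>+x. ennpowr (T N \<phi> x) p \<partial>lebesgue) =
    (\<integral>\<^sup>+Q. (\<integral>\<^sup>+x\<in>reg Q. ennpowr (T N \<phi> x) p \<partial>lebesgue) \<partial>count_space (range (cell N)))"
    by (rule nn_integral_split_cells) measurable
  also have "\<dots> \<le> (\<integral>\<^sup>+Q. ennreal (bound_const p CARD('d) D * A powr (p + p')) * (\<integral>\<^sup>+x\<in>reg Q. ennpowr (\<phi> x) p \<partial>lebesgue)
      \<partial>count_space (range (cell N)))"
    by (intro nn_integral_mono) (auto intro!: T_bound_cell)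
  also have "\<dots> = ennreal (bound_const p CARD('d) D * A powr (p + p')) * (\<integral>\<^sup>+x. ennpowr (\<phi> x) p \<partial>lebesgue)"
    by (subst nn_integral_cmult) (auto simp flip: nn_integral_split_cells)
  finally show ?thesis .
qed

end

section \<open>Dyadic grids and iteration over the factors\<close>

definition grid_index :: "real ^ 'n \<Rightarrow> real \<Rightarrow> real ^ 'n \<Rightarrow> 'n \<Rightarrow> int" where
  "grid_index a \<delta> x = (\<lambda>c. \<lfloor>(x $ c - a $ c) / \<delta>\<rfloor>)"

text \<open>
  The indices of the finest cubes in the dyadic box around \<open>m\<close> whose side in direction \<open>c\<close> has level
  \<open>s c\<close>.
\<close>

definition rect :: "('n \<Rightarrow> nat) \<Rightarrow> ('n \<Rightarrow> int) \<Rightarrow> ('n \<Rightarrow> int) set" where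
  "rect s m = {m'. \<forall>c. m' c div 2 ^ s c = m c div 2 ^ s c}"

lemma rect_self [simp]: "m \<in> rect s m"
  by (simp add: rect_def)

lemma rect_eq: "m' \<in> rect s m \<Longrightarrow> rect s m' = rect s m"
  by (auto simp: rect_def)

lemma rect_mono: "(\<And>c. s c \<le> s' c) \<Longrightarrow> rect s m \<subseteq> rect s' m"
proof
  fix m' assume le: "\<And>c. s c \<le> s' c" and m': "m' \<in> rect s m"
  have "x div 2 ^ s' c = x div 2 ^ s c div 2 ^ (s' c - s c)" for x :: int and c
  proof -
    have "(2::int) ^ s' c = 2 ^ s c * 2 ^ (s' c - s c)" using le[of c] by (simp flip: power_add)
    then show ?thesis by (simp add: zdiv_zmult2_eq)
  qed
  with m' show "m' \<in> rect s' m" by (simp add: rect_def)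
qed

lemma div_eq_iff_bounds:
  fixes x k B :: int
  assumes "0 < B"
  shows "x div B = k \<longleftrightarrow> k * B \<le> x \<and> x < (k + 1) * B"
proof
  assume "x div B = k"
  then show "k * B \<le> x \<and> x < (k + 1) * B"
    using mult_div_mod_eq[of B x] pos_mod_bound[OF assms, of x] pos_mod_sign[OF assms, of x]
    unfolding distrib_right by (simp only: mult.commute[of _ B] mult_1) linarith
next
  assume "k * B \<le> x \<and> x < (k + 1) * B"
  then show "x div B = k" by (intro int_div_pos_eq[of x B k "x - B * k"]) (auto simp: algebra_simps)
qed

lemma rect_eq_PiE:
  "rect s m = (\<Pi>\<^sub>E c\<in>UNIV. {m c div 2 ^ s c * 2 ^ s c ..< (m c div 2 ^ s c + 1) * 2 ^ s c})"
  by (auto simp: rect_def PiE_def Pi_def div_eq_iff_bounds)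

lemma finite_rect [simp]: "finite (rect s (m :: 'n::finite \<Rightarrow> int))"
  unfolding rect_eq_PiE by (intro finite_PiE) auto

lemma card_rect: "card (rect s (m :: 'n::finite \<Rightarrow> int)) = (\<Prod>c\<in>UNIV. 2 ^ s c)"
  unfolding rect_eq_PiE by (subst card_PiE) (auto simp: distrib_right nat_power_eq)

lemma rect_ne [simp]: "rect s m \<noteq> {}"
  using rect_self by blast

definition corner :: "real ^ 'n \<Rightarrow> real \<Rightarrow> ('n \<Rightarrow> nat) \<Rightarrow> ('n \<Rightarrow> int) \<Rightarrow> real ^ 'n" where
  "corner a \<delta> s m = (\<chi> c. a $ c + \<delta> * 2 ^ s c * of_int (m c div 2 ^ s c))"

lemma grid_index_in_rect:
  assumes "0 < \<delta>"
  shows "grid_index a \<delta> x \<in> rect s m \<longleftrightarrow>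
    (\<forall>c. corner a \<delta> s m $ c \<le> x $ c \<and> x $ c < corner a \<delta> s m $ c + \<delta> * 2 ^ s c)"
proof -
  have "grid_index a \<delta> x c div 2 ^ s c = m c div 2 ^ s c \<longleftrightarrow>
    corner a \<delta> s m $ c \<le> x $ c \<and> x $ c < corner a \<delta> s m $ c + \<delta> * 2 ^ s c" for c
  proof -
    define h where "h = \<delta> * 2 ^ s c"
    have h: "0 < h" using assms by (simp add: h_def)
    have "grid_index a \<delta> x c div 2 ^ s c = \<lfloor>(x $ c - a $ c) / \<delta> / real_of_int (2 ^ s c)\<rfloor>"
      unfolding grid_index_def by (rule floor_divide_real_eq_div[symmetric]) simp
    also have "\<dots> = \<lfloor>(x $ c - a $ c) / h\<rfloor>" by (simp add: h_def)
    finally have "grid_index a \<delta> x c div 2 ^ s c = m c div 2 ^ s c \<longleftrightarrow>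
        of_int (m c div 2 ^ s c) \<le> (x $ c - a $ c) / h \<and> (x $ c - a $ c) / h < of_int (m c div 2 ^ s c) + 1"
      by (simp only: floor_eq_iff)
    also have "\<dots> \<longleftrightarrow> corner a \<delta> s m $ c \<le> x $ c \<and> x $ c < corner a \<delta> s m $ c + h"
    proof -
      have "corner a \<delta> s m $ c = a $ c + h * of_int (m c div 2 ^ s c)" by (simp add: corner_def h_def)
      then show ?thesis using h by (simp add: field_simps)
    qed
    finally show ?thesis by (simp add: h_def)
  qed
  then show ?thesis by (simp add: rect_def)
qed

text \<open>
  The dyadic boxes are half-open and the boxes of the basis are open; they differ by a null set.
\<close>

lemma grid_box_AE:
  fixes a :: "real ^ 'n::finite"
  assumes "0 < \<delta>"
  shows "AE x in lebesgue. grid_index a \<delta> x \<in> rect s m \<longleftrightarrow>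
    x \<in> box (corner a \<delta> s m) (corner a \<delta> s m + (\<chi> c. \<delta> * 2 ^ s c))"
proof -
  let ?l = "corner a \<delta> s m" and ?u = "corner a \<delta> s m + (\<chi> c. \<delta> * 2 ^ s c)"
  have "cbox ?l ?u - box ?l ?u \<in> null_sets lebesgue"
    using negligible_frontier_interval negligible_iff_null_sets by blast
  then have "AE x in lebesgue. x \<notin> cbox ?l ?u - box ?l ?u" by (rule AE_not_in)
  then show ?thesis
  proof eventually_elim
    case (elim x)
    have "x \<in> box ?l ?u \<Longrightarrow> grid_index a \<delta> x \<in> rect s m"
      by (auto simp: grid_index_in_rect[OF assms] mem_box_cart less_imp_le)
    moreover have "grid_index a \<delta> x \<in> rect s m \<Longrightarrow> x \<in> cbox ?l ?u"
      by (auto simp: grid_index_in_rect[OF assms] mem_box_cart less_imp_le)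
    ultimately show ?case using elim by blast
  qed
qed

lemma emeasure_box_cart:
  fixes l :: "real ^ 'n::finite"
  assumes "\<And>c. 0 \<le> h c"
  shows "emeasure lebesgue (box l (l + (\<chi> c. h c))) = ennreal (\<Prod>c\<in>UNIV. h c)"
proof -
  have "emeasure lborel (box l (l + (\<chi> c. h c))) = ennreal (\<Prod>b\<in>Basis. (l + (\<chi> c. h c) - l) \<bullet> b)"
    by (rule emeasure_lborel_box) (auto simp: Basis_vec_def inner_axis assms)
  also have "(\<Prod>b\<in>Basis. (l + (\<chi> c. h c) - l) \<bullet> b) = (\<Prod>c\<in>UNIV. h c)"
    unfolding Basis_vec_def
    by (subst prod.reindex_cong[of "\<lambda>c. axis c (1::real)" UNIV]) (auto simp: inj_on_def axis_eq_axis inner_axis)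
  finally show ?thesis by simp
qed

lemma sets_grid_rect:
  fixes a :: "real ^ 'n::finite"
  assumes "0 < \<delta>"
  shows "grid_index a \<delta> -` rect s m \<in> sets lebesgue"
proof -
  have "grid_index a \<delta> -` rect s m = (\<Inter>c. {x. corner a \<delta> s m $ c \<le> x $ c} \<inter> {x. x $ c < corner a \<delta> s m $ c + \<delta> * 2 ^ s c})"
    by (auto simp: grid_index_in_rect[OF assms])
  also have "\<dots> \<in> sets borel"
    by (intro sets.finite_INT sets.Int borel_closed borel_open
        closed_halfspace_component_ge_cart open_halfspace_component_lt_cart) auto
  finally show ?thesis by simp
qed

lemma emeasure_grid_rect:
  fixes a :: "real ^ 'n::finite"
  assumes "0 < \<delta>"
  shows "emeasure lebesgue (grid_index a \<delta> -` rect s m) = ennreal (\<Prod>c\<in>UNIV. \<delta> * 2 ^ s c)"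
proof -
  have "emeasure lebesgue (grid_index a \<delta> -` rect s m) =
      emeasure lebesgue (box (corner a \<delta> s m) (corner a \<delta> s m + (\<chi> c. \<delta> * 2 ^ s c)))"
    using grid_box_AE[OF assms, of a s m] sets_grid_rect[OF assms]
    by (intro emeasure_eq_AE) auto
  also have "\<dots> = ennreal (\<Prod>c\<in>UNIV. \<delta> * 2 ^ s c)" using assms by (intro emeasure_box_cart) auto
  finally show ?thesis .
qed

lemma rect_zero: "rect (\<lambda>_. 0) m = {m}"
  by (auto simp: rect_def)

lemma measurable_grid_index:
  fixes a :: "real ^ 'n::finite"
  assumes "0 < \<delta>"
  shows "grid_index a \<delta> \<in> lebesgue \<rightarrow>\<^sub>M count_space UNIV"
  unfolding measurable_count_space_eq_countable[OF countableI_type]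
  using sets_grid_rect[OF assms, of a "\<lambda>_. 0"] by (simp add: rect_zero)

text \<open>
  Arbitrary scale in the coordinates of factor \<open>i\<close>, finest scale in the others. These boxes belong
  to the multiparameter basis.
\<close>

definition block_cell :: "('n \<Rightarrow> nat) \<Rightarrow> nat \<Rightarrow> nat \<Rightarrow> ('n \<Rightarrow> int) \<Rightarrow> ('n \<Rightarrow> int) set" where
  "block_cell blk i k = rect (\<lambda>c. if blk c = i then k else 0)"

lemma nested_cells_block:
  "nested_cells (block_cell (blk :: 'n::finite \<Rightarrow> nat) i) (2 ^ CARD('n))"
proof
  fix k x
  let ?s = "\<lambda>k c. if blk c = i then k else 0 :: nat"
  show "block_cell blk i 0 x = {x}" using rect_zero[of x] by (simp add: block_cell_def)
  show "block_cell blk i k x \<subseteq> block_cell blk i (Suc k) x"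
    unfolding block_cell_def by (rule rect_mono) auto
  have "real (card (block_cell blk i (Suc k) x)) = (\<Prod>c\<in>UNIV. 2 ^ ?s (Suc k) c)"
    by (simp add: block_cell_def card_rect)
  also have "\<dots> \<le> (\<Prod>c\<in>UNIV. 2 * 2 ^ ?s k c)" by (intro prod_mono) auto
  also have "\<dots> = 2 ^ CARD('n) * real (card (block_cell blk i k x))"
    by (simp add: block_cell_def card_rect prod.distrib)
  finally show "real (card (block_cell blk i (Suc k) x)) \<le> 2 ^ CARD('n) * real (card (block_cell blk i k x))" .
qed (auto simp: block_cell_def rect_eq)

locale grid_weight = invertible_weight W
  for W :: "real ^ 'n::finite \<Rightarrow> real ^ 'd::finite ^ 'd" +
  fixes blk :: "'n \<Rightarrow> nat" and a :: "real ^ 'n" and \<delta> p A :: real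
  assumes \<delta>: "0 < \<delta>" and p_gt: "1 < p" and A0: "0 \<le> A"
    and Ap_box: "R \<in> multi_basis blk \<Longrightarrow>
      average R (\<lambda>x. ennpowr (average R (\<lambda>y. ennpowr (ennreal (t x y)) (p / (p - 1)))) (p - 1)) \<le> ennreal (A powr p)"
begin

abbreviation \<iota> where "\<iota> \<equiv> grid_index a \<delta>"

sublocale block: weighted_cells W "block_cell blk i" "2 ^ CARD('n)" \<iota> "\<delta> ^ CARD('n)" p for i
proof -
  interpret nested_cells "block_cell blk i" "2 ^ CARD('n)" by (rule nested_cells_block)
  show "weighted_cells W (block_cell blk i) (2 ^ CARD('n)) \<iota> (\<delta> ^ CARD('n)) p"
  proof
    show "\<iota> \<in> lebesgue \<rightarrow>\<^sub>M count_space UNIV" using \<delta> by (rule measurable_grid_index)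
    show "emeasure lebesgue (\<iota> -` {m}) = ennreal (\<delta> ^ CARD('n))" for m
      using emeasure_grid_rect[OF \<delta>, of a "\<lambda>_. 0" m] by (simp add: rect_zero)
  qed (use \<delta> p_gt in auto)
qed

lemma box_rect_basis:
  "box (corner a \<delta> (\<lambda>c. sc (blk c)) m) (corner a \<delta> (\<lambda>c. sc (blk c)) m + (\<chi> c. \<delta> * 2 ^ sc (blk c))) \<in> multi_basis blk"
  unfolding multi_basis_def using \<delta>
  by (intro CollectI exI[of _ "corner a \<delta> (\<lambda>c. sc (blk c)) m"] exI[of _ "\<lambda>i. \<delta> * 2 ^ sc i"]) auto

lemma card_rect_nu:
  fixes m :: "'n \<Rightarrow> int"
  shows "real (card (rect s m)) * (\<delta> ^ CARD('n)) = (\<Prod>c\<in>UNIV. \<delta> * 2 ^ s c)"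
  by (simp add: card_rect prod.distrib)

lemma average_box_eq_av:
  "average (box (corner a \<delta> s m) (corner a \<delta> s m + (\<chi> c. \<delta> * 2 ^ s c))) g = block.av (rect s m) g"
proof -
  let ?R = "box (corner a \<delta> s m) (corner a \<delta> s m + (\<chi> c. \<delta> * 2 ^ s c))"
  have "emeasure lebesgue ?R = ennreal (card (rect s m) * (\<delta> ^ CARD('n)))"
    unfolding card_rect_nu using \<delta> by (intro emeasure_box_cart) auto
  moreover have "(\<integral>\<^sup>+y\<in>?R. g y \<partial>lebesgue) = (\<integral>\<^sup>+y\<in>\<iota> -` rect s m. g y \<partial>lebesgue)"
    using grid_box_AE[OF \<delta>, of a s m] by (intro nn_integral_cong_AE) (auto simp: indicator_def)
  ultimately show ?thesis by (simp only: average_def block.av_def)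
qed

sublocale block: Ap_cells W "block_cell blk i" "2 ^ CARD('n)" \<iota> "\<delta> ^ CARD('n)" p A for i
proof
  show "0 \<le> A" by (rule A0)
  fix k m
  let ?Q = "block_cell blk i k m"
  define sc where "sc l = (if l = i then k else 0)" for l
  have Q: "?Q = rect (\<lambda>c. sc (blk c)) m" by (simp add: block_cell_def sc_def)
  have pp: "1 / (p / (p - 1)) * p = p - 1" using p_gt by (simp add: field_simps)
  have "block.av ?Q (\<lambda>x. ennpowr (block.\<tau> ?Q x) p) \<le> ennreal (A powr p)"
    using Ap_box[OF box_rect_basis[of sc m]]
    unfolding average_box_eq_av Q block.\<tau>_def ennpowr_ennpowr pp .
  then show "(\<integral>\<^sup>+x\<in>\<iota> -` ?Q. ennpowr (block.\<tau> ?Q x) p \<partial>lebesgue) \<le> ennreal (A powr p) * ennreal (card ?Q * (\<delta> ^ CARD('n)))"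
    by (subst (asm) block.av_le_iff) (auto simp: Q)
qed

definition iterated :: "nat \<Rightarrow> nat list \<Rightarrow> (real ^ 'n \<Rightarrow> ennreal) \<Rightarrow> real ^ 'n \<Rightarrow> ennreal" where
  "iterated N is \<phi> = foldr (\<lambda>i. block.T i N) is \<phi>"

lemma measurable_iterated:
  "\<phi> \<in> borel_measurable lebesgue \<Longrightarrow> iterated N is \<phi> \<in> borel_measurable lebesgue"
  unfolding iterated_def by (induction "is") (auto intro: block.measurable_T)

lemma iterated_bound:
  assumes \<phi>: "\<phi> \<in> borel_measurable lebesgue"
  defines "K \<equiv> bound_const p CARD('d) (2 ^ CARD('n)) * A powr (p + p / (p - 1))"
  shows "(\<integral>\<^sup>+x. ennpowr (iterated N is \<phi> x) p \<partial>lebesgue) \<le>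
    ennreal (K ^ length is) * (\<integral>\<^sup>+x. ennpowr (\<phi> x) p \<partial>lebesgue)"
proof (induction "is")
  case (Cons i "is")
  let ?I = "\<integral>\<^sup>+x. ennpowr (\<phi> x) p \<partial>lebesgue"
  have K: "0 \<le> K" using p_gt unfolding K_def bound_const_def by auto
  have "(\<integral>\<^sup>+x. ennpowr (iterated N (i # is) \<phi> x) p \<partial>lebesgue) \<le>
      ennreal K * (\<integral>\<^sup>+x. ennpowr (iterated N is \<phi> x) p \<partial>lebesgue)"
    using block.T_bound[OF measurable_iterated[OF \<phi>], of i N N "is"] by (simp add: iterated_def K_def)
  also have "\<dots> \<le> ennreal K * (ennreal (K ^ length is) * ?I)"
    by (intro mult_left_mono Cons.IH) simp
  also have "\<dots> = ennreal (K ^ length (i # is)) * ?I"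
    using ennreal_mult[OF K zero_le_power[OF K]] by (simp add: mult.assoc)
  finally show ?case .
qed (simp add: iterated_def)

text \<open>
  If the scales \<open>s1\<close> and \<open>s2\<close> concern different coordinates, the boxes \<open>rect s2 m\<close> with \<open>m\<close> in
  \<open>rect s1 m0\<close> tile the box in which both scales are large.
\<close>

lemma av_av_rect:
  assumes disj: "\<And>c. s1 c = 0 \<or> s2 c = 0" and h [measurable]: "h \<in> borel_measurable lebesgue"
  shows "block.av (rect s1 m0) (\<lambda>y. block.av (rect s2 (\<iota> y)) h) = block.av (rect (\<lambda>c. s1 c + s2 c) m0) h"
proof -
  define I where "I z = (\<integral>\<^sup>+y\<in>\<iota> -` {z}. h y \<partial>lebesgue)" for z
  define G where "G m = block.av (rect s2 m) h" for m
  let ?\<nu> = "\<delta> ^ CARD('n)"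
  define n1 n2 :: real where "n1 = (\<Prod>c\<in>UNIV. 2 ^ s1 c)" and "n2 = (\<Prod>c\<in>UNIV. 2 ^ s2 c)"
  have \<nu>: "0 < ?\<nu>" "0 < n1" "0 < n2" using \<delta> by (auto simp: n1_def n2_def intro: prod_pos)
  have av: "block.av Q g = (\<integral>\<^sup>+x\<in>\<iota> -` Q. g x \<partial>lebesgue) * ennreal (1 / (card Q * ?\<nu>))"
    if "finite Q" "Q \<noteq> {}" for Q g using that by (rule block.av_eq_mult)
  have G: "G m = (\<Sum>z\<in>rect s2 m. I z) * ennreal (1 / (n2 * ?\<nu>))" for m
    unfolding G_def I_def av[OF finite_rect rect_ne] block.integral_reg[OF finite_rect h]
    by (simp only: card_rect n2_def of_nat_prod of_nat_power of_nat_numeral)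
  have [measurable]: "(\<lambda>y. G (\<iota> y)) \<in> borel_measurable lebesgue"
    by (rule measurable_compose[OF measurable_grid_index[OF \<delta>]]) simp
  have "(\<integral>\<^sup>+y\<in>\<iota> -` rect s1 m0. G (\<iota> y) \<partial>lebesgue) = (\<Sum>m\<in>rect s1 m0. \<integral>\<^sup>+y\<in>\<iota> -` {m}. G (\<iota> y) \<partial>lebesgue)"
    by (rule block.integral_reg) auto
  also have "\<dots> = (\<Sum>m\<in>rect s1 m0. G m * ennreal (\<delta> ^ CARD('n)))"
  proof (rule sum.cong[OF refl])
    fix m
    have "(\<integral>\<^sup>+y\<in>\<iota> -` {m}. G (\<iota> y) \<partial>lebesgue) = (\<integral>\<^sup>+y\<in>\<iota> -` {m}. G m \<partial>lebesgue)"
      by (intro nn_integral_cong) (auto simp: indicator_def)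
    also have "\<dots> = G m * emeasure lebesgue (\<iota> -` {m})"
      by (rule nn_integral_cmult_indicator) (rule block.sets_reg)
    finally show "(\<integral>\<^sup>+y\<in>\<iota> -` {m}. G (\<iota> y) \<partial>lebesgue) = G m * ennreal (\<delta> ^ CARD('n))"
      by (simp only: block.emeasure_fibre)
  qed
  also have "\<dots> = (\<Sum>m\<in>rect s1 m0. \<Sum>z\<in>rect s2 m. I z) * (ennreal (1 / (n2 * ?\<nu>)) * ennreal ?\<nu>)"
    unfolding G by (simp only: sum_distrib_right mult.assoc)
  also have "ennreal (1 / (n2 * ?\<nu>)) * ennreal ?\<nu> = ennreal (1 / n2)"
    using \<nu> \<delta> by (simp flip: ennreal_mult)
  also have "(\<Sum>m\<in>rect s1 m0. \<Sum>z\<in>rect s2 m. I z) = (\<Sum>z\<in>(\<Union>m\<in>rect s1 m0. rect s2 m). I z)"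
  proof (rule sum.UNION_disjoint[symmetric])
    show "\<forall>m\<in>rect s1 m0. \<forall>m'\<in>rect s1 m0. m \<noteq> m' \<longrightarrow> rect s2 m \<inter> rect s2 m' = {}"
    proof (intro ballI impI, rule ccontr)
      fix m m' assume m: "m \<in> rect s1 m0" "m' \<in> rect s1 m0" "m \<noteq> m'" "rect s2 m \<inter> rect s2 m' \<noteq> {}"
      then obtain z where z: "z \<in> rect s2 m" "z \<in> rect s2 m'" by auto
      have "m c = m' c" for c
        using disj[of c]
      proof
        assume "s1 c = 0"
        then show ?thesis using m by (auto simp: rect_def dest!: spec[of _ c])
      next
        assume "s2 c = 0"
        then show ?thesis using z by (auto simp: rect_def dest!: spec[of _ c])
      qed
      then show False using m(3) by auto
    qed
  qed auto
  also have "(\<Union>m\<in>rect s1 m0. rect s2 m) = rect (\<lambda>c. s1 c + s2 c) m0"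
  proof (intro equalityI subsetI)
    fix z assume "z \<in> (\<Union>m\<in>rect s1 m0. rect s2 m)"
    then obtain m where m: "m \<in> rect s1 m0" "z \<in> rect s2 m" by auto
    have "z c div 2 ^ (s1 c + s2 c) = m0 c div 2 ^ (s1 c + s2 c)" for c
      using disj[of c] m by (auto simp: rect_def dest!: spec[of _ c])
    then show "z \<in> rect (\<lambda>c. s1 c + s2 c) m0" by (simp add: rect_def)
  next
    fix z assume z: "z \<in> rect (\<lambda>c. s1 c + s2 c) m0"
    \<comment> \<open>The index that has the coordinates of \<open>z\<close> exactly where \<open>s1\<close> allows it to move.\<close>
    define m where "m c = (if s1 c = 0 then m0 c else z c)" for c
    have "m \<in> rect s1 m0"
      unfolding rect_def
    proof (intro CollectI allI)
      fix c
      show "m c div 2 ^ s1 c = m0 c div 2 ^ s1 c"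
        using z disj[of c] by (auto simp: rect_def m_def dest!: spec[of _ c])
    qed
    moreover have "z \<in> rect s2 m"
      unfolding rect_def
    proof (intro CollectI allI)
      fix c
      show "z c div 2 ^ s2 c = m c div 2 ^ s2 c"
        using z disj[of c] by (auto simp: rect_def m_def dest!: spec[of _ c])
    qed
    ultimately show "z \<in> (\<Union>m\<in>rect s1 m0. rect s2 m)" by auto
  qed
  finally have eq: "(\<integral>\<^sup>+y\<in>\<iota> -` rect s1 m0. G (\<iota> y) \<partial>lebesgue) =
      (\<integral>\<^sup>+y\<in>\<iota> -` rect (\<lambda>c. s1 c + s2 c) m0. h y \<partial>lebesgue) * ennreal (1 / n2)"
    unfolding I_def block.integral_reg[OF finite_rect h] .
  have "block.av (rect s1 m0) (\<lambda>y. G (\<iota> y)) =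
      (\<integral>\<^sup>+y\<in>\<iota> -` rect (\<lambda>c. s1 c + s2 c) m0. h y \<partial>lebesgue) * (ennreal (1 / n2) * ennreal (1 / (n1 * ?\<nu>)))"
    unfolding av[OF finite_rect rect_ne] eq
    by (simp only: card_rect n1_def mult.assoc of_nat_prod of_nat_power of_nat_numeral)
  also have "ennreal (1 / n2) * ennreal (1 / (n1 * ?\<nu>)) = ennreal (1 / (card (rect (\<lambda>c. s1 c + s2 c) m0) * ?\<nu>))"
    using \<nu> by (simp add: card_rect power_add prod.distrib n1_def n2_def mult_ac flip: ennreal_mult)
  finally show ?thesis
    unfolding G_def av[OF finite_rect rect_ne, of "\<lambda>c. s1 c + s2 c"] .
qed

text \<open>
  Average first over the scales of factor \<open>l\<close> and then over those of the later factors, and insert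
  the intermediate point \<open>y\<close> by \<open>t x z \<le> t x y * t y z\<close>. The inner average is then one for the
  kernel at \<open>y\<close>, to which the induction hypothesis applies, and the outer one is an average that
  defines \<open>T\<close> for factor \<open>l\<close>.
\<close>

lemma iterated_dominates:
  assumes \<phi> [measurable]: "\<phi> \<in> borel_measurable lebesgue" and sc: "\<And>i. sc i \<le> N" and blk: "\<And>c. blk c < j"
    and l: "l < j"
  shows "block.av (rect (\<lambda>c. if l \<le> blk c then sc (blk c) else 0) (\<iota> x)) (\<lambda>y. \<phi> y * ennreal (t x y))
    \<le> iterated N [l..<j] \<phi> x"
  using l
proof (induction l arbitrary: x rule: measure_induct_rule[of "\<lambda>l. j - l"])
  case (less l)
  let ?s = "\<lambda>l c. if l \<le> blk c then sc (blk c) else 0"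
  let ?cell = "block_cell blk l (sc l)"
  have T_ge: "block.av (?cell (\<iota> x)) (\<lambda>y. \<psi> y * ennreal (t x y)) \<le> block.T l N \<psi> x" for \<psi>
    unfolding block.T_def using sc by (intro SUP_upper) auto
  show ?case
  proof (cases "Suc l = j")
    case True
    have "?s l c = (if blk c = l then sc l else 0)" for c
      using blk[of c] True by (cases "blk c = l") auto
    then have "?s l = (\<lambda>c. if blk c = l then sc l else 0)" by (rule ext)
    then have "rect (?s l) = ?cell" by (simp add: block_cell_def)
    moreover have "[l..<j] = [l]" using True by auto
    ultimately show ?thesis using T_ge[of \<phi>] by (simp add: iterated_def)
  next
    case False
    then have lj: "Suc l < j" using less.prems by simp
    let ?\<psi> = "iterated N [Suc l..<j] \<phi>"
    let ?s1 = "\<lambda>c. if blk c = l then sc l else 0"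
    have m [measurable]: "(\<lambda>y. ennreal (t x y)) \<in> borel_measurable lebesgue" by measurable
    have "?s1 c + ?s (Suc l) c = ?s l c" for c by (cases "blk c = l") auto
    then have "(\<lambda>c. ?s1 c + ?s (Suc l) c) = ?s l" by (rule ext)
    then have "block.av (rect (?s l) (\<iota> x)) (\<lambda>y. \<phi> y * ennreal (t x y)) =
        block.av (?cell (\<iota> x)) (\<lambda>y. block.av (rect (?s (Suc l)) (\<iota> y)) (\<lambda>z. \<phi> z * ennreal (t x z)))"
      unfolding block_cell_def by (subst av_av_rect) auto
    also have "\<dots> \<le> block.av (?cell (\<iota> x)) (\<lambda>y. ?\<psi> y * ennreal (t x y))"
    proof (rule block.av_mono)
      fix y
      have [measurable]: "(\<lambda>z. ennreal (t y z)) \<in> borel_measurable lebesgue" by measurable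
      have "block.av (rect (?s (Suc l)) (\<iota> y)) (\<lambda>z. \<phi> z * ennreal (t x z)) \<le>
          block.av (rect (?s (Suc l)) (\<iota> y)) (\<lambda>z. ennreal (t x y) * (\<phi> z * ennreal (t y z)))"
      proof (rule block.av_mono)
        fix z
        have "ennreal (t x z) \<le> ennreal (t x y) * ennreal (t y z)"
          using t_submultiplicative[of x z y] by (simp flip: ennreal_mult)
        then have "\<phi> z * ennreal (t x z) \<le> \<phi> z * (ennreal (t x y) * ennreal (t y z))"
          by (rule mult_left_mono) simp
        then show "\<phi> z * ennreal (t x z) \<le> ennreal (t x y) * (\<phi> z * ennreal (t y z))"
          by (simp add: mult_ac)
      qed
      also have "\<dots> = ennreal (t x y) * block.av (rect (?s (Suc l)) (\<iota> y)) (\<lambda>z. \<phi> z * ennreal (t y z))"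
        by (rule block.av_cmult) measurable
      also have "\<dots> \<le> ennreal (t x y) * ?\<psi> y"
        using less.IH[of "Suc l" y] lj by (intro mult_left_mono) auto
      finally show "block.av (rect (?s (Suc l)) (\<iota> y)) (\<lambda>z. \<phi> z * ennreal (t x z)) \<le> ?\<psi> y * ennreal (t x y)"
        by (simp add: mult.commute)
    qed
    also have "\<dots> \<le> block.T l N ?\<psi> x" by (rule T_ge)
    also have "\<dots> = iterated N [l..<j] \<phi> x"
      using less.prems by (simp add: iterated_def upt_conv_Cons)
    finally show ?thesis .
  qed
qed

end

section \<open>Arbitrary boxes\<close>

lemma average_le_iff:
  assumes "emeasure lebesgue R \<noteq> 0" "emeasure lebesgue R < top"
  shows "average R g \<le> c \<longleftrightarrow> (\<integral>\<^sup>+y\<in>R. g y \<partial>lebesgue) \<le> c * emeasure lebesgue R"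
  unfolding average_def using assms by (rule ennreal_divide_le_iff)

lemma emeasure_basis:
  assumes "\<And>i. 0 < s i"
  shows "emeasure lebesgue (box u (u + (\<chi> k. s (blk k))) :: (real ^ 'n::finite) set) = ennreal (\<Prod>k\<in>UNIV. s (blk k))"
    "0 < (\<Prod>k\<in>(UNIV :: 'n set). s (blk k))"
  using emeasure_box_cart[of "\<lambda>k. s (blk k)" u] assms by (auto simp: less_imp_le intro!: prod_pos simp del: emeasure_completion)

lemma floor_eq_of_no_grid_point:
  fixes a h u w x y :: real
  assumes h: "0 < h" and no: "\<And>m::int. \<not> (u < a + of_int m * h \<and> a + of_int m * h < w)"
    and xy: "u < x" "x < w" "u < y" "y < w"
  shows "\<lfloor>(x - a) / h\<rfloor> = \<lfloor>(y - a) / h\<rfloor>"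
proof -
  have False if lt: "\<lfloor>(x - a) / h\<rfloor> < \<lfloor>(y - a) / h\<rfloor>" and "u < x" "y < w" for x y
  proof -
    let ?m = "\<lfloor>(y - a) / h\<rfloor>"
    have "(x - a) / h < of_int ?m" using lt by (simp only: floor_less_iff)
    then have "x < a + of_int ?m * h" using h by (simp add: field_simps)
    moreover have "of_int ?m \<le> (y - a) / h" by simp
    then have "of_int ?m * h \<le> y - a" using h by (simp only: pos_le_divide_eq)
    ultimately show False using no[of ?m] that by linarith
  qed
  then show ?thesis using xy by (meson linorder_neqE)
qed

text \<open>
  Grid points of the two grids differ by at least \<open>h / 3\<close> because 3 does not divide a power of 2. An
  open interval of length at most \<open>h / 3\<close> therefore contains points of at most one of them.
\<close>

lemma two_grids:
  fixes h u w :: real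
  assumes h: "0 < h" "3 * (w - u) \<le> h"
  shows "(\<forall>m::int. \<not> (u < of_int m * h \<and> of_int m * h < w)) \<or>
    (\<forall>m::int. \<not> (u < 2 ^ i * h / 3 + of_int m * h \<and> 2 ^ i * h / 3 + of_int m * h < w))"
proof (rule ccontr)
  assume "\<not> ?thesis"
  then obtain m m' :: int where m: "u < of_int m * h" "of_int m * h < w"
    "u < 2 ^ i * h / 3 + of_int m' * h" "2 ^ i * h / 3 + of_int m' * h < w" by blast
  \<comment> \<open>The difference of two grid points, in units of \<open>h / 3\<close>.\<close>
  define k :: int where "k = 2 ^ i + 3 * (m' - m)"
  have k: "of_int k * h = 3 * ((2 ^ i * h / 3 + of_int m' * h) - of_int m * h)"
    by (simp add: k_def algebra_simps)
  have "of_int k * h < 1 * h" "(-1) * h < of_int k * h"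
    unfolding k using m h by auto
  then have "of_int k < (1 :: real)" "(-1 :: real) < of_int k" using h by (simp_all only: mult_less_cancel_right_pos)
  then have "k = 0" by linarith
  then have "(3 :: int) dvd 2 ^ i" unfolding k_def by (metis add.commute add_eq_0_iff dvd_minus_iff dvd_triv_left)
  moreover have "\<not> (3 :: int) dvd 2 ^ i"
  proof (induction i)
    case (Suc i)
    then show ?case unfolding power_Suc by presburger
  qed simp
  ultimately show False by simp
qed

text \<open>
  The least level with a side of at least \<open>3 s\<close>, where level 0 has side \<open>2\<^sup>-\<^sup>K\<close>. The default 0 keeps
  it at most \<open>2 K\<close> for every \<open>s\<close>, as \<open>iterated_dominates\<close> requires at all indices.
\<close>

definition dyadic_level :: "nat \<Rightarrow> real \<Rightarrow> nat" where
  "dyadic_level K s = (if 3 * s \<le> 2 ^ K then LEAST k. 3 * s \<le> 2 ^ k / 2 ^ K else 0)"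

lemma dyadic_level:
  assumes "0 < s"
  shows "dyadic_level K s \<le> 2 * K"
    and "3 * s \<le> 2 ^ K \<Longrightarrow> 1 / 2 ^ K \<le> 6 * s \<Longrightarrow>
      3 * s \<le> 2 ^ dyadic_level K s / 2 ^ K \<and> 2 ^ dyadic_level K s / 2 ^ K \<le> 6 * s"
proof -
  let ?P = "\<lambda>k. 3 * s \<le> 2 ^ k / 2 ^ K"
  have P: "?P (2 * K)" if "3 * s \<le> 2 ^ K"
    using that by (simp add: power_mult power2_eq_square mult_2 power_add)
  show "dyadic_level K s \<le> 2 * K"
    using Least_le[of ?P, OF P] by (simp add: dyadic_level_def)
  assume *: "3 * s \<le> 2 ^ K" "1 / 2 ^ K \<le> 6 * s"
  then have eq: "dyadic_level K s = (LEAST k. ?P k)" by (simp add: dyadic_level_def)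
  have "?P (dyadic_level K s)" unfolding eq by (rule LeastI[of ?P, OF P[OF *(1)]])
  moreover have "2 ^ dyadic_level K s / 2 ^ K \<le> 6 * s"
  proof (cases "dyadic_level K s")
    case 0
    then show ?thesis using *(2) by simp
  next
    case (Suc k)
    then have "\<not> ?P k" using not_less_Least[of k ?P] eq by simp
    then show ?thesis using Suc by simp
  qed
  ultimately show "3 * s \<le> 2 ^ dyadic_level K s / 2 ^ K \<and> 2 ^ dyadic_level K s / 2 ^ K \<le> 6 * s" by blast
qed

text \<open>
  At level \<open>k \<le> 2 K\<close> the side is \<open>h = 2\<^bsup>k - K\<^esup>\<close> and \<open>2\<^sup>K / 3 = 2\<^bsup>2 K - k\<^esup> h / 3\<close>. Hence the same
  shift works at all levels up to the coarsest one.
\<close>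

definition shift :: "'n set \<Rightarrow> nat \<Rightarrow> real ^ 'n" where
  "shift \<xi> K = (\<chi> c. if c \<in> \<xi> then 2 ^ K / 3 else 0)"

lemma box_in_rect:
  fixes u :: "real ^ 'n::finite" and s :: "'n \<Rightarrow> real"
  assumes s: "\<And>c. 0 < s c" "\<And>c. 3 * s c \<le> 2 ^ K" "\<And>c. 1 / 2 ^ K \<le> 6 * s c"
  obtains \<xi> where "\<And>x y. x \<in> box u (u + (\<chi> c. s c)) \<Longrightarrow> y \<in> box u (u + (\<chi> c. s c)) \<Longrightarrow>
     grid_index (shift \<xi> K) (1 / 2 ^ K) y \<in> rect (\<lambda>c. dyadic_level K (s c)) (grid_index (shift \<xi> K) (1 / 2 ^ K) x)"
proof -
  define h :: "'n \<Rightarrow> real" where "h c = 2 ^ dyadic_level K (s c) / 2 ^ K" for c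
  have h: "0 < h c" "3 * s c \<le> h c" for c using dyadic_level(2)[OF s(1,2,3), of c] by (auto simp: h_def)
  define ok where "ok c b \<longleftrightarrow> (\<forall>m::int. \<not> (u $ c < b + of_int m * h c \<and> b + of_int m * h c < u $ c + s c))" for c b
  have ok: "ok c 0 \<or> ok c (2 ^ K / 3)" for c
  proof -
    define i where "i = 2 * K - dyadic_level K (s c)"
    have "(2::real) ^ i * 2 ^ dyadic_level K (s c) = 2 ^ K * 2 ^ K"
      using dyadic_level(1)[OF s(1), of K c] by (simp add: i_def mult_2 flip: power_add)
    then have "2 ^ i * h c = 2 ^ K" by (simp add: h_def)
    then show ?thesis using two_grids[of "h c" "u $ c + s c" "u $ c" i] h[of c] by (simp add: ok_def)
  qed
  \<comment> \<open>Shift only the coordinates in which the standard grid cuts the box.\<close>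
  define \<xi> where "\<xi> = {c. \<not> ok c 0}"
  have ok_shift: "ok c (shift \<xi> K $ c)" for c using ok[of c] by (auto simp: shift_def \<xi>_def)
  show ?thesis
  proof (rule that[of \<xi>])
    fix x y assume x: "x \<in> box u (u + (\<chi> c. s c))" and y: "y \<in> box u (u + (\<chi> c. s c))"
    have idx: "grid_index (shift \<xi> K) (1 / 2 ^ K) z c div 2 ^ dyadic_level K (s c) =
        \<lfloor>(z $ c - shift \<xi> K $ c) / h c\<rfloor>" for z c
    proof -
      have "grid_index (shift \<xi> K) (1 / 2 ^ K) z c div 2 ^ dyadic_level K (s c) =
          \<lfloor>(z $ c - shift \<xi> K $ c) / (1 / 2 ^ K) / real_of_int (2 ^ dyadic_level K (s c))\<rfloor>"
        unfolding grid_index_def by (rule floor_divide_real_eq_div[symmetric]) simp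
      then show ?thesis by (simp add: h_def)
    qed
    have "\<lfloor>(y $ c - shift \<xi> K $ c) / h c\<rfloor> = \<lfloor>(x $ c - shift \<xi> K $ c) / h c\<rfloor>" for c
      using ok_shift[of c] h[of c] x y unfolding ok_def
      by (intro floor_eq_of_no_grid_point[of _ "u $ c" _ "u $ c + s c"]) (auto simp: mem_box_cart)
    then show "grid_index (shift \<xi> K) (1 / 2 ^ K) y \<in>
        rect (\<lambda>c. dyadic_level K (s c)) (grid_index (shift \<xi> K) (1 / 2 ^ K) x)"
      by (simp add: rect_def idx)
  qed
qed

locale strong_weight = invertible_weight W
  for W :: "real ^ 'n::finite \<Rightarrow> real ^ 'd::finite ^ 'd" +
  fixes blk :: "'n \<Rightarrow> nat" and p A :: real
  assumes p_gt: "1 < p" and A0: "0 \<le> A"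
    and Ap_box: "R \<in> multi_basis blk \<Longrightarrow>
      average R (\<lambda>x. ennpowr (average R (\<lambda>y. ennpowr (ennreal (t x y)) (p / (p - 1)))) (p - 1)) \<le> ennreal (A powr p)"
begin

sublocale grid: grid_weight W blk "shift \<xi> K" "1 / 2 ^ K" p A for \<xi> and K :: nat
  by unfold_locales (use p_gt A0 Ap_box in auto)

text \<open>
  In every direction the side of the dyadic box is at most 6 times that of \<open>R\<close>.
\<close>

lemma average_le_iterated:
  assumes [measurable]: "\<phi> \<in> borel_measurable lebesgue" and blk: "\<And>c. blk c < j"
    and s: "\<And>i. 0 < s i" "\<And>c. 3 * s (blk c) \<le> 2 ^ K" "\<And>c. 1 / 2 ^ K \<le> 6 * s (blk c)"
    and R: "R = box u (u + (\<chi> c. s (blk c)))" and x: "x \<in> R"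
  shows "average R (\<lambda>y. \<phi> y * ennreal (t x y)) \<le>
    ennreal (6 ^ CARD('n)) * (SUP \<xi>. grid.iterated \<xi> K (2 * K) [0..<j] \<phi> x)"
proof -
  obtain \<xi> where \<xi>: "\<And>x y. x \<in> R \<Longrightarrow> y \<in> R \<Longrightarrow>
     grid_index (shift \<xi> K) (1 / 2 ^ K) y \<in>
       rect (\<lambda>c. dyadic_level K (s (blk c))) (grid_index (shift \<xi> K) (1 / 2 ^ K) x)"
    using box_in_rect[of "\<lambda>c. s (blk c)" K u, OF s(1) s(2) s(3)] unfolding R by blast
  let ?g = "\<lambda>y. \<phi> y * ennreal (t x y)"
  let ?s = "\<lambda>c. dyadic_level K (s (blk c))"
  let ?Q = "rect ?s (grid_index (shift \<xi> K) (1 / 2 ^ K) x)"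
  define V where "V = (\<Prod>c\<in>(UNIV :: 'n set). s (blk c))"
  have V: "emeasure lebesgue R = ennreal V" "0 < V"
    unfolding R V_def by (intro emeasure_basis s(1))+
  let ?it = "grid.iterated \<xi> K (2 * K) [0..<j] \<phi> x"
  have j: "0 < j" using blk[of undefined] by simp
  have "grid.block.av \<xi> K ?Q ?g \<le> ?it"
    using grid.iterated_dominates[of \<phi> "\<lambda>i. dyadic_level K (s i)" "2 * K" j 0 \<xi> K x] s(1) blk j
    by (simp add: dyadic_level(1))
  moreover have "(\<integral>\<^sup>+y\<in>R. ?g y \<partial>lebesgue) \<le> (\<integral>\<^sup>+y\<in>grid_index (shift \<xi> K) (1 / 2 ^ K) -` ?Q. ?g y \<partial>lebesgue)"
    using \<xi>[OF x] by (intro nn_integral_mono mult_left_mono) (auto simp: indicator_def)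
  ultimately have "(\<integral>\<^sup>+y\<in>R. ?g y \<partial>lebesgue) \<le> ?it * ennreal (card ?Q * (1 / 2 ^ K) ^ CARD('n))"
    by (subst (asm) grid.block.av_le_iff) auto
  also have "\<dots> \<le> ?it * ennreal (6 ^ CARD('n) * V)"
  proof (intro mult_left_mono ennreal_leI)
    have "card ?Q * (1 / 2 ^ K) ^ CARD('n) = (\<Prod>c\<in>(UNIV :: 'n set). 1 / 2 ^ K * 2 ^ ?s c)"
      by (rule grid.card_rect_nu)
    also have "\<dots> \<le> (\<Prod>c\<in>(UNIV :: 'n set). 6 * s (blk c))"
      using dyadic_level(2)[OF s(1) s(2) s(3)] by (intro prod_mono) auto
    finally show "card ?Q * (1 / 2 ^ K) ^ CARD('n) \<le> 6 ^ CARD('n) * V" by (simp add: prod.distrib V_def)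
  qed simp
  also have "\<dots> = ennreal (6 ^ CARD('n)) * ?it * ennreal V"
    using V(2) by (simp add: ennreal_mult mult_ac)
  finally have "average R ?g \<le> ennreal (6 ^ CARD('n)) * ?it"
    using V by (subst average_le_iff) (simp_all del: emeasure_completion)
  also have "\<dots> \<le> ennreal (6 ^ CARD('n)) * (SUP \<xi>. grid.iterated \<xi> K (2 * K) [0..<j] \<phi> x)"
    by (intro mult_left_mono SUP_upper) auto
  finally show ?thesis .
qed

lemma maximal_le_liminf:
  assumes \<phi>: "\<phi> \<in> borel_measurable lebesgue" and blk: "\<And>c. blk c < j"
  shows "(SUP R\<in>multi_basis blk. average R (\<lambda>y. \<phi> y * ennreal (t x y)) * indicator R x) \<le>
    liminf (\<lambda>K. ennreal (6 ^ CARD('n)) * (SUP \<xi>. grid.iterated \<xi> K (2 * K) [0..<j] \<phi> x))"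
proof (rule SUP_least)
  fix R assume "R \<in> multi_basis blk"
  then obtain u s where R: "R = box u (u + (\<chi> c. s (blk c)))" and s: "\<And>i. 0 < s i"
    unfolding multi_basis_def by blast
  show "average R (\<lambda>y. \<phi> y * ennreal (t x y)) * indicator R x \<le>
    liminf (\<lambda>K. ennreal (6 ^ CARD('n)) * (SUP \<xi>. grid.iterated \<xi> K (2 * K) [0..<j] \<phi> x))"
  proof (cases "x \<in> R")
    case True
    have "eventually (\<lambda>K. 3 * s (blk c) \<le> 2 ^ K \<and> 1 / 2 ^ K \<le> 6 * s (blk c)) sequentially" for c
    proof (intro eventually_conj)
      show "eventually (\<lambda>K. 3 * s (blk c) \<le> 2 ^ K) sequentially"
      proof -
        obtain n where n: "3 * s (blk c) < 2 ^ n" using real_arch_pow[of 2 "3 * s (blk c)"] by auto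
        have "3 * s (blk c) \<le> 2 ^ K" if "n \<le> K" for K
          using n power_increasing[OF that, of "2::real"] by linarith
        then show ?thesis by (auto simp: eventually_sequentially)
      qed
      show "eventually (\<lambda>K. 1 / 2 ^ K \<le> 6 * s (blk c)) sequentially"
      proof -
        have "(\<lambda>K. (1 / 2) ^ K :: real) \<longlonglongrightarrow> 0" by (rule LIMSEQ_power_zero) simp
        moreover have "0 < 6 * s (blk c)" using s[of "blk c"] by simp
        ultimately have "eventually (\<lambda>K. (1 / 2) ^ K < 6 * s (blk c)) sequentially"
          by (rule order_tendstoD(2))
        then show ?thesis by eventually_elim (simp add: power_one_over)
      qed
    qed
    then have "eventually (\<lambda>K. \<forall>c. 3 * s (blk c) \<le> 2 ^ K \<and> 1 / 2 ^ K \<le> 6 * s (blk c)) sequentially"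
      by (rule eventually_all_finite)
    then have "eventually (\<lambda>K. average R (\<lambda>y. \<phi> y * ennreal (t x y)) \<le>
        ennreal (6 ^ CARD('n)) * (SUP \<xi>. grid.iterated \<xi> K (2 * K) [0..<j] \<phi> x)) sequentially"
    proof eventually_elim
      case (elim K)
      then show ?case by (intro average_le_iterated[where s = s and u = u] \<phi> blk s R True) auto
    qed
    then have "average R (\<lambda>y. \<phi> y * ennreal (t x y)) \<le>
        liminf (\<lambda>K. ennreal (6 ^ CARD('n)) * (SUP \<xi>. grid.iterated \<xi> K (2 * K) [0..<j] \<phi> x))"
      by (rule Liminf_bounded)
    then show ?thesis using True by simp
  qed simp
qed

text \<open>
  For fixed \<open>K\<close> the bound is \<open>iterated_bound\<close>, applied to each of the shifted grids. The constants
  do not depend on \<open>K\<close>, so Fatou's lemma gives the limit.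
\<close>

lemma strong_bound:
  assumes \<phi>: "\<phi> \<in> borel_measurable lebesgue" and blk: "\<And>c. blk c < j"
  shows "(\<integral>\<^sup>+x. ennpowr (SUP R\<in>multi_basis blk. average R (\<lambda>y. \<phi> y * ennreal (t x y)) * indicator R x) p \<partial>lebesgue)
    \<le> ennreal ((6 ^ CARD('n)) powr p * CARD('n set) *
        (bound_const p CARD('d) (2 ^ CARD('n)) * A powr (p + p / (p - 1))) ^ j) * (\<integral>\<^sup>+x. ennpowr (\<phi> x) p \<partial>lebesgue)"
proof -
  define c where "c = (6 ^ CARD('n)) powr p"
  define B where "B = bound_const p CARD('d) (2 ^ CARD('n)) * A powr (p + p / (p - 1))"
  let ?it = "\<lambda>\<xi> K. grid.iterated \<xi> K (2 * K) [0..<j] \<phi>"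
  let ?I = "\<integral>\<^sup>+x. ennpowr (\<phi> x) p \<partial>lebesgue"
  have B: "0 \<le> B" using p_gt unfolding B_def bound_const_def by auto
  have [measurable]: "?it \<xi> K \<in> borel_measurable lebesgue" for \<xi> K
    using grid.measurable_iterated[OF \<phi>] .
  have "ennpowr (SUP R\<in>multi_basis blk. average R (\<lambda>y. \<phi> y * ennreal (t x y)) * indicator R x) p
      \<le> liminf (\<lambda>K. ennreal c * (\<Sum>\<xi>\<in>UNIV. ennpowr (?it \<xi> K x) p))" for x
  proof -
    have "ennpowr (SUP R\<in>multi_basis blk. average R (\<lambda>y. \<phi> y * ennreal (t x y)) * indicator R x) p
        \<le> ennpowr (liminf (\<lambda>K. ennreal (6 ^ CARD('n)) * (SUP \<xi>. ?it \<xi> K x))) p"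
      using p_gt by (intro ennpowr_mono maximal_le_liminf \<phi> blk) auto
    also have "\<dots> \<le> liminf (\<lambda>K. ennpowr (ennreal (6 ^ CARD('n)) * (SUP \<xi>. ?it \<xi> K x)) p)"
      using p_gt by (intro ennpowr_liminf_le) auto
    also have "\<dots> \<le> liminf (\<lambda>K. ennreal c * (\<Sum>\<xi>\<in>UNIV. ennpowr (?it \<xi> K x) p))"
    proof (intro Liminf_mono always_eventually allI)
      fix K
      have "ennpowr (SUP \<xi>. ?it \<xi> K x) p \<le> (SUP \<xi>. ennpowr (?it \<xi> K x) p)"
        using p_gt by (intro ennpowr_SUP_le) auto
      also have "\<dots> \<le> (\<Sum>\<xi>\<in>UNIV. ennpowr (?it \<xi> K x) p)"
        by (intro SUP_least member_le_sum) auto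
      finally show "ennpowr (ennreal (6 ^ CARD('n)) * (SUP \<xi>. ?it \<xi> K x)) p \<le>
          ennreal c * (\<Sum>\<xi>\<in>UNIV. ennpowr (?it \<xi> K x) p)"
        unfolding ennpowr_mult c_def by (simp add: mult_left_mono)
    qed
    finally show ?thesis .
  qed
  then have "(\<integral>\<^sup>+x. ennpowr (SUP R\<in>multi_basis blk. average R (\<lambda>y. \<phi> y * ennreal (t x y)) * indicator R x) p \<partial>lebesgue)
      \<le> (\<integral>\<^sup>+x. liminf (\<lambda>K. ennreal c * (\<Sum>\<xi>\<in>UNIV. ennpowr (?it \<xi> K x) p)) \<partial>lebesgue)"
    by (rule nn_integral_mono)
  also have "\<dots> \<le> liminf (\<lambda>K. \<integral>\<^sup>+x. ennreal c * (\<Sum>\<xi>\<in>UNIV. ennpowr (?it \<xi> K x) p) \<partial>lebesgue)"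
    by (rule nn_integral_liminf) measurable
  also have "\<dots> \<le> ennreal (c * CARD('n set) * B ^ j) * ?I"
  proof (rule Liminf_le)
    show "eventually (\<lambda>K. (\<integral>\<^sup>+x. ennreal c * (\<Sum>\<xi>\<in>UNIV. ennpowr (?it \<xi> K x) p) \<partial>lebesgue)
        \<le> ennreal (c * CARD('n set) * B ^ j) * ?I) sequentially"
    proof (intro always_eventually allI)
      fix K
      have "(\<integral>\<^sup>+x. ennreal c * (\<Sum>\<xi>\<in>UNIV. ennpowr (?it \<xi> K x) p) \<partial>lebesgue)
          = ennreal c * (\<Sum>\<xi>\<in>UNIV. \<integral>\<^sup>+x. ennpowr (?it \<xi> K x) p \<partial>lebesgue)"
        by (subst nn_integral_cmult) (auto simp: nn_integral_sum)
      also have "\<dots> \<le> ennreal c * (\<Sum>\<xi>\<in>(UNIV :: 'n set set). ennreal (B ^ j) * ?I)"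
        using grid.iterated_bound[OF \<phi>, of _ _ _ "[0..<j]"]
        by (intro mult_left_mono sum_mono) (auto simp: B_def)
      also have "\<dots> = ennreal (c * CARD('n set) * B ^ j) * ?I"
        using B by (simp add: c_def ennreal_mult ennreal_of_nat_eq_real_of_nat mult_ac)
      finally show "(\<integral>\<^sup>+x. ennreal c * (\<Sum>\<xi>\<in>UNIV. ennpowr (?it \<xi> K x) p) \<partial>lebesgue)
          \<le> ennreal (c * CARD('n set) * B ^ j) * ?I" .
    qed
  qed simp
  finally show ?thesis unfolding c_def B_def .
qed

end

section \<open>Reduction to countably many boxes\<close>

text \<open>
  Approximate a box from inside by boxes with rational data. Their indicators converge pointwise to
  that of the box, their volumes are smaller, and they eventually contain the given point \<open>x\<close>; by
  Fatou's lemma the average over the box is at most the supremum of the averages over them.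
\<close>

lemma basis_countable:
  fixes blk :: "'n::finite \<Rightarrow> nat"
  obtains \<B> where "countable \<B>" "\<B> \<subseteq> multi_basis blk"
    "\<And>(g :: real ^ 'n \<Rightarrow> ennreal) R x. g \<in> borel_measurable lebesgue \<Longrightarrow> R \<in> multi_basis blk \<Longrightarrow>
       average R g * indicator R x \<le> (SUP R\<in>\<B>. average R g * indicator R x)"
proof -
  define side :: "rat list \<Rightarrow> nat \<Rightarrow> real" where
    "side L i = (if i < length L then of_rat (L ! i) else 1)" for L i
  define bx :: "('n \<Rightarrow> rat) \<times> rat list \<Rightarrow> (real ^ 'n) set" where
    "bx z = box (\<chi> k. of_rat (fst z k)) ((\<chi> k. of_rat (fst z k)) + (\<chi> k. side (snd z) (blk k)))" for z
  define \<B> where "\<B> = bx ` {z. \<forall>i. 0 < side (snd z) i}"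
  have sub: "\<B> \<subseteq> multi_basis blk" unfolding \<B>_def multi_basis_def bx_def by blast
  have main: "average R g * indicator R x \<le> (SUP R\<in>\<B>. average R g * indicator R x)"
    if g [measurable]: "g \<in> borel_measurable lebesgue" and R: "R \<in> multi_basis blk"
    for g :: "real ^ 'n \<Rightarrow> ennreal" and R x
  proof (cases "x \<in> R")
    case x: True
    let ?S = "SUP R\<in>\<B>. average R g * indicator R x"
    obtain u s where R_eq: "R = box u (u + (\<chi> k. s (blk k)))" and s: "\<And>i. 0 < s i"
      using R unfolding multi_basis_def by blast
    define I where "I = Suc (Max (range blk))"
    have blk_I: "blk k < I" for k unfolding I_def by (simp add: less_Suc_eq_le)
    define \<mu> where "\<mu> = Min (s ` {..<I})"
    have \<mu>: "0 < \<mu>" "\<And>i. i < I \<Longrightarrow> \<mu> \<le> s i"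
    proof -
      have "\<mu> \<in> s ` {..<I}" unfolding \<mu>_def by (rule Min_in) (auto simp: I_def)
      then show "0 < \<mu>" using s by auto
      show "\<mu> \<le> s i" if "i < I" for i unfolding \<mu>_def using that by (intro Min_le) auto
    qed
    \<comment> \<open>Small compared with the shortest side, so that the inner boxes keep positive side lengths.\<close>
    define \<epsilon> where "\<epsilon> n = \<mu> / (4 * real (Suc n))" for n
    have \<epsilon>: "0 < \<epsilon> n" "2 * \<epsilon> n < \<mu>" for n
      using \<mu>(1) by (auto simp: \<epsilon>_def field_simps add_pos_nonneg)
    have \<epsilon>_lim: "\<epsilon> \<longlonglongrightarrow> 0"
    proof -
      have "(\<lambda>n. \<mu> / 4 * inverse (real (Suc n))) \<longlonglongrightarrow> \<mu> / 4 * 0"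
        by (intro tendsto_intros LIMSEQ_inverse_real_of_nat)
      then show ?thesis by (simp add: \<epsilon>_def[abs_def] field_simps)
    qed
    have ex_c: "\<exists>q. u $ k < of_rat q \<and> of_rat q < u $ k + \<epsilon> n" for k n
      using of_rat_dense[of "u $ k" "u $ k + \<epsilon> n"] \<epsilon>(1)[of n] by auto
    define c where "c n k = (SOME q. u $ k < of_rat q \<and> of_rat q < u $ k + \<epsilon> n)" for n k
    have c: "u $ k < of_rat (c n k) \<and> of_rat (c n k) < u $ k + \<epsilon> n" for n k
      unfolding c_def by (rule someI_ex) (rule ex_c)
    have ex_r: "\<exists>q. s i - 2 * \<epsilon> n < of_rat q \<and> of_rat q < s i - \<epsilon> n" for i n
      using of_rat_dense[of "s i - 2 * \<epsilon> n" "s i - \<epsilon> n"] \<epsilon>(1)[of n] by auto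
    define r where "r n i = (SOME q. s i - 2 * \<epsilon> n < of_rat q \<and> of_rat q < s i - \<epsilon> n)" for n i
    have r: "s i - 2 * \<epsilon> n < of_rat (r n i) \<and> of_rat (r n i) < s i - \<epsilon> n" for n i
      unfolding r_def by (rule someI_ex) (rule ex_r)
    define z where "z n = (c n, map (r n) [0..<I])" for n
    have side: "side (snd (z n)) (blk k) = of_rat (r n (blk k))" for n k
      using blk_I by (simp add: z_def side_def)
    have "0 < side (snd (z n)) i" for n i
    proof (cases "i < I")
      case True
      then have "0 < real_of_rat (r n i)" using r[of i n] \<mu>(2)[of i] \<epsilon>(2)[of n] by linarith
      then show ?thesis using True by (simp add: z_def side_def)
    qed (simp add: z_def side_def)
    then have zB: "bx (z n) \<in> \<B>" for n unfolding \<B>_def by blast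
    have mem: "y \<in> bx (z n) \<longleftrightarrow> (\<forall>k. of_rat (c n k) < y $ k \<and> y $ k < of_rat (c n k) + of_rat (r n (blk k)))" for y n
      unfolding bx_def by (simp add: mem_box_cart side) (simp add: z_def)
    have inc: "bx (z n) \<subseteq> R" for n
    proof
      fix y assume y: "y \<in> bx (z n)"
      have "u $ k < y $ k \<and> y $ k < u $ k + s (blk k)" for k
        using y[unfolded mem, rule_format, of k] c[of k n] r[of "blk k" n] by linarith
      then show "y \<in> R" by (simp add: R_eq mem_box_cart)
    qed
    have ev: "eventually (\<lambda>n. y \<in> bx (z n)) sequentially" if y: "y \<in> R" for y
    proof -
      have "eventually (\<lambda>n. of_rat (c n k) < y $ k \<and> y $ k < of_rat (c n k) + of_rat (r n (blk k))) sequentially" for k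
      proof -
        have "u $ k < y $ k" "y $ k < u $ k + s (blk k)" using y by (auto simp: R_eq mem_box_cart)
        then have "0 < min (y $ k - u $ k) ((u $ k + s (blk k) - y $ k) / 2)" by simp
        from order_tendstoD(2)[OF \<epsilon>_lim this] show ?thesis
        proof eventually_elim
          case (elim n)
          then show ?case using c[of k n] r[of "blk k" n] by auto
        qed
      qed
      then show ?thesis unfolding mem by (rule eventually_all_finite)
    qed
    define V where "V = (\<Prod>k\<in>(UNIV :: 'n set). s (blk k))"
    have V: "emeasure lebesgue R = ennreal V" "0 < V"
      using emeasure_basis[where s = s and blk = blk] s by (auto simp: V_def R_eq)
    have [measurable]: "R \<in> sets lebesgue" "bx (z n) \<in> sets lebesgue" for n
      unfolding R_eq bx_def by auto
    have "(\<integral>\<^sup>+y\<in>R. g y \<partial>lebesgue) \<le> (\<integral>\<^sup>+y. liminf (\<lambda>n. g y * indicator (bx (z n)) y) \<partial>lebesgue)"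
    proof (rule nn_integral_mono)
      fix y
      show "g y * indicator R y \<le> liminf (\<lambda>n. g y * indicator (bx (z n)) y)"
      proof (cases "y \<in> R")
        case True
        show ?thesis
          by (rule Liminf_bounded, rule eventually_mono[OF ev[OF True]]) (simp add: True)
      qed simp
    qed
    also have "\<dots> \<le> liminf (\<lambda>n. \<integral>\<^sup>+y\<in>bx (z n). g y \<partial>lebesgue)"
      by (rule nn_integral_liminf) measurable
    also have "\<dots> \<le> ?S * ennreal V"
    proof (rule Liminf_le)
      show "eventually (\<lambda>n. (\<integral>\<^sup>+y\<in>bx (z n). g y \<partial>lebesgue) \<le> ?S * ennreal V) sequentially"
        using ev[OF x]
      proof eventually_elim
        case (elim n)
        obtain u' s' where n_eq: "bx (z n) = box u' (u' + (\<chi> k. s' (blk k)))" and s': "\<And>i. 0 < s' i"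
          using zB sub unfolding multi_basis_def by blast
        have pos: "emeasure lebesgue (bx (z n)) \<noteq> 0" "emeasure lebesgue (bx (z n)) < top"
          unfolding n_eq emeasure_basis(1)[of s', OF s'] using emeasure_basis(2)[of s' blk, OF s']
          by (simp_all only: ennreal_eq_0_iff not_le ennreal_less_top)
        have "average (bx (z n)) g \<le> ?S"
          using SUP_upper[OF zB[of n], of "\<lambda>R. average R g * indicator R x"] elim by simp
        then have "(\<integral>\<^sup>+y\<in>bx (z n). g y \<partial>lebesgue) \<le> ?S * emeasure lebesgue (bx (z n))"
          using average_le_iff[OF pos] by simp
        also have "\<dots> \<le> ?S * ennreal V"
          unfolding V(1)[symmetric] by (intro mult_left_mono emeasure_mono inc) auto
        finally show ?case .
      qed
    qed simp
    finally have "average R g \<le> ?S" using V by (subst average_le_iff) auto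
    then show ?thesis using x by simp
  qed simp
  show ?thesis by (rule that[OF _ sub main]) (auto simp: \<B>_def)
qed

lemma measurable_maximal:
  fixes k :: "real ^ 'n::finite \<Rightarrow> real ^ 'n \<Rightarrow> ennreal"
  assumes [measurable]: "case_prod k \<in> borel_measurable (lebesgue \<Otimes>\<^sub>M lebesgue)"
  shows "(\<lambda>x. SUP R\<in>multi_basis blk. average R (k x) * indicator R x) \<in> borel_measurable lebesgue"
proof -
  interpret lebesgue: sigma_finite_measure "lebesgue :: (real ^ 'n) measure"
    by (rule sigma_finite_lebesgue)
  obtain \<B> where \<B>: "countable \<B>" "\<B> \<subseteq> multi_basis blk"
    "\<And>(g :: real ^ 'n \<Rightarrow> ennreal) R x. g \<in> borel_measurable lebesgue \<Longrightarrow> R \<in> multi_basis blk \<Longrightarrow>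
       average R g * indicator R x \<le> (SUP R\<in>\<B>. average R g * indicator R x)"
    by (rule basis_countable[of blk]) blast
  have [measurable]: "k x \<in> borel_measurable lebesgue" for x
    using measurable_compose[OF measurable_Pair1' assms, of x] by simp
  have "(SUP R\<in>multi_basis blk. average R (k x) * indicator R x) = (SUP R\<in>\<B>. average R (k x) * indicator R x)" for x
    using \<B>(2,3) by (intro antisym SUP_least SUP_subset_mono) auto
  moreover have "(\<lambda>x. SUP R\<in>\<B>. average R (k x) * indicator R x) \<in> borel_measurable lebesgue"
  proof (intro borel_measurable_SUP \<B>(1))
    fix R assume "R \<in> \<B>"
    then have [measurable]: "R \<in> sets lebesgue" using \<B>(2) by (auto simp: multi_basis_def)
    show "(\<lambda>x. average R (k x) * indicator R x) \<in> borel_measurable lebesgue"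
      unfolding average_def by measurable
  qed
  ultimately show ?thesis by simp
qed

section \<open>The Christ-Goldberg maximal operator\<close>

lemma average_cong_AE: "(AE y in lebesgue. g y = h y) \<Longrightarrow> average R g = average R h"
  unfolding average_def by (intro arg_cong2[where f = "(/)"] nn_integral_cong_AE) auto

lemma average_mono_AE: "(AE y in lebesgue. g y \<le> h y) \<Longrightarrow> average R g \<le> average R h"
  unfolding average_def
  by (intro divide_right_mono_ennreal nn_integral_mono_AE) (auto elim!: eventually_mono intro: mult_right_mono)

lemma average_cmult:
  assumes "g \<in> borel_measurable lebesgue" "R \<in> sets lebesgue"
  shows "average R (\<lambda>y. c * g y) = c * average R g"
  using assms by (simp add: average_def nn_integral_cmult mult.assoc ennreal_times_divide)

text \<open>
  Changing the weight on a null set makes it invertible everywhere.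
\<close>

definition regularize :: "(real ^ 'n \<Rightarrow> real ^ 'd ^ 'd) \<Rightarrow> real ^ 'n \<Rightarrow> real ^ 'd ^ 'd" where
  "regularize W x = (if invertible (W x) then W x else mat 1)"

lemma regularize_AE: "matrix_weight W \<Longrightarrow> AE x in lebesgue. regularize W x = W x"
  unfolding matrix_weight_def regularize_def by (auto elim: eventually_mono)

lemma invertible_mat_1: "invertible (mat 1 :: real ^ 'd ^ 'd)"
  unfolding invertible_def by (intro exI[of _ "mat 1"]) simp

lemma invertible_weight_regularize:
  assumes W: "matrix_weight W"
  shows "invertible_weight (regularize W)"
proof
  have "AE x in lebesgue. W x = regularize W x" using regularize_AE[OF W] by (auto elim: eventually_mono)
  with W show "regularize W \<in> borel_measurable lebesgue"
    unfolding matrix_weight_def by (blast intro: measurable_lebesgue_AE)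
  show "transpose (regularize W x) = regularize W x" for x
    using W by (auto simp: regularize_def matrix_weight_def pos_semidefinite_def transpose_mat)
  show "invertible (regularize W x)" for x
    by (simp add: regularize_def invertible_mat_1)
qed

lemma transfer_norm_regularize_AE:
  assumes W: "matrix_weight W" and x: "regularize W x = W x"
  shows "AE y in lebesgue. transfer_norm (regularize W) x y = transfer_norm W x y"
  using regularize_AE[OF W] by eventually_elim (simp add: transfer_norm_def x)

lemma christ_goldberg_regularize_AE:
  assumes W: "matrix_weight W"
  shows "AE x in lebesgue. christ_goldberg blk (regularize W) f x = christ_goldberg blk W f x"
  using regularize_AE[OF W]
proof eventually_elim
  case (elim x)
  have "average R (\<lambda>y. ennreal (norm ((regularize W x ** matrix_inv (regularize W y)) *v f y))) =
      average R (\<lambda>y. ennreal (norm ((W x ** matrix_inv (W y)) *v f y)))" for R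
    by (intro average_cong_AE) (use regularize_AE[OF W] in eventually_elim, simp add: elim)
  then show ?case unfolding christ_goldberg_def by simp
qed

lemma (in invertible_weight) christ_goldberg_le:
  "christ_goldberg blk W f x \<le>
    (SUP R\<in>multi_basis blk. average R (\<lambda>y. ennreal (norm (f y)) * ennreal (t x y)) * indicator R x)"
  unfolding christ_goldberg_def
proof (rule SUP_mono)
  fix R assume R: "R \<in> multi_basis blk"
  have le: "ennreal (norm ((W x ** matrix_inv (W y)) *v f y)) \<le> ennreal (norm (f y)) * ennreal (t x y)" for y
    using onorm_matrix_mult_vector[of "W x ** matrix_inv (W y)" "f y"]
    by (simp add: transfer_norm_def mult.commute ennreal_leI onorm_matrix_nonneg flip: ennreal_mult)
  show "\<exists>R'\<in>multi_basis blk. average R (\<lambda>y. ennreal (norm ((W x ** matrix_inv (W y)) *v f y))) * indicator R x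
      \<le> average R' (\<lambda>y. ennreal (norm (f y)) * ennreal (t x y)) * indicator R' x"
    using le by (intro bexI[OF _ R] mult_right_mono average_mono_AE) auto
qed

lemma (in invertible_weight) measurable_christ_goldberg:
  assumes f: "f \<in> borel_measurable lebesgue"
  shows "christ_goldberg blk W f \<in> borel_measurable lebesgue"
proof -
  have "(\<lambda>z. ennreal (norm ((W (fst z) ** matrix_inv (W (snd z))) *v f (snd z))))
      \<in> borel_measurable (lebesgue \<Otimes>\<^sub>M lebesgue)"
    by (intro measurable_compose[OF _ measurable_ennreal] measurable_compose[OF _ borel_measurable_norm]
        measurable_matrix_vector measurable_matrix_mult measurable_matrix_inv invertible_W
        measurable_compose[OF measurable_fst measurable_W] measurable_compose[OF measurable_snd measurable_W]
        measurable_compose[OF measurable_snd f])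
  then show ?thesis
    unfolding christ_goldberg_def
    by (intro measurable_maximal) (simp add: case_prod_beta')
qed

lemma measurable_christ_goldberg_weight:
  assumes W: "matrix_weight W" and f: "f \<in> borel_measurable lebesgue"
  shows "christ_goldberg blk W f \<in> borel_measurable lebesgue"
  using invertible_weight.measurable_christ_goldberg[OF invertible_weight_regularize[OF W] f]
    christ_goldberg_regularize_AE[OF W]
  by (rule measurable_lebesgue_AE)

lemma christ_goldberg_Lp_bound:
  fixes P A :: real and W :: "real ^ 'n::finite \<Rightarrow> real ^ 'd::finite ^ 'd" and f :: "real ^ 'n \<Rightarrow> real ^ 'd"
    and blk :: "'n \<Rightarrow> nat" and j :: nat
  assumes P: "1 < P" and W: "matrix_weight W" and A: "Ap_const (ennreal P) blk W = ennreal A" "0 \<le> A"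
    and blk: "\<And>c. blk c < j" and f: "f \<in> borel_measurable lebesgue"
  shows "Lp_norm (ennreal P) (christ_goldberg blk W f) \<le>
    ennreal (6 ^ CARD('n) * CARD('n set) powr (1 / P) * bound_const P CARD('d) (2 ^ CARD('n)) powr (j / P)
      * A powr (j * (P / (P - 1)))) * Lp_norm (ennreal P) (\<lambda>x. ennreal (norm (f x)))"
proof -
  let ?W = "regularize W"
  let ?B = "bound_const P CARD('d) (2 ^ CARD('n))"
  let ?P' = "P / (P - 1)"
  let ?\<phi> = "\<lambda>x. ennreal (norm (f x))"
  interpret invertible_weight ?W using W by (rule invertible_weight_regularize)
  have conj: "conj_exp (ennreal P) = ?P'" using P by (simp add: conj_exp_def)
  have PP: "P / ?P' = P - 1" using P by (simp add: field_simps)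
  have Ap: "average R (\<lambda>x. ennpowr (average R (\<lambda>y. ennpowr (ennreal (t x y)) ?P')) (P - 1)) \<le> ennreal (A powr P)"
    if R: "R \<in> multi_basis blk" for R
  proof -
    let ?X = "\<lambda>W. average R (\<lambda>x. ennpowr (average R (\<lambda>y. ennpowr (ennreal (transfer_norm W x y)) ?P')) (P - 1))"
    have eq: "Ap_const (ennreal P) blk W = (SUP R\<in>multi_basis blk. ennpowr (average R (\<lambda>x. ennpowr
        (average R (\<lambda>y. ennpowr (ennreal (transfer_norm W x y)) ?P')) (P - 1))) (1 / P))"
      using P by (simp add: Ap_const_def conj PP)
    have "ennpowr (?X W) (1 / P) \<le> Ap_const (ennreal P) blk W"
      unfolding eq by (rule SUP_upper[OF R])
    then have "ennpowr (ennpowr (?X W) (1 / P)) P \<le> ennpowr (ennreal A) P"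
      unfolding A(1) using P by (intro ennpowr_mono) auto
    then have "?X W \<le> ennreal (A powr P)" using P A(2) by (simp add: ennpowr_ennpowr)
    moreover have "?X ?W = ?X W"
    proof (intro average_cong_AE)
      show "AE x in lebesgue. ennpowr (average R (\<lambda>y. ennpowr (ennreal (t x y)) ?P')) (P - 1) =
          ennpowr (average R (\<lambda>y. ennpowr (ennreal (transfer_norm W x y)) ?P')) (P - 1)"
        using regularize_AE[OF W]
      proof eventually_elim
        case (elim x)
        have "average R (\<lambda>y. ennpowr (ennreal (t x y)) ?P') = average R (\<lambda>y. ennpowr (ennreal (transfer_norm W x y)) ?P')"
          by (intro average_cong_AE) (use transfer_norm_regularize_AE[OF W elim] in eventually_elim, simp)
        then show ?case by simp
      qed
    qed
    ultimately show ?thesis by simp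
  qed
  interpret strong_weight ?W blk P A
    by unfold_locales (use P A(2) Ap in auto)
  let ?M = "\<lambda>x. SUP R\<in>multi_basis blk. average R (\<lambda>y. ?\<phi> y * ennreal (t x y)) * indicator R x"
  have meas: "christ_goldberg blk W f \<in> borel_measurable lebesgue"
    using W f by (rule measurable_christ_goldberg_weight)
  have \<phi>: "?\<phi> \<in> borel_measurable lebesgue" using f by measurable
  have B: "0 \<le> ?B" using P by (simp add: bound_const_def)
  define C where "C = (6 ^ CARD('n)) powr P * CARD('n set) * (?B * A powr (P + ?P')) ^ j"
  have C: "0 \<le> C" using B by (simp add: C_def)
  have "(\<integral>\<^sup>+x. ennpowr (christ_goldberg blk W f x) P \<partial>lebesgue) \<le> (\<integral>\<^sup>+x. ennpowr (?M x) P \<partial>lebesgue)"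
  proof (rule nn_integral_mono_AE)
    show "AE x in lebesgue. ennpowr (christ_goldberg blk W f x) P \<le> ennpowr (?M x) P"
      using christ_goldberg_regularize_AE[OF W, of blk f]
    proof eventually_elim
      case (elim x)
      show ?case using christ_goldberg_le[of blk f x] P unfolding elim by (intro ennpowr_mono) auto
    qed
  qed
  also have "\<dots> \<le> ennreal C * (\<integral>\<^sup>+x. ennpowr (?\<phi> x) P \<partial>lebesgue)"
    unfolding C_def using \<phi> blk by (rule strong_bound)
  finally have "ennpowr (\<integral>\<^sup>+x. ennpowr (christ_goldberg blk W f x) P \<partial>lebesgue) (1 / P)
      \<le> ennpowr (ennreal C * (\<integral>\<^sup>+x. ennpowr (?\<phi> x) P \<partial>lebesgue)) (1 / P)"
    using P by (intro ennpowr_mono) auto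
  also have "\<dots> = ennreal (C powr (1 / P)) * ennpowr (\<integral>\<^sup>+x. ennpowr (?\<phi> x) P \<partial>lebesgue) (1 / P)"
    using C by (simp add: ennpowr_mult)
  also have "C powr (1 / P) = 6 ^ CARD('n) * CARD('n set) powr (1 / P) * ?B powr (j / P) * A powr (j * ?P')"
  proof -
    have e: "(P + ?P') * (j * (1 / P)) = j * ?P'" using P by (simp add: field_simps)
    have "C powr (1 / P) = ((6 ^ CARD('n)) powr P) powr (1 / P) * CARD('n set) powr (1 / P) *
        ((?B * A powr (P + ?P')) ^ j) powr (1 / P)"
      using B by (simp add: C_def powr_mult)
    also have "((6 ^ CARD('n)) powr P) powr (1 / P) = (6 ^ CARD('n) :: real)" using P by (simp add: powr_powr)
    also have "((?B * A powr (P + ?P')) ^ j) powr (1 / P) = ?B powr (j / P) * A powr (j * ?P')"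
    proof (cases "?B * A powr (P + ?P') = 0")
      case True
      have "0 < j" using blk[of undefined] by simp
      with True show ?thesis by auto
    next
      case False
      then have "((?B * A powr (P + ?P')) ^ j) powr (1 / P) = (?B * A powr (P + ?P')) powr (j * (1 / P))"
        using B by (simp add: powr_powr flip: powr_realpow)
      also have "\<dots> = ?B powr (j / P) * A powr (j * ?P')"
        using B A(2) e by (simp add: powr_mult powr_powr)
      finally show ?thesis .
    qed
    finally show ?thesis by (simp only: mult.assoc)
  qed
  finally show ?thesis using P meas \<phi> by (simp add: Lp_norm_def)
qed

lemma basis_nonempty: "\<exists>R. R \<in> multi_basis blk"
  unfolding multi_basis_def by (auto intro!: exI[of _ "\<lambda>_. 1"])

text \<open>
  Let \<open>N\<close> be the average of \<open>dual u\<close> over \<open>R\<close>. Averaging \<open>dual u y \<le> t x y * dual u x\<close> in \<open>y\<close> gives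
  \<open>N \<le> A * dual u x\<close> for almost all \<open>x\<close> in \<open>R\<close>, and averaging once more in \<open>x\<close> gives \<open>N \<le> A * N\<close>.
\<close>

lemma (in invertible_weight) one_le_of_average_le:
  assumes R: "R \<in> multi_basis blk" and A: "0 \<le> A"
    and le: "AE x in lebesgue. x \<in> R \<longrightarrow> average R (\<lambda>y. ennreal (t x y)) \<le> ennreal A"
  shows "1 \<le> A"
proof -
  obtain c s where R_eq: "R = box c (c + (\<chi> k. s (blk k)))" and s: "\<And>i. 0 < s i"
    using R unfolding multi_basis_def by blast
  define V where "V = (\<Prod>k\<in>(UNIV :: 'n set). s (blk k))"
  have V: "emeasure lebesgue R = ennreal V" "0 < V"
    using emeasure_basis[where s = s and blk = blk] s by (auto simp: V_def R_eq simp del: emeasure_completion)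
  have [measurable]: "R \<in> sets lebesgue" by (simp add: R_eq)
  obtain u :: "real ^ 'd" where u: "u \<noteq> 0"
    using that[of "axis undefined 1"] by (simp add: axis_eq_0_iff)
  define N where "N = average R (\<lambda>y. ennreal (dual u y))"
  have N: "AE x in lebesgue. x \<in> R \<longrightarrow> N \<le> ennreal A * ennreal (dual u x)"
    using le
  proof eventually_elim
    case (elim x)
    show ?case
    proof
      assume "x \<in> R"
      have "N \<le> average R (\<lambda>y. ennreal (dual u x) * ennreal (t x y))"
        unfolding N_def using dual_le[of u _ x]
        by (intro average_mono_AE always_eventually allI) (simp add: mult.commute ennreal_leI flip: ennreal_mult)
      also have "\<dots> = ennreal (dual u x) * average R (\<lambda>y. ennreal (t x y))"
        by (intro average_cmult) measurable
      also have "\<dots> \<le> ennreal (dual u x) * ennreal A"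
        using elim \<open>x \<in> R\<close> by (intro mult_left_mono) auto
      finally show "N \<le> ennreal A * ennreal (dual u x)" by (simp add: mult.commute)
    qed
  qed
  have "\<exists>x. x \<in> R \<and> N \<le> ennreal A * ennreal (dual u x)"
  proof (rule ccontr)
    assume "\<not> ?thesis"
    with N have "AE x in lebesgue. x \<notin> R" by (auto elim!: eventually_mono)
    then have "R \<in> null_sets lebesgue" by (subst (asm) AE_iff_null_sets[symmetric]) auto
    then show False using V by auto
  qed
  then obtain x where "N \<le> ennreal A * ennreal (dual u x)" by blast
  also have "\<dots> < top" by (simp add: ennreal_mult_less_top)
  finally have "N < top" .
  moreover have "N \<noteq> 0"
  proof
    assume "N = 0"
    then have "AE y in lebesgue. ennreal (dual u y) * indicator R y = 0"
      unfolding N_def average_def V(1) by (simp add: nn_integral_0_iff_AE)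
    then have "AE x in lebesgue. x \<notin> R"
      by eventually_elim (use dual_pos[OF u] in \<open>auto simp: indicator_def less_le split: if_splits\<close>)
    then have "R \<in> null_sets lebesgue" by (subst (asm) AE_iff_null_sets[symmetric]) auto
    then show False using V by auto
  qed
  ultimately obtain n where n: "N = ennreal n" "0 < n" by (cases N) auto
  have "N * ennreal V = (\<integral>\<^sup>+x\<in>R. N \<partial>lebesgue)" using V by (simp add: nn_integral_cmult_indicator del: emeasure_completion)
  also have "\<dots> \<le> (\<integral>\<^sup>+x. ennreal A * (ennreal (dual u x) * indicator R x) \<partial>lebesgue)"
    by (rule nn_integral_mono_AE) (use N in eventually_elim, auto simp: indicator_def)
  also have "\<dots> = ennreal A * (\<integral>\<^sup>+x\<in>R. ennreal (dual u x) \<partial>lebesgue)"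
    by (rule nn_integral_cmult) measurable
  also have "(\<integral>\<^sup>+x\<in>R. ennreal (dual u x) \<partial>lebesgue) = N * ennreal V"
    unfolding N_def average_def V(1) using V(2) by (intro ennreal_divide_mult_cancel[symmetric]) auto
  finally have "n * V \<le> A * (n * V)"
    using n V A by (simp flip: ennreal_mult)
  then show ?thesis using n V by simp
qed

text \<open>
  The constant \<open>A\<close> bounds the average over each single \<open>R\<close> for almost every \<open>x\<close>; the exceptional
  sets add up to a null set only after the reduction to countably many \<open>R\<close>.
\<close>

lemma christ_goldberg_Linf_bound:
  fixes W :: "real ^ 'n::finite \<Rightarrow> real ^ 'd::finite ^ 'd" and f :: "real ^ 'n \<Rightarrow> real ^ 'd"
  assumes W: "matrix_weight W" and A: "Ap_const \<infinity> blk W = ennreal A" "0 \<le> A"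
    and f: "f \<in> borel_measurable lebesgue"
  shows "Lp_norm \<infinity> (christ_goldberg blk W f) \<le> ennreal A * Lp_norm \<infinity> (\<lambda>x. ennreal (norm (f x)))" "1 \<le> A"
proof -
  let ?W = "regularize W"
  interpret invertible_weight ?W using W by (rule invertible_weight_regularize)
  have Ap: "AE x in lebesgue. x \<in> R \<longrightarrow> average R (\<lambda>y. ennreal (t x y)) \<le> ennreal A"
    if R: "R \<in> multi_basis blk" for R
  proof -
    have R_sets: "R \<in> sets lebesgue" using R by (auto simp: multi_basis_def)
    let ?g = "\<lambda>x. average R (\<lambda>y. ennreal (transfer_norm W x y))"
    have "esssup (restrict_space lebesgue R) ?g \<le> ennreal A"
      unfolding A(1)[symmetric] Ap_const_def by (simp only: if_True simp_thms) (rule SUP_upper[OF R])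
    then have "AE x in restrict_space lebesgue R. ?g x \<le> ennreal A"
      using esssup_AE[of ?g "restrict_space lebesgue R"] by (auto elim!: eventually_mono)
    then have "AE x in lebesgue. x \<in> R \<longrightarrow> ?g x \<le> ennreal A"
      using R_sets by (subst (asm) AE_restrict_space_iff) auto
    then show ?thesis
      using regularize_AE[OF W]
    proof eventually_elim
      case (elim x)
      have "average R (\<lambda>y. ennreal (t x y)) = ?g x"
        by (intro average_cong_AE) (use transfer_norm_regularize_AE[OF W elim(2)] in eventually_elim, simp)
      then show ?case using elim(1) by simp
    qed
  qed
  obtain R0 where R0: "R0 \<in> multi_basis blk" using basis_nonempty[of blk] by blast
  show "1 \<le> A" using one_le_of_average_le[OF R0 A(2) Ap[OF R0]] .
  obtain \<B> where \<B>: "countable \<B>" "\<B> \<subseteq> multi_basis blk"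
    "\<And>(g :: real ^ 'n \<Rightarrow> ennreal) R x. g \<in> borel_measurable lebesgue \<Longrightarrow> R \<in> multi_basis blk \<Longrightarrow>
       average R g * indicator R x \<le> (SUP R\<in>\<B>. average R g * indicator R x)"
    by (rule basis_countable[of blk]) blast
  define F where "F = esssup lebesgue (\<lambda>x. ennreal (norm (f x)))"
  have fF: "AE y in lebesgue. ennreal (norm (f y)) \<le> F" unfolding F_def by (rule esssup_AE)
  have "AE x in lebesgue. \<forall>R\<in>\<B>. x \<in> R \<longrightarrow> average R (\<lambda>y. ennreal (t x y)) \<le> ennreal A"
    using Ap \<B>(1,2) by (subst AE_ball_countable) auto
  then have "AE x in lebesgue. christ_goldberg blk W f x \<le> ennreal A * F"
    using christ_goldberg_regularize_AE[OF W, of blk f]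
  proof eventually_elim
    case (elim x)
    have "average R (\<lambda>y. ennreal (norm (f y)) * ennreal (t x y)) * indicator R x \<le> ennreal A * F"
      if R: "R \<in> multi_basis blk" for R
    proof -
      have [measurable]: "R \<in> sets lebesgue" using R by (auto simp: multi_basis_def)
      have "average R (\<lambda>y. ennreal (norm (f y)) * ennreal (t x y)) \<le> average R (\<lambda>y. F * ennreal (t x y))"
        by (intro average_mono_AE) (use fF in eventually_elim, simp add: mult_right_mono)
      also have "\<dots> = F * average R (\<lambda>y. ennreal (t x y))" by (intro average_cmult) measurable
      finally have "average R (\<lambda>y. ennreal (norm (f y)) * ennreal (t x y)) * indicator R x \<le>
          F * (average R (\<lambda>y. ennreal (t x y)) * indicator R x)"
        by (simp add: mult_right_mono flip: mult.assoc)
      also have "\<dots> \<le> F * ennreal A"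
      proof (rule mult_left_mono)
        have "average R (\<lambda>y. ennreal (t x y)) * indicator R x
            \<le> (SUP R\<in>\<B>. average R (\<lambda>y. ennreal (t x y)) * indicator R x)"
          using R by (intro \<B>(3)) auto
        also have "\<dots> \<le> ennreal A" using elim(1) by (intro SUP_least) (auto simp: indicator_def)
        finally show "average R (\<lambda>y. ennreal (t x y)) * indicator R x \<le> ennreal A" .
      qed simp
      finally show ?thesis by (simp add: mult.commute)
    qed
    then have "(SUP R\<in>multi_basis blk. average R (\<lambda>y. ennreal (norm (f y)) * ennreal (t x y)) * indicator R x) \<le> ennreal A * F"
      by (rule SUP_least)
    then show ?case
      unfolding elim(2)[symmetric] by (rule order_trans[OF christ_goldberg_le])
  qed
  then show "Lp_norm \<infinity> (christ_goldberg blk W f) \<le> ennreal A * Lp_norm \<infinity> (\<lambda>x. ennreal (norm (f x)))"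
    unfolding Lp_norm_def F_def
    by (simp add: esssup_I measurable_christ_goldberg_weight[OF W f])
qed

lemma length_le_sum_list: "(\<forall>a\<in>set \<alpha>. 0 < (a::nat)) \<Longrightarrow> length \<alpha> \<le> sum_list \<alpha>"
  by (induction \<alpha>) auto

theorem theorem1p12:
  fixes p :: ennreal
  assumes "1 < p"
  shows "\<exists>C::real. 0 < C \<and>
    (\<forall>(\<alpha>::nat list) (blk::'n::finite \<Rightarrow> nat) (W::real ^ 'n \<Rightarrow> real ^ 'd::finite ^ 'd) (f::real ^ 'n \<Rightarrow> real ^ 'd).
       factor_blocks \<alpha> blk \<longrightarrow> W \<in> Ap_weights p blk \<longrightarrow> f \<in> Lp_space p \<longrightarrow>
         Lp_norm p (christ_goldberg blk W f)
           \<le> ennreal C * ennpowr (Ap_const p blk W) (real (length \<alpha>) * conj_exp p)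
               * Lp_norm p (\<lambda>x. ennreal (norm (f x))) \<and>
         (p = \<infinity> \<longrightarrow>
           Lp_norm p (christ_goldberg blk W f)
             \<le> ennreal C * Ap_const p blk W * Lp_norm p (\<lambda>x. ennreal (norm (f x)))))"
proof (cases p)
  case (real P)
  then have P: "1 < P" using assms by simp
  have p: "p \<noteq> \<infinity>" "enn2real p = P" using real by auto
  \<comment> \<open>The maximum with 1 makes the bound monotone in the number of factors, which is at most \<open>n\<close>.\<close>
  define B where "B = max 1 (bound_const P CARD('d) (2 ^ CARD('n)))"
  define C where "C = 6 ^ CARD('n) * CARD('n set) powr (1 / P) * B powr (CARD('n) / P)"
  show ?thesis
  proof (intro exI[of _ C] conjI allI impI)
    show "0 < C" by (simp add: C_def B_def)
  next
    fix \<alpha> :: "nat list" and blk :: "'n \<Rightarrow> nat" and W :: "real ^ 'n \<Rightarrow> real ^ 'd ^ 'd" and f :: "real ^ 'n \<Rightarrow> real ^ 'd"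
    assume fb: "factor_blocks \<alpha> blk" and W: "W \<in> Ap_weights p blk" and f: "f \<in> Lp_space p"
    let ?j = "length \<alpha>"
    let ?n = "Lp_norm p (\<lambda>x. ennreal (norm (f x)))"
    have j: "?j \<le> CARD('n)" using fb length_le_sum_list[of \<alpha>] by (simp add: factor_blocks_def)
    obtain A where A: "Ap_const p blk W = ennreal A" "0 \<le> A"
      using W unfolding Ap_weights_def by (cases "Ap_const p blk W") auto
    have "bound_const P CARD('d) (2 ^ CARD('n)) powr (?j / P) \<le> B powr (?j / P)"
      using P by (intro powr_mono2) (auto simp: B_def bound_const_def)
    also have "\<dots> \<le> B powr (CARD('n) / P)"
      using P j by (intro powr_mono divide_right_mono) (auto simp: B_def)
    finally have le: "6 ^ CARD('n) * CARD('n set) powr (1 / P) * bound_const P CARD('d) (2 ^ CARD('n)) powr (?j / P) \<le> C"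
      unfolding C_def by (intro mult_left_mono) auto
    have "Lp_norm p (christ_goldberg blk W f) \<le>
      ennreal (6 ^ CARD('n) * CARD('n set) powr (1 / P) * bound_const P CARD('d) (2 ^ CARD('n)) powr (?j / P)
        * A powr (?j * (P / (P - 1)))) * ?n"
      unfolding real using W f fb A P unfolding real
      by (intro christ_goldberg_Lp_bound) (auto simp: Ap_weights_def Lp_space_def factor_blocks_def)
    also have "\<dots> \<le> ennreal (C * A powr (?j * (P / (P - 1)))) * ?n"
      using le by (intro mult_right_mono ennreal_leI) auto
    also have "\<dots> = ennreal C * ennpowr (Ap_const p blk W) (real ?j * conj_exp p) * ?n"
      using A(2) p by (simp add: A(1) conj_exp_def ennreal_mult'' flip: ennreal_mult)
    finally show "Lp_norm p (christ_goldberg blk W f)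
        \<le> ennreal C * ennpowr (Ap_const p blk W) (real ?j * conj_exp p) * ?n" .
  qed (use p in auto)
next
  case top
  show ?thesis
  proof (intro exI[of _ 1] allI impI conjI)
    fix \<alpha> :: "nat list" and blk :: "'n \<Rightarrow> nat" and W :: "real ^ 'n \<Rightarrow> real ^ 'd ^ 'd" and f :: "real ^ 'n \<Rightarrow> real ^ 'd"
    assume fb: "factor_blocks \<alpha> blk" and W: "W \<in> Ap_weights p blk" and f: "f \<in> Lp_space p"
    let ?j = "length \<alpha>"
    let ?n = "Lp_norm p (\<lambda>x. ennreal (norm (f x)))"
    obtain A where A: "Ap_const p blk W = ennreal A" "0 \<le> A"
      using W unfolding Ap_weights_def by (cases "Ap_const p blk W") auto
    have le: "Lp_norm p (christ_goldberg blk W f) \<le> ennreal A * ?n" and A1: "1 \<le> A"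
      using christ_goldberg_Linf_bound[of W blk A f] W f A top by (auto simp: Ap_weights_def Lp_space_def)
    then show "Lp_norm p (christ_goldberg blk W f) \<le> ennreal 1 * Ap_const p blk W * ?n" by (simp add: A)
    have j: "1 \<le> ?j" using fb by (cases \<alpha>) (auto simp: factor_blocks_def)
    have "A powr 1 \<le> A powr ?j" using A1 j by (intro powr_mono) auto
    then have "ennreal A \<le> ennpowr (Ap_const p blk W) (real ?j * conj_exp p)"
      using A A1 top by (simp add: conj_exp_def ennreal_leI)
    then have "ennreal A * ?n \<le> ennreal 1 * ennpowr (Ap_const p blk W) (real ?j * conj_exp p) * ?n"
      by (simp add: mult_right_mono)
    with le show "Lp_norm p (christ_goldberg blk W f)
        \<le> ennreal 1 * ennpowr (Ap_const p blk W) (real ?j * conj_exp p) * ?n"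
      by (rule order_trans)
  qed simp
qed

end
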